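(* For $\beta\in[0,1]$ let $v(\beta)$ be the speed of the excited random walk (ERW) with bias $\beta$ on $\mathbb{Z}^d$. 1. For $d\ge 8$, $v$ is differentiable on $[0,1)$. For $d\ge 6$, the derivative of $v$ at the critical point $0$ exists, is positive, and satisfies $$\lim_{\beta\to0}\frac{v(\beta)}{\beta}=\frac1d R(0),$$ where $R(0):=\lim_{n\to\infty}R_n/n$ and $R_n$ is the number of points visited at time $n$ by the symmetric simple random walk on $\mathbb{Z}^d$. 2. There exist $d_0\in\mathbb{N}^*$ and $\beta_0\in(0,1)$ such that $v$ is strictly increasing in $\beta\in[0,1]$ for every $d\ge d_0$, and strictly increasing in $\beta\in[0,\beta_0)$ for every $d\ge 8$.
   Context: **ERW.** Given $\beta\in[0,1]$, the excited random walk with bias $\beta$ is the nearest neighbour process $(Y_n)_{n\ge0}$ on $\mathbb{Z}^d$ with law $\mathbb{P}_\beta$ such that $Y_0=0$; $\mathbb{P}_\beta[Y_{n+1}-Y_n=\pm e_i\mid Y_0,\dots,Y_n]=\frac1{2d}$ for $2\le i\le d$; and $\mathbb{P}_\beta[Y_{n+1}-Y_n=\pm e_1\mid Y_0,\dots,Y_n]=\frac{1\pm\beta}{2d}$ if $Y_n\notin\{Y_0,\dots,Y_{n-1}\}$, and $=\frac1{2d}$ otherwise. **Speed.** $v(\beta)$ is the deterministic almost sure limit of $(Y_n\cdot e_1)/n$ under $\mathbb{P}_\beta$ (its existence is known). Derivatives at $0$ are right derivatives. **Range.** $R_n$ is the number of distinct sites visited by the simple symmetric random walk on $\mathbb{Z}^d$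 at times $0,\dots,n-1$ (the convention about the endpoint does not affect $R(0)$); the limit $R(0)$ exists almost surely and is a constant. *)

theory Defs
  imports "HOL-Probability.Probability" "HOL-Library.Poly_Mapping"
begin

text \<open>
  The dimension varies inside the theorem, so \<open>\<int>\<^sup>d\<close> is realised inside the finitely supported
  functions \<open>nat \<Rightarrow>\<^sub>0 int\<close>, with coordinates indexed by \<open>1, \<dots>, d\<close>: the vector \<open>e\<^sub>i\<close> is
  \<open>Poly_Mapping.single i 1\<close>, and \<open>y \<cdot> e\<^sub>i\<close> is \<open>Poly_Mapping.lookup y i\<close>. A walk which starts at \<open>0\<close> and whose steps
  are \<open>\<plusminus> e\<^sub>1, \<dots>, \<plusminus> e\<^sub>d\<close> never leaves this copy of \<open>\<int>\<^sup>d\<close>.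
\<close>

type_synonym site = "nat \<Rightarrow>\<^sub>0 int"

abbreviation path_space :: "(nat \<Rightarrow> site) measure" where
  "path_space \<equiv> \<Pi>\<^sub>M n\<in>UNIV. count_space UNIV"

text \<open>
  The number \<open>p n y i s\<close> (with \<open>s = \<plusminus>1\<close>) is the conditional probability of the step
  \<open>Y\<^bsub>n+1\<^esub> - Y\<^sub>n = s e\<^sub>i\<close> given \<open>Y\<^sub>0 = y 0, \<dots>, Y\<^sub>n = y n\<close>. Sites being countable, conditioning on
  \<open>Y\<^sub>0, \<dots>, Y\<^sub>n\<close> amounts to conditioning on the histories of positive probability.
\<close>

definition is_walk_law ::
    "nat \<Rightarrow> (nat \<Rightarrow> (nat \<Rightarrow> site) \<Rightarrow> nat \<Rightarrow> int \<Rightarrow> real) \<Rightarrow> (nat \<Rightarrow> site) measure \<Rightarrow> bool" where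
  "is_walk_law d p P \<longleftrightarrow>
     prob_space P \<and> sets P = sets path_space \<and>
     \<P>(\<omega> in P. \<omega> 0 = 0) = 1 \<and>
     (\<forall>n y. \<P>(\<omega> in P. \<forall>k\<le>n. \<omega> k = y k) > 0 \<longrightarrow>
        (\<forall>i\<in>{1..d}. \<forall>s\<in>{1, -1}.
           \<P>(\<omega> in P. \<omega> (Suc n) - \<omega> n = Poly_Mapping.single i s \<bar> \<forall>k\<le>n. \<omega> k = y k) = p n y i s))"

definition walk_law ::
    "nat \<Rightarrow> (nat \<Rightarrow> (nat \<Rightarrow> site) \<Rightarrow> nat \<Rightarrow> int \<Rightarrow> real) \<Rightarrow> (nat \<Rightarrow> site) measure" where
  "walk_law d p = (THE P. is_walk_law d p P)"

definition srw_prob :: "nat \<Rightarrow> nat \<Rightarrow> (nat \<Rightarrow> site) \<Rightarrow> nat \<Rightarrow> int \<Rightarrow> real" where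
  "srw_prob d n y i s = 1 / (2 * real d)"

definition erw_prob :: "nat \<Rightarrow> real \<Rightarrow> nat \<Rightarrow> (nat \<Rightarrow> site) \<Rightarrow> nat \<Rightarrow> int \<Rightarrow> real" where
  "erw_prob d \<beta> n y i s =
     (if i = 1 \<and> y n \<notin> y ` {..<n} then (1 + of_int s * \<beta>) / (2 * real d) else 1 / (2 * real d))"

definition srw_law :: "nat \<Rightarrow> (nat \<Rightarrow> site) measure" where
  "srw_law d = walk_law d (srw_prob d)"

definition erw_law :: "nat \<Rightarrow> real \<Rightarrow> (nat \<Rightarrow> site) measure" where
  "erw_law d \<beta> = walk_law d (erw_prob d \<beta>)"

definition speed :: "nat \<Rightarrow> real \<Rightarrow> real" where
  "speed d \<beta> =
     (THE v. AE \<omega> in erw_law d \<beta>. (\<lambda>n. of_int (Poly_Mapping.lookup (\<omega> n) 1) / real n) \<longlonglongrightarrow> v)"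

definition range_rate :: "nat \<Rightarrow> real" where
  "range_rate d =
     (THE r. AE \<omega> in srw_law d. (\<lambda>n. real (card (\<omega> ` {..<n})) / real n) \<longlonglongrightarrow> r)"

text \<open>
  Well-definedness: the laws above exist and are unique (by the Ionescu-Tulcea theorem), so that
  \<open>walk_law\<close> denotes the intended measure.
\<close>

lemma countable_sites: "countable (UNIV :: site set)"
proof -
  define f :: "site \<Rightarrow> (nat \<times> int) set" where
    "f x = (\<lambda>k. (k, Poly_Mapping.lookup x k)) ` Poly_Mapping.keys x" for x
  have "x = y" if "f x = f y" for x y
  proof (rule poly_mapping_eqI)
    fix k
    have *: "(k, v) \<in> f z \<longleftrightarrow> v \<noteq> 0 \<and> v = Poly_Mapping.lookup z k" for v and z :: site
      by (auto simp: f_def in_keys_iff)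
    show "Poly_Mapping.lookup x k = Poly_Mapping.lookup y k"
      using that *[of _ x] *[of _ y] by metis
  qed
  then have "inj f" by (auto intro: injI)
  moreover have "range f \<subseteq> Collect finite" by (auto simp: f_def)
  ultimately show ?thesis
    by (meson countable_Collect_finite countable_image_inj_on countable_subset)
qed

lemma PiM_sites:
  "finite J \<Longrightarrow> PiM J (\<lambda>_. count_space (UNIV :: site set)) = count_space (PiE J (\<lambda>_. UNIV))"
  by (intro count_space_PiM_finite countable_sites)

lemma sets_event:
  assumes "sets P = sets path_space" "finite J"
    "\<And>\<omega> \<omega>'. (\<forall>k\<in>J. \<omega> k = \<omega>' k) \<Longrightarrow> Q \<omega> \<longleftrightarrow> Q \<omega>'"
  shows "{\<omega> \<in> space P. Q \<omega>} \<in> sets P"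
proof -
  have sp: "space P = UNIV" using sets_eq_imp_space_eq[OF assms(1)] by (simp add: space_PiM)
  have *: "(\<lambda>\<omega>. restrict \<omega> J) \<in> P \<rightarrow>\<^sub>M count_space (PiE J (\<lambda>_. UNIV))"
    unfolding PiM_sites[OF assms(2), symmetric] measurable_cong_sets[OF assms(1) refl]
    by (rule measurable_restrict_subset) simp
  have "{\<omega> \<in> space P. Q \<omega>} = (\<lambda>\<omega>. restrict \<omega> J) -` {f \<in> PiE J (\<lambda>_. UNIV). Q f} \<inter> space P"
    using assms(3)[of "restrict _ J"] by (auto simp: sp)
  also have "\<dots> \<in> sets P"
    by (rule measurable_sets[OF *]) auto
  finally show ?thesis .
qed

lemma measure_eq_paths:
  assumes "prob_space P" "prob_space Q" "sets P = sets path_space" "sets Q = sets path_space"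
    and eq: "\<And>n y. \<P>(\<omega> in P. \<forall>k\<le>n. \<omega> k = y k) = \<P>(\<omega> in Q. \<forall>k\<le>n. \<omega> k = y k)"
  shows "P = Q"
proof (rule measure_eqI_PiM_infinite[OF assms(3,4)])
  interpret P: prob_space P by fact
  interpret Q: prob_space Q by fact
  show "finite_measure P" by unfold_locales
  have sP: "space P = UNIV" and sQ: "space Q = UNIV"
    using sets_eq_imp_space_eq[OF assms(3)] sets_eq_imp_space_eq[OF assms(4)] by (simp_all add: space_PiM)
  fix A and J :: "nat set" assume J: "finite J"
  obtain n where n: "J \<subseteq> {..n}" using J finite_nat_iff_bounded_le by auto
  let ?J = "{..n}" and ?r = "\<lambda>\<omega>::nat \<Rightarrow> site. restrict \<omega> {..n}"
  let ?C = "count_space (PiE ?J (\<lambda>_. UNIV :: site set))"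
  have mP: "?r \<in> P \<rightarrow>\<^sub>M ?C" and mQ: "?r \<in> Q \<rightarrow>\<^sub>M ?C"
    unfolding PiM_sites[OF finite_atMost, symmetric] measurable_cong_sets[OF assms(3) refl]
      measurable_cong_sets[OF assms(4) refl]
    by (rule measurable_restrict_subset; simp)+
  have "distr P ?C ?r = distr Q ?C ?r"
  proof (rule measure_eqI_countable)
    show "sets (distr P ?C ?r) = Pow (PiE ?J (\<lambda>_. UNIV))" "sets (distr Q ?C ?r) = Pow (PiE ?J (\<lambda>_. UNIV))"
      by simp_all
    show "countable (PiE ?J (\<lambda>_. UNIV :: site set))"
      by (intro countable_PiE countable_sites) simp
    fix y :: "nat \<Rightarrow> site" assume y: "y \<in> PiE ?J (\<lambda>_. UNIV)"
    have *: "?r -` {y} = {\<omega>. \<forall>k\<le>n. \<omega> k = y k}"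
      using y by (auto simp: fun_eq_iff PiE_def extensional_def restrict_def)
    show "emeasure (distr P ?C ?r) {y} = emeasure (distr Q ?C ?r) {y}"
      using eq[of n y] y
      by (simp add: emeasure_distr[OF mP] emeasure_distr[OF mQ] * sP sQ
          P.emeasure_eq_measure Q.emeasure_eq_measure)
  qed
  then have **: "emeasure (distr P ?C ?r) B = emeasure (distr Q ?C ?r) B" for B by simp
  let ?E = "prod_emb UNIV (\<lambda>_. count_space (UNIV :: site set)) J (Pi\<^sub>E J A)"
  have E: "?E = ?r -` {f \<in> PiE ?J (\<lambda>_. UNIV). \<forall>j\<in>J. f j \<in> A j}"
    using n by (auto simp: prod_emb_def PiE_def Pi_def)
  have in_C: "{f \<in> PiE ?J (\<lambda>_. UNIV :: site set). \<forall>j\<in>J. f j \<in> A j} \<in> sets ?C" by auto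
  show "emeasure P ?E = emeasure Q ?E"
    using **[of "{f \<in> PiE ?J (\<lambda>_. UNIV). \<forall>j\<in>J. f j \<in> A j}"]
    unfolding emeasure_distr[OF mP in_C] emeasure_distr[OF mQ in_C] by (simp add: E sP sQ)
qed

locale walk_prob =
  fixes d :: nat and p :: "nat \<Rightarrow> (nat \<Rightarrow> site) \<Rightarrow> nat \<Rightarrow> int \<Rightarrow> real"
  assumes p_nonneg: "i \<in> {1..d} \<Longrightarrow> s \<in> {1, -1} \<Longrightarrow> 0 \<le> p n y i s"
    and p_sum: "(\<Sum>i\<in>{1..d}. \<Sum>s\<in>{1, -1}. p n y i s) = 1"
    and p_history: "(\<And>k. k \<le> n \<Longrightarrow> y k = y' k) \<Longrightarrow> p n y i s = p n y' i s"
begin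

definition steps :: "(nat \<times> int) set" where
  "steps = {1..d} \<times> {1, -1}"

definition step :: "nat \<times> int \<Rightarrow> site" where
  "step x = Poly_Mapping.single (fst x) (snd x)"

lemma finite_steps: "finite steps"
  by (simp add: steps_def)

lemma inj_step: "inj_on step steps"
proof (rule inj_onI)
  fix x y assume x: "x \<in> steps" and y: "y \<in> steps" and eq: "step x = step y"
  have "Poly_Mapping.keys (step x) = {fst x}" "Poly_Mapping.keys (step y) = {fst y}"
    using x y by (auto simp: steps_def step_def)
  then have f: "fst x = fst y" using eq by simp
  moreover have "snd x = snd y"
    using arg_cong[OF eq, of "\<lambda>z. Poly_Mapping.lookup z (fst x)"] f by (simp add: step_def)
  ultimately show "x = y" by (rule prod_eqI)
qed

lemma steps_nonneg: "x \<in> steps \<Longrightarrow> 0 \<le> p n y (fst x) (snd x)"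
  using p_nonneg by (auto simp: steps_def)

lemma steps_sum: "(\<Sum>x\<in>steps. p n y (fst x) (snd x)) = 1"
  using p_sum[of n y] unfolding steps_def sum.cartesian_product by (simp only: case_prod_unfold)

definition step_pmf :: "nat \<Rightarrow> (nat \<Rightarrow> site) \<Rightarrow> (nat \<times> int) pmf" where
  "step_pmf n y = embed_pmf (\<lambda>x. if x \<in> steps then p n y (fst x) (snd x) else 0)"

lemma pmf_step: "pmf (step_pmf n y) x = (if x \<in> steps then p n y (fst x) (snd x) else 0)"
  unfolding step_pmf_def
proof (rule pmf_embed_pmf)
  show "0 \<le> (if x \<in> steps then p n y (fst x) (snd x) else 0)" for x
    by (simp add: steps_nonneg)
  have "(\<integral>\<^sup>+ x. ennreal (if x \<in> steps then p n y (fst x) (snd x) else 0) \<partial>count_space UNIV) =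
      (\<Sum>x\<in>steps. ennreal (if x \<in> steps then p n y (fst x) (snd x) else 0))"
    by (rule nn_integral_count_space') (auto simp: finite_steps)
  also have "\<dots> = ennreal (\<Sum>x\<in>steps. p n y (fst x) (snd x))"
    by (subst sum_ennreal[symmetric]) (auto simp: steps_nonneg)
  finally show "(\<integral>\<^sup>+ x. ennreal (if x \<in> steps then p n y (fst x) (snd x) else 0) \<partial>count_space UNIV) = 1"
    by (simp add: steps_sum)
qed

lemma set_pmf_step: "set_pmf (step_pmf n y) \<subseteq> steps"
  by (auto simp: set_pmf_iff pmf_step split: if_splits)

definition kernel :: "nat \<Rightarrow> (nat \<Rightarrow> site) \<Rightarrow> site pmf" where
  "kernel n y =
     (case n of 0 \<Rightarrow> return_pmf 0 | Suc m \<Rightarrow> map_pmf (\<lambda>x. y m + step x) (step_pmf m y))"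

lemma pmf_kernel:
  assumes "x \<in> steps"
  shows "pmf (kernel (Suc n) y) (y n + step x) = p n y (fst x) (snd x)"
proof -
  have inj: "inj_on (\<lambda>x. y n + step x) steps"
    using inj_step by (auto simp: inj_on_def)
  have "pmf (kernel (Suc n) y) (y n + step x) =
      measure (step_pmf n y) ((\<lambda>x. y n + step x) -` {y n + step x})"
    by (simp add: kernel_def pmf_map)
  also have "\<dots> = measure (step_pmf n y) {x}"
    using inj assms set_pmf_step[of n y]
    by (intro measure_pmf.finite_measure_eq_AE) (auto simp: AE_measure_pmf_iff inj_on_def)
  finally show ?thesis
    using assms by (simp add: measure_pmf_single pmf_step)
qed

lemma kernel_history: "(\<And>k. k < n \<Longrightarrow> y k = y' k) \<Longrightarrow> kernel n y = kernel n y'"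
  using p_history[of _ y y']
  by (cases n) (auto simp: kernel_def step_pmf_def cong: if_cong)

sublocale IT: Ionescu_Tulcea "\<lambda>n y. measure_pmf (kernel n y)" "\<lambda>_. count_space UNIV"
proof
  show "(\<lambda>y. measure_pmf (kernel i y)) \<in>
      (\<Pi>\<^sub>M i\<in>{0..<i}. count_space UNIV) \<rightarrow>\<^sub>M subprob_algebra (count_space UNIV)" for i
    unfolding PiM_sites[OF finite_atLeastLessThan]
    by (auto simp: space_subprob_algebra measure_pmf.subprob_space_axioms)
qed

definition cyl :: "nat \<Rightarrow> (nat \<Rightarrow> site) \<Rightarrow> (nat \<Rightarrow> site) set" where
  "cyl n y = {\<omega>. \<forall>k<n. \<omega> k = y k}"

lemma emeasure_C_Suc:
  "emeasure (IT.C 0 (Suc n) (\<lambda>_. undefined)) {restrict y {0..<Suc n}} =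
     emeasure (IT.C 0 n (\<lambda>_. undefined)) {restrict y {0..<n}} * pmf (kernel n y) (y n)"
proof -
  let ?M = "\<lambda>n. PiM {0..<n::nat} (\<lambda>_. count_space (UNIV :: site set))"
  let ?u = "\<lambda>_. undefined :: site"
  have in_sets: "{restrict y {0..<m}} \<in> sets (?M m)" for m
    by (simp add: PiM_sites)
  have u: "?u \<in> space (?M 0)" by (simp add: space_PiM)
  have sC: "sets (IT.C 0 n ?u) = sets (?M n)" using IT.sets_C[OF u, of n] by simp
  have spC: "space (IT.C 0 n ?u) = space (?M n)" using IT.space_C[OF u, of n] by simp
  have "emeasure (IT.C 0 (Suc n) ?u) {restrict y {0..<Suc n}} =
      (\<integral>\<^sup>+ x. emeasure (IT.eP n x) {restrict y {0..<Suc n}} \<partial>IT.C 0 n ?u)"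
  proof -
    have "IT.eP n \<in> IT.C 0 n ?u \<rightarrow>\<^sub>M subprob_algebra (?M (Suc n))"
      using IT.measurable_eP[of n] by (simp add: measurable_cong_sets[OF sC refl])
    moreover have "space (IT.C 0 n ?u) \<noteq> {}" by (simp add: spC space_PiM PiE_eq_empty_iff)
    ultimately show ?thesis
      using in_sets by (simp add: emeasure_bind[where N = "?M (Suc n)"])
  qed
  also have "\<dots> = (\<integral>\<^sup>+ x. ennreal (pmf (kernel n y) (y n)) * indicator {restrict y {0..<n}} x \<partial>IT.C 0 n ?u)"
  proof (rule nn_integral_cong)
    fix x assume "x \<in> space (IT.C 0 n ?u)"
    then have x: "x \<in> space (?M n)" by (simp add: spC)
    have "emeasure (IT.eP n x) {restrict y {0..<Suc n}} =
        emeasure (kernel n x) ((\<lambda>z. x(n := z)) -` {restrict y {0..<Suc n}})"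
      using IT.emeasure_eP[OF x in_sets] by simp
    also have "(\<lambda>z. x(n := z)) -` {restrict y {0..<Suc n}} =
        (if x = restrict y {0..<n} then {y n} else {})"
    proof -
      have "x(n := z) = restrict y {0..<Suc n} \<longleftrightarrow> x = restrict y {0..<n} \<and> z = y n" for z
      proof
        have und: "x k = undefined" if "\<not> k < n" for k
          using x that by (auto simp: space_PiM PiE_def extensional_def)
        assume eq: "x(n := z) = restrict y {0..<Suc n}"
        have "x k = restrict y {0..<n} k" for k
          using fun_cong[OF eq, of k] und[of k] by (cases "k < n") auto
        moreover have "z = y n" using fun_cong[OF eq, of n] by simp
        ultimately show "x = restrict y {0..<n} \<and> z = y n" by auto
      qed (auto simp: fun_eq_iff)
      then show ?thesis by (simp add: vimage_def)
    qed
    also have "emeasure (kernel n x) \<dots> = ennreal (pmf (kernel n y) (y n)) * indicator {restrict y {0..<n}} x"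
      using kernel_history[of n "restrict y {0..<n}" y] by (auto simp: emeasure_pmf_single)
    finally show "emeasure (IT.eP n x) {restrict y {0..<Suc n}} =
        ennreal (pmf (kernel n y) (y n)) * indicator {restrict y {0..<n}} x" .
  qed
  also have "\<dots> = pmf (kernel n y) (y n) * emeasure (IT.C 0 n ?u) {restrict y {0..<n}}"
    by (subst nn_integral_cmult_indicator) (use in_sets sC in auto)
  finally show ?thesis by (simp add: mult.commute)
qed

lemma emeasure_lim_cyl:
  "emeasure IT.PF.lim (cyl n y) = emeasure (IT.C 0 n (\<lambda>_. undefined)) {restrict y {0..<n}}"
proof -
  let ?X = "{restrict y {0..<n}}"
  have X: "?X \<in> sets (PiM {0..<n} (\<lambda>_. count_space UNIV))" by (simp add: PiM_sites)
  have "cyl n y = IT.PF.emb UNIV {0..<n} ?X"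
    by (auto simp: cyl_def prod_emb_def fun_eq_iff restrict_def split: if_splits)
  then have "emeasure IT.PF.lim (cyl n y) = emeasure (IT.CI {0..<n}) ?X"
    using IT.lim[OF finite_atLeastLessThan X] by simp
  also have "\<dots> = emeasure (IT.C 0 n (\<lambda>_. undefined)) (IT.PF.emb {0..<n} {0..<n} ?X)"
    by (rule IT.emeasure_CI[OF _ X]) simp
  also have "IT.PF.emb {0..<n} {0..<n} ?X = ?X"
    by (rule prod_emb_id) simp
  finally show ?thesis .
qed

lemma measure_lim_cyl_Suc:
  "measure IT.PF.lim (cyl (Suc n) y) = measure IT.PF.lim (cyl n y) * pmf (kernel n y) (y n)"
  using emeasure_C_Suc[of n y, folded emeasure_lim_cyl]
  by (simp only: measure_def enn2real_mult) simp

lemma cyl_0: "cyl 0 y = space IT.PF.lim"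
  unfolding IT.PF.space_lim by (auto simp: cyl_def space_PiM)

lemma prob_lim: "prob_space IT.PF.lim"
proof
  have "emeasure IT.PF.lim (cyl 0 (\<lambda>_. 0)) = 1"
    unfolding emeasure_lim_cyl by (simp add: PiM_sites restrict_def)
  then show "emeasure IT.PF.lim (space IT.PF.lim) = 1" by (simp only: cyl_0)
qed

lemma is_walk_law_lim: "is_walk_law d p IT.PF.lim"
  unfolding is_walk_law_def
proof (intro conjI allI impI ballI)
  let ?L = IT.PF.lim
  interpret prob_space ?L by (rule prob_lim)
  show "prob_space ?L" by (rule prob_lim)
  show "sets ?L = sets path_space" by simp
  have sp: "space ?L = UNIV" by (simp add: space_PiM)
  have "measure ?L (cyl (Suc 0) (\<lambda>_. 0)) = 1"
    by (simp only: measure_lim_cyl_Suc cyl_0 prob_space) (simp add: kernel_def)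
  then show "\<P>(\<omega> in ?L. \<omega> 0 = 0) = 1" unfolding sp by (simp add: cyl_def)
  fix n y i and s :: int
  assume pos: "\<P>(\<omega> in ?L. \<forall>k\<le>n. \<omega> k = y k) > 0" and i: "i \<in> {1..d}" and s: "s \<in> {1, -1}"
  let ?y = "y(Suc n := y n + step (i, s))"
  have x: "(i, s) \<in> steps" using i s by (simp add: steps_def)
  have c: "{\<omega> \<in> space ?L. \<forall>k\<le>n. \<omega> k = y k} = cyl (Suc n) y"
    unfolding sp by (auto simp: cyl_def less_Suc_eq_le)
  have c': "{\<omega> \<in> space ?L. \<omega> (Suc n) - \<omega> n = Poly_Mapping.single i s \<and> (\<forall>k\<le>n. \<omega> k = y k)} =
      cyl (Suc (Suc n)) ?y"
  proof -
    have "\<omega> \<in> cyl (Suc (Suc n)) ?y \<longleftrightarrow>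
        \<omega> (Suc n) - \<omega> n = Poly_Mapping.single i s \<and> (\<forall>k\<le>n. \<omega> k = y k)" for \<omega>
      by (auto simp: cyl_def step_def less_Suc_eq_le algebra_simps le_Suc_eq)
    then show ?thesis unfolding sp by auto
  qed
  have h: "measure ?L (cyl (Suc n) ?y) = measure ?L (cyl (Suc n) y)"
    by (rule arg_cong[where f = "measure ?L"]) (auto simp: cyl_def)
  have k: "kernel (Suc n) ?y = kernel (Suc n) y" by (rule kernel_history) simp
  have "measure ?L (cyl (Suc (Suc n)) ?y) = measure ?L (cyl (Suc n) y) * p n y i s"
    unfolding measure_lim_cyl_Suc[of "Suc n"] h k using pmf_kernel[OF x, of n y] by simp
  then show "\<P>(\<omega> in ?L. \<omega> (Suc n) - \<omega> n = Poly_Mapping.single i s \<bar> \<forall>k\<le>n. \<omega> k = y k) = p n y i s"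
    using pos unfolding cond_prob_def c c' by simp
qed

lemma walk_law_cylinder:
  assumes P: "is_walk_law d p P"
  shows "\<P>(\<omega> in P. \<forall>k\<le>n. \<omega> k = y k) = measure IT.PF.lim (cyl (Suc n) y)"
proof -
  interpret P: prob_space P using P by (simp add: is_walk_law_def)
  interpret L: prob_space IT.PF.lim by (rule prob_lim)
  have sP: "sets P = sets path_space" using P by (simp add: is_walk_law_def)
  have sp: "space P = UNIV" using sets_eq_imp_space_eq[OF sP] by (simp add: space_PiM)
  let ?H = "\<lambda>n y. {\<omega> \<in> space P. \<forall>k\<le>n. \<omega> k = y k}"
  have H[measurable]: "?H n y \<in> sets P" for n and y :: "nat \<Rightarrow> site"
    by (rule sets_event[OF sP, of "{..n}"]) auto
  show ?thesis
  proof (induction n arbitrary: y)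
    case 0
    have z: "P.prob {\<omega> \<in> space P. \<omega> 0 = 0} = 1" using P by (simp add: is_walk_law_def)
    have L0: "measure IT.PF.lim (cyl (Suc 0) y) = (if y 0 = 0 then 1 else 0)"
      by (simp only: measure_lim_cyl_Suc cyl_0 L.prob_space) (simp add: kernel_def)
    have "P.prob (?H 0 y) = 0" if "y 0 \<noteq> 0"
    proof -
      have "{\<omega> \<in> space P. \<omega> 0 = 0} \<in> sets P" using H[of 0 "\<lambda>_. 0"] by simp
      then have "P.prob (space P - {\<omega> \<in> space P. \<omega> 0 = 0}) = 0" using P.prob_compl z by simp
      moreover have "P.prob (?H 0 y) \<le> P.prob (space P - {\<omega> \<in> space P. \<omega> 0 = 0})"
        using that \<open>{\<omega> \<in> space P. \<omega> 0 = 0} \<in> sets P\<close> by (intro P.finite_measure_mono) auto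
      ultimately show ?thesis using measure_nonneg[of P "?H 0 y"] by linarith
    qed
    then show ?case using L0 z by auto
  next
    case (Suc n)
    let ?q = "P.prob (?H n y)"
    have IH: "measure IT.PF.lim (cyl (Suc n) y) = ?q" using Suc by simp
    have mono: "P.prob (?H (Suc n) y) \<le> ?q"
      by (rule P.finite_measure_mono[OF _ H]) auto
    show ?case
    proof (cases "?q > 0")
      case False
      then have "?q = 0" using measure_nonneg[of P "?H n y"] by linarith
      then show ?thesis
        using mono measure_nonneg[of P "?H (Suc n) y"] IH by (simp add: measure_lim_cyl_Suc[of "Suc n"])
    next
      case True
      let ?E = "\<lambda>x. {\<omega> \<in> space P. \<omega> (Suc n) - \<omega> n = step x \<and> (\<forall>k\<le>n. \<omega> k = y k)}"
      have E: "?E x \<in> sets P" for x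
        by (rule sets_event[OF sP, of "{..Suc n}"]) auto
      have pE: "P.prob (?E x) = ?q * p n y (fst x) (snd x)" if "x \<in> steps" for x
      proof -
        have "\<P>(\<omega> in P. \<omega> (Suc n) - \<omega> n = Poly_Mapping.single (fst x) (snd x) \<bar> \<forall>k\<le>n. \<omega> k = y k) =
            p n y (fst x) (snd x)"
          using P True that unfolding is_walk_law_def steps_def by auto
        then show ?thesis using True by (auto simp: cond_prob_def step_def field_simps)
      qed
      show ?thesis
      proof (cases "\<exists>x\<in>steps. y (Suc n) = y n + step x")
        case True
        then obtain x where x: "x \<in> steps" "y (Suc n) = y n + step x" by auto
        have "?H (Suc n) y = ?E x"
          using x by (auto simp: le_Suc_eq algebra_simps)
        then have "P.prob (?H (Suc n) y) = ?q * p n y (fst x) (snd x)" using pE x by simp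
        also have "\<dots> = measure IT.PF.lim (cyl (Suc (Suc n)) y)"
          unfolding measure_lim_cyl_Suc[of "Suc n"] IH using pmf_kernel[OF x(1), of n y] x by simp
        finally show ?thesis .
      next
        case False
        then have "pmf (kernel (Suc n) y) (y (Suc n)) = 0"
          using set_pmf_step[of n y] by (force simp: pmf_eq_0_set_pmf kernel_def)
        moreover have "P.prob (?H (Suc n) y) = 0"
        proof -
          have dE: "disjoint_family_on ?E steps"
            using inj_step by (fastforce simp: disjoint_family_on_def inj_on_def)
          have U: "P.prob (\<Union>x\<in>steps. ?E x) = ?q"
          proof -
            have "?E ` steps \<subseteq> sets P" using E by blast
            from P.finite_measure_finite_Union[OF finite_steps this dE] show ?thesis
              by (simp add: pE sum_distrib_left[symmetric] steps_sum)
          qed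
          have mU: "(\<Union>x\<in>steps. ?E x) \<in> sets P" using E finite_steps by auto
          have "?H (Suc n) y \<inter> (\<Union>x\<in>steps. ?E x) = {}"
          proof -
            have ne: "y (Suc n) - y n \<noteq> step x" if "x \<in> steps" for x
              using \<open>\<not> (\<exists>x\<in>steps. y (Suc n) = y n + step x)\<close> that by (metis add.commute diff_add_cancel)
            have "\<omega> \<notin> ?E x" if "\<omega> \<in> ?H (Suc n) y" "x \<in> steps" for \<omega> x
              using that(1) ne[OF that(2)] by auto
            then show ?thesis by blast
          qed
          then have "P.prob (?H (Suc n) y) + ?q = P.prob (?H (Suc n) y \<union> (\<Union>x\<in>steps. ?E x))"
            using U by (subst P.finite_measure_Union[OF H mU]) auto
          also have "\<dots> \<le> ?q"
            by (rule P.finite_measure_mono[OF _ H]) auto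
          finally show ?thesis using measure_nonneg[of P "?H (Suc n) y"] by linarith
        qed
        ultimately show ?thesis by (simp add: measure_lim_cyl_Suc[of "Suc n"])
      qed
    qed
  qed
qed

lemma ex1_walk_law: "\<exists>!P. is_walk_law d p P"
proof (rule ex1I)
  show "is_walk_law d p IT.PF.lim" by (rule is_walk_law_lim)
  fix P assume P: "is_walk_law d p P"
  have "\<P>(\<omega> in P. \<forall>k\<le>n. \<omega> k = y k) = \<P>(\<omega> in IT.PF.lim. \<forall>k\<le>n. \<omega> k = y k)" for n y
    by (simp only: walk_law_cylinder[OF P] walk_law_cylinder[OF is_walk_law_lim])
  then show "P = IT.PF.lim"
    using P is_walk_law_lim by (intro measure_eq_paths) (auto simp: is_walk_law_def)
qed

lemma is_walk_law_walk_law: "is_walk_law d p (walk_law d p)"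
  unfolding walk_law_def by (rule theI'[OF ex1_walk_law])

end

lemma is_walk_law_srw_law:
  assumes "d > 0"
  shows "is_walk_law d (srw_prob d) (srw_law d)"
proof -
  interpret walk_prob d "srw_prob d"
    using assms by unfold_locales (auto simp: srw_prob_def)
  show ?thesis unfolding srw_law_def by (rule is_walk_law_walk_law)
qed

lemma is_walk_law_erw_law:
  assumes "d > 0" "0 \<le> \<beta>" "\<beta> \<le> 1"
  shows "is_walk_law d (erw_prob d \<beta>) (erw_law d \<beta>)"
proof -
  interpret walk_prob d "erw_prob d \<beta>"
  proof
    have "(\<Sum>s\<in>{1, -1}. erw_prob d \<beta> n y i s) = 1 / real d" for n y i
      using assms by (simp add: erw_prob_def field_simps)
    then show "(\<Sum>i\<in>{1..d}. \<Sum>s\<in>{1, -1}. erw_prob d \<beta> n y i s) = 1" for n y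
      using assms by simp
    show "erw_prob d \<beta> n y i s = erw_prob d \<beta> n y' i s"
      if "\<And>k. k \<le> n \<Longrightarrow> y k = y' k" for n y y' i s
    proof -
      have "y ` {..<n} = y' ` {..<n}" by (rule image_cong) (use that in auto)
      then show ?thesis using that by (simp add: erw_prob_def)
    qed
  qed (use assms in \<open>auto simp: erw_prob_def\<close>)
  show ?thesis unfolding erw_law_def by (rule is_walk_law_walk_law)
qed

end

(*
  The drift of the walk comes only from new sites, so v(beta) = (beta / d) r(beta), where r(beta) is the
  asymptotic density of new sites. Drive the walk by i.i.d. letters of which only a Bernoulli(beta) mark
  depends on beta. Whether the walk is at a new site at time n depends only on the letters after any time c
  such that the projection of the walk orthogonal to e_1 never revisits, after c, a site seen before c. The
  projection is a random walk which does not feel the excitation, hence the probability q_m that a window of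
  m steps contains no such cut time bounds every memory effect, uniformly in beta. The q_m have averages of
  order n^(-1/4) if d >= 6 and are summable, with a bound uniform in d, if d >= 8.

  From d >= 6: the density of new sites at time n converges uniformly in beta, so r is continuous, and a
  variance bound gives the laws of large numbers. From d >= 8: by Russo's formula the derivatives in beta
  converge uniformly and are O(1/d), so that beta r(beta) increases as soon as r is bounded below.
*)
theory Submission
  imports Defs "HOL-Library.Function_Algebras" "HOL-Real_Asymp.Real_Asymp"
begin

section \<open>Expectations over finite words\<close>

text \<open>Cut times are taken relative to a finite word, so every estimate is about finite sums
  and neither two-sided walks nor a regeneration structure on infinite paths enter. The price is
  that the probability of having no cut time must be bounded uniformly over the length of the past.
  It is not bounded window by window: the sum over all window lengths satisfies a self-consistent
  inequality. When a candidate cut time fails, the walk restarts with the sites already seen as a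
  finite obstacle set, and the bound aimed at, the size of the obstacle set plus a constant,
  reproduces itself, because after r steps there are at most r obstacles. A factor r thus multiplies
  the return probabilities at each restart, and a past of arbitrary length costs one more such
  factor. A single letter has weight of order 1/d, so constants uniform in d require letters to be
  grouped by their projected increment. The factor 1/d in the derivative comes from the only pair of
  letters for which the mark matters.\<close>

primrec expect :: "'x set \<Rightarrow> ('x \<Rightarrow> real) \<Rightarrow> nat \<Rightarrow> ('x list \<Rightarrow> real) \<Rightarrow> real" where
  "expect S w 0 f = f []"
| "expect S w (Suc n) f = (\<Sum>x\<in>S. w x * expect S w n (\<lambda>xs. f (x # xs)))"

lemma expect_cong:
  assumes "\<And>xs. set xs \<subseteq> S \<Longrightarrow> length xs = n \<Longrightarrow> f xs = g xs"
  shows "expect S w n f = expect S w n g"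
  using assms
proof (induction n arbitrary: f g)
  case (Suc n)
  have "expect S w n (\<lambda>xs. f (x # xs)) = expect S w n (\<lambda>xs. g (x # xs))" if "x \<in> S" for x
    using that Suc.prems by (intro Suc.IH) auto
  then show ?case by simp
qed simp

lemma expect_add: "expect S w n (\<lambda>xs. f xs + g xs) = expect S w n f + expect S w n g"
  by (induction n arbitrary: f g) (simp_all add: distrib_left sum.distrib)

lemma expect_cmult: "expect S w n (\<lambda>xs. c * f xs) = c * expect S w n f"
  by (induction n arbitrary: f) (simp_all add: sum_distrib_left mult_ac)

lemma expect_diff: "expect S w n (\<lambda>xs. f xs - g xs) = expect S w n f - expect S w n g"
  using expect_add[of S w n f "\<lambda>xs. - 1 * g xs"] by (simp add: expect_cmult[of S w n "-1" g, simplified])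

lemma expect_zero: "expect S w n (\<lambda>_. 0) = 0"
  by (induction n) simp_all

lemma expect_sum: "expect S w n (\<lambda>xs. \<Sum>i\<in>I. f i xs) = (\<Sum>i\<in>I. expect S w n (f i))"
  by (induction I rule: infinite_finite_induct) (simp_all add: expect_zero expect_add)

lemma expect_append: "expect S w (m + n) f = expect S w m (\<lambda>xs. expect S w n (\<lambda>ys. f (xs @ ys)))"
  by (induction m arbitrary: f) simp_all

locale iid_lists =
  fixes S :: "'x set" and w :: "'x \<Rightarrow> real"
  assumes finite_S: "finite S" and w_nonneg: "x \<in> S \<Longrightarrow> 0 \<le> w x" and w_sum: "sum w S = 1"
begin

abbreviation E :: "nat \<Rightarrow> ('x list \<Rightarrow> real) \<Rightarrow> real" where
  "E \<equiv> expect S w"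

lemma E_mono:
  assumes "\<And>xs. set xs \<subseteq> S \<Longrightarrow> length xs = n \<Longrightarrow> f xs \<le> g xs"
  shows "E n f \<le> E n g"
  using assms
proof (induction n arbitrary: f g)
  case (Suc n)
  have "E n (\<lambda>xs. f (x # xs)) \<le> E n (\<lambda>xs. g (x # xs))" if "x \<in> S" for x
    using that Suc.prems by (intro Suc.IH) auto
  then show ?case by (auto intro!: sum_mono mult_left_mono w_nonneg)
qed simp

lemma E_const: "E n (\<lambda>_. c) = c"
  by (induction n) (simp_all add: w_sum sum_distrib_right[symmetric])

lemma E_nonneg: "(\<And>xs. set xs \<subseteq> S \<Longrightarrow> length xs = n \<Longrightarrow> 0 \<le> f xs) \<Longrightarrow> 0 \<le> E n f"
  using E_mono[of n "\<lambda>_. 0" f] by (simp add: E_const)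

lemma E_le_const: "(\<And>xs. set xs \<subseteq> S \<Longrightarrow> length xs = n \<Longrightarrow> f xs \<le> c) \<Longrightarrow> E n f \<le> c"
  using E_mono[of n f "\<lambda>_. c"] by (simp add: E_const)

lemma E_abs: "\<bar>E n f\<bar> \<le> E n (\<lambda>xs. \<bar>f xs\<bar>)"
proof -
  have "E n f \<le> E n (\<lambda>xs. \<bar>f xs\<bar>)" "E n (\<lambda>xs. - 1 * f xs) \<le> E n (\<lambda>xs. \<bar>f xs\<bar>)"
    by (auto intro!: E_mono)
  then show ?thesis unfolding expect_cmult by linarith
qed

lemma E_take:
  assumes "m \<le> n"
  shows "E n (\<lambda>xs. f (take m xs)) = E m f"
proof -
  have "E (m + (n - m)) (\<lambda>xs. f (take m xs)) = E m f"
    unfolding expect_append by (intro expect_cong) (simp add: E_const)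
  then show ?thesis using assms by simp
qed

lemma E_drop:
  assumes "m \<le> n"
  shows "E n (\<lambda>xs. f (drop (n - m) xs)) = E m f"
proof -
  have "E (n - m + m) (\<lambda>xs. f (drop (n - m) xs)) = E (n - m) (\<lambda>_. E m f)"
    unfolding expect_append by (intro expect_cong) simp
  then show ?thesis using assms by (simp add: E_const)
qed

text \<open>Each letter is only asked to share the increment of \<open>x0\<close>: a single letter
  may have very small weight, while the class of letters with a common projected increment will keep
  a mass bounded below in all dimensions. Hence the condition that \<open>f\<close> sees the word
  through its increments.\<close>

lemma E_replicate:
  assumes "x0 \<in> S" "0 \<le> p0" "p0 \<le> (\<Sum>x\<in>{x\<in>S. inc x = inc x0}. w x)" "\<And>xs. 0 \<le> f xs"
    and "\<And>xs ys. map inc xs = map inc ys \<Longrightarrow> f xs = f ys"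
  shows "p0 ^ n * f (replicate n x0) \<le> E n f"
  using assms(4,5)
proof (induction n arbitrary: f)
  case 0
  show ?case by simp
next
  case (Suc n)
  let ?X = "{x\<in>S. inc x = inc x0}"
  have "p0 ^ Suc n * f (replicate (Suc n) x0) = p0 * (p0 ^ n * f (x0 # replicate n x0))" by simp
  also have "\<dots> \<le> (\<Sum>x\<in>?X. w x) * E n (\<lambda>xs. f (x0 # xs))"
  proof (rule mult_mono[OF assms(3)])
    show "p0 ^ n * f (x0 # replicate n x0) \<le> E n (\<lambda>xs. f (x0 # xs))"
      by (rule Suc.IH) (simp_all add: Suc.prems(1), rule Suc.prems(2), simp)
    show "0 \<le> (\<Sum>x\<in>?X. w x)" by (intro sum_nonneg) (simp add: w_nonneg)
    show "0 \<le> p0 ^ n * f (x0 # replicate n x0)" using assms(2) Suc.prems(1) by simp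
  qed
  also have "\<dots> = (\<Sum>x\<in>?X. w x * E n (\<lambda>xs. f (x # xs)))"
  proof -
    have "E n (\<lambda>xs. f (x0 # xs)) = E n (\<lambda>xs. f (x # xs))" if "x \<in> ?X" for x
      using that by (intro expect_cong Suc.prems(2)) simp
    then show ?thesis unfolding sum_distrib_right by (intro sum.cong) auto
  qed
  also have "\<dots> \<le> (\<Sum>x\<in>S. w x * E n (\<lambda>xs. f (x # xs)))"
    using finite_S w_nonneg Suc.prems(1) by (intro sum_mono2) (auto intro!: mult_nonneg_nonneg E_nonneg)
  finally show ?case by simp
qed

end

lemma one_le_sum_of_bool:
  assumes "finite A" "x \<in> A" "P x"
  shows "(1::real) \<le> (\<Sum>x\<in>A. of_bool (P x))"
  using member_le_sum[of x A "\<lambda>x. of_bool (P x) :: real"] assms by auto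

lemma sum_of_bool_le_one:
  assumes "finite A" "\<And>x y. x \<in> A \<Longrightarrow> y \<in> A \<Longrightarrow> P x \<Longrightarrow> P y \<Longrightarrow> x = y"
  shows "(\<Sum>x\<in>A. of_bool (P x)) \<le> (1::real)"
proof (cases "\<exists>x\<in>A. P x")
  case True
  then obtain x where x: "x \<in> A" "P x" by auto
  then have "(\<Sum>y\<in>A. of_bool (P y)) = (\<Sum>y\<in>A. of_bool (y = x) :: real)"
    using assms(2) by (intro sum.cong) auto
  also have "\<dots> = 1" using x assms(1) by (simp add: of_bool_def)
  finally show ?thesis by simp
qed (simp add: sum.neutral)

section \<open>Walks as partial sums of words\<close>

definition psum :: "('x \<Rightarrow> 'a::ab_group_add) \<Rightarrow> 'x list \<Rightarrow> 'a" where
  "psum inc xs = sum_list (map inc xs)"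

lemma psum_simps [simp]:
  "psum inc [] = 0" "psum inc (x # xs) = inc x + psum inc xs" "psum inc (xs @ ys) = psum inc xs + psum inc ys"
  by (simp_all add: psum_def)

lemma psum_take_drop: "psum inc (take i (drop r xs)) = psum inc (take (r + i) xs) - psum inc (take r xs)"
  by (simp add: take_add)

lemma psum_drop: "psum inc (drop r xs) = psum inc xs - psum inc (take r xs)"
  using psum_simps(3)[of inc "take r xs" "drop r xs"] by (simp del: psum_simps)

text \<open>
  Forcing \<open>2 s\<close> steps equal to the increment of \<open>x0\<close> around a time makes it a cut time with probability at
  least \<open>1 / 2\<close>. The time \<open>T\<close> is the delay after which the next candidate for a cut time is tried.
\<close>

locale cut_walk = iid_lists S w for S :: "'x set" and w +
  fixes inc :: "'x \<Rightarrow> 'a::ab_group_add" and ht :: "'a \<Rightarrow> int" and x0 :: 'x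
    and a :: "nat \<Rightarrow> real" and s T :: nat and p0 :: real
  assumes ht_add: "ht (u + v) = ht u + ht v"
    and ht_inc: "x \<in> S \<Longrightarrow> \<bar>ht (inc x)\<bar> \<le> 1"
    and ht_x0: "ht (inc x0) = 1"
    and x0: "x0 \<in> S" "p0 \<le> (\<Sum>x\<in>{x\<in>S. inc x = inc x0}. w x)" "0 < p0"
    and conc: "E n (\<lambda>xs. of_bool (psum inc xs = z)) \<le> a n"
    and s_pos: "1 \<le> s" and sT: "s < T"
    and tail_s: "(\<Sum>t\<in>{s..n}. real t * a t) \<le> 1 / 8"
    and tail_T: "(\<Sum>t\<in>{T..n}. real t * a t) \<le> (p0 ^ (2 * s) / 2) / (4 + p0 ^ (2 * s) / 2)"
begin

section \<open>Cut times with probability bounded below\<close>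

definition \<delta> :: real where "\<delta> = p0 ^ (2 * s) / 2"

abbreviation Z :: "'x list \<Rightarrow> nat \<Rightarrow> 'a" where "Z xs i \<equiv> psum inc (take i xs)"

lemma p0_le: "p0 \<le> 1"
proof -
  have "(\<Sum>x\<in>{x\<in>S. inc x = inc x0}. w x) \<le> sum w S"
    using w_nonneg finite_S by (intro sum_mono2) auto
  then show ?thesis using x0 w_sum by simp
qed

lemma \<delta>_pos: "0 < \<delta>" and \<delta>_le: "\<delta> \<le> 1"
  using x0 p0_le power_le_one[of p0 "2 * s"] unfolding \<delta>_def by auto

lemma a_nonneg: "0 \<le> a n"
  using conc[of n 0] E_nonneg[of n "\<lambda>xs. of_bool (psum inc xs = 0)"] by simp

lemma ht_psum: "set xs \<subseteq> S \<Longrightarrow> \<bar>ht (psum inc xs)\<bar> \<le> int (length xs)"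
proof (induction xs)
  case Nil
  have "ht 0 = 0" using ht_add[of 0 0] by simp
  then show ?case by simp
next
  case (Cons x xs)
  then show ?case using ht_inc[of x] by (auto simp: ht_add)
qed

lemma ht_replicate: "ht (psum inc (replicate k x0)) = int k"
proof -
  have "ht 0 = 0" using ht_add[of 0 0] by simp
  then show ?thesis by (induction k) (simp_all add: ht_add ht_x0)
qed

text \<open>The height is additive and changes by at most 1 per step, so \<open>k\<close> steps of
  height 1 are undone by no fewer than \<open>k\<close> further steps. This makes all relevant
  returns long enough to fall into the small tail of \<open>a\<close>.\<close>

lemma cancel_replicate:
  assumes "psum inc (replicate k x0) + psum inc xs = 0" "set xs \<subseteq> S"
  shows "k \<le> length xs"
proof -
  have "ht 0 = 0" using ht_add[of 0 0] by simp
  then have "int k + ht (psum inc xs) = 0" using assms(1) ht_add ht_replicate by metis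
  then show ?thesis using ht_psum[OF assms(2)] by linarith
qed

text \<open>Time 0 is left out among the earlier times: when the walk is restarted, the site of the
  restart is counted in the obstacle set instead.\<close>

definition crossing :: "nat \<Rightarrow> 'x list \<Rightarrow> bool" where
  "crossing t xs \<longleftrightarrow> (\<exists>i\<in>{t..length xs}. \<exists>j\<in>{1..<t}. Z xs i = Z xs j)"

lemma crossing_cong:
  assumes "map inc xs = map inc ys"
  shows "crossing t xs = crossing t ys"
proof -
  have "length xs = length ys" using assms map_eq_imp_length_eq by blast
  moreover have "Z xs i = Z ys i" for i unfolding psum_def take_map[symmetric] using assms by simp
  ultimately show ?thesis unfolding crossing_def by simp
qed

text \<open>The forced block occupies the times from \<open>t - s\<close> to \<open>t + s\<close>.
  By the height, two times inside the block cannot coincide; the other coincidences are between a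
  time before the block and one in it (A), in it and after it (B), before and after it (C). In each
  case a piece of \<open>us\<close> and \<open>vs\<close> undoes at least \<open>s\<close> forced
  steps, hence has length at least \<open>s\<close>.\<close>

lemma crossing_forced_cases:
  assumes S: "set us \<subseteq> S" "set vs \<subseteq> S" and len: "length us = t - s" and t: "s < t"
    and cr: "crossing t (us @ replicate (2 * s) x0 @ vs)"
  obtains (A) \<tau> k where "\<tau> \<in> {s..t - s}" "k \<in> {s..2 * s}"
      "psum inc (drop (t - s - \<tau>) us) = - psum inc (replicate k x0)"
  | (B) v k where "v \<in> {s..length vs}" "k \<in> {Suc s..2 * s}"
      "psum inc (take v vs) = - psum inc (replicate k x0)"
  | (C) u \<tau> where "u \<in> {s..t - s + length vs}" "\<tau> \<in> {1..<u}" "\<tau> \<le> t - s" "u - \<tau> \<le> length vs"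
      "psum inc (drop (t - s - \<tau>) us @ take (u - \<tau>) vs) = - psum inc (replicate (2 * s) x0)"
proof -
  let ?R = "replicate (2 * s) x0"
  let ?xs = "us @ ?R @ vs"
  obtain i j where ij: "i \<in> {t..length ?xs}" "j \<in> {1..<t}" "Z ?xs i = Z ?xs j"
    using cr unfolding crossing_def by blast
  define k where "k = i - (t - s)"
  have k: "i = t - s + k" "s \<le> k" using ij t by (auto simp: k_def)
  have Zi: "Z ?xs i = psum inc us + (psum inc (replicate (min k (2 * s)) x0) + psum inc (take (k - 2 * s) vs))"
    unfolding k(1) by (simp add: len min_def)
  show thesis
  proof (cases "j < t - s")
    case True
    define \<tau> where "\<tau> = t - s - j"
    have \<tau>: "\<tau> \<in> {1..t - s}" "t - s - \<tau> = j" using ij True by (auto simp: \<tau>_def)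
    have Zj: "Z ?xs j = psum inc us - psum inc (drop j us)"
      using True len by (simp add: psum_drop)
    have eq: "psum inc (replicate (min k (2 * s)) x0) + psum inc (drop j us @ take (k - 2 * s) vs) = 0"
      using ij(3) unfolding Zi Zj by (simp add: algebra_simps)
    have setS: "set (drop j us @ take (k - 2 * s) vs) \<subseteq> S"
      using S set_drop_subset[of j us] set_take_subset[of "k - 2 * s" vs] by auto
    have le: "min k (2 * s) \<le> length (drop j us @ take (k - 2 * s) vs)"
      by (rule cancel_replicate[OF eq setS])
    show thesis
    proof (cases "k \<le> 2 * s")
      case True
      then have "\<tau> \<in> {s..t - s}" using le \<tau> k len by auto
      moreover have "psum inc (drop (t - s - \<tau>) us) = - psum inc (replicate k x0)"
        using eq True \<tau> by (simp add: eq_neg_iff_add_eq_0 add.commute)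
      ultimately show thesis using A[of \<tau> k] k True by auto
    next
      case False
      define u where "u = \<tau> + (k - 2 * s)"
      have kl: "k - 2 * s \<le> length vs" using ij k len t by auto
      show thesis
      proof (rule C[of u \<tau>])
        show "u \<in> {s..t - s + length vs}" using le \<tau> kl len False by (auto simp: u_def)
        show "\<tau> \<in> {1..<u}" "\<tau> \<le> t - s" using \<tau> False by (auto simp: u_def)
        show "u - \<tau> \<le> length vs" using kl by (simp add: u_def)
        show "psum inc (drop (t - s - \<tau>) us @ take (u - \<tau>) vs) = - psum inc ?R"
          using eq False \<tau> by (simp add: u_def eq_neg_iff_add_eq_0 add.commute)
      qed
    qed
  next
    case False
    define l where "l = j - (t - s)"
    have l: "j = t - s + l" "l < s" using False ij t by (auto simp: l_def)
    have Zj: "Z ?xs j = psum inc us + psum inc (replicate l x0)"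
      unfolding l(1) using l(2) by (simp add: len min_def)
    define m where "m = min k (2 * s) - l"
    have "min k (2 * s) = l + m" using l k by (simp add: m_def)
    then have "psum inc (replicate m x0) + psum inc (take (k - 2 * s) vs) = 0"
      using ij(3) unfolding Zi Zj by (simp add: replicate_add)
    note eq = this
    have setS: "set (take (k - 2 * s) vs) \<subseteq> S"
      using S set_take_subset[of "k - 2 * s" vs] by auto
    have le: "m \<le> length (take (k - 2 * s) vs)"
      by (rule cancel_replicate[OF eq setS])
    have m: "1 \<le> m" "m \<le> 2 * s" using k l s_pos by (auto simp: m_def)
    \<comment> \<open>If both times were in the block, the cancelling word would be empty, contrary
      to \<open>1 \<le> m\<close>.\<close>
    have "k > 2 * s" using le m by (cases "k > 2 * s") auto
    then have "m > s" using l by (auto simp: m_def)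
    show thesis
    proof (rule B[of "k - 2 * s" m])
      show "k - 2 * s \<in> {s..length vs}" using le \<open>m > s\<close> ij k len t by auto
      show "m \<in> {Suc s..2 * s}" using \<open>m > s\<close> m by auto
      show "psum inc (take (k - 2 * s) vs) = - psum inc (replicate m x0)"
        using eq by (simp add: eq_neg_iff_add_eq_0 add.commute)
    qed
  qed
qed

text \<open>Union bound over the three cases, indexed by the length t of the cancelling piece. The
  other parameter has at most s + 1 \<le> 2 t, s \<le> t and t values respectively, so the total is
  at most four times the tail of t * a t beyond s. This is where the constant 1/8 comes
  from.\<close>

lemma crossing_forced:
  assumes t: "s < t"
  shows "E (t - s) (\<lambda>us. E m (\<lambda>vs. of_bool (crossing t (us @ replicate (2 * s) x0 @ vs)))) \<le> 1 / 2"
proof -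
  let ?e = "\<lambda>k. - psum inc (replicate k x0)"
  let ?A = "\<lambda>us. \<Sum>\<tau>\<in>{s..t - s}. \<Sum>k\<in>{s..2 * s}. of_bool (psum inc (drop (t - s - \<tau>) us) = ?e k) :: real"
  let ?B = "\<lambda>vs. \<Sum>v\<in>{s..m}. \<Sum>k\<in>{Suc s..2 * s}. of_bool (psum inc (take v vs) = ?e k) :: real"
  let ?I = "\<lambda>u. {\<tau>\<in>{1..<u}. \<tau> \<le> t - s \<and> u - \<tau> \<le> m}"
  let ?C = "\<lambda>us vs. \<Sum>u\<in>{s..t - s + m}. \<Sum>\<tau>\<in>?I u.
    of_bool (psum inc (drop (t - s - \<tau>) us @ take (u - \<tau>) vs) = ?e (2 * s)) :: real"
  have pw: "of_bool (crossing t (us @ replicate (2 * s) x0 @ vs)) \<le> ?A us + ?B vs + ?C us vs"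
    if "set us \<subseteq> S" "length us = t - s" "set vs \<subseteq> S" "length vs = m" for us vs
  proof (cases "crossing t (us @ replicate (2 * s) x0 @ vs)")
    case cr: True
    have nn: "0 \<le> ?A us" "0 \<le> ?B vs" "0 \<le> ?C us vs" by (auto intro!: sum_nonneg)
    from that(1,3,2) t cr have "1 \<le> ?A us \<or> 1 \<le> ?B vs \<or> 1 \<le> ?C us vs"
    proof (cases rule: crossing_forced_cases)
      case (A \<tau> k)
      have "1 \<le> (\<Sum>x\<in>{s..t - s} \<times> {s..2 * s}. of_bool (psum inc (drop (t - s - fst x) us) = ?e (snd x)) :: real)"
        by (rule one_le_sum_of_bool[of _ "(\<tau>, k)"]) (use A in auto)
      then show ?thesis unfolding sum.cartesian_product by (simp add: case_prod_unfold)
    next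
      case (B v k)
      have "1 \<le> (\<Sum>x\<in>{s..m} \<times> {Suc s..2 * s}. of_bool (psum inc (take (fst x) vs) = ?e (snd x)) :: real)"
        by (rule one_le_sum_of_bool[of _ "(v, k)"]) (use B that in auto)
      then show ?thesis unfolding sum.cartesian_product by (simp add: case_prod_unfold)
    next
      case (C u \<tau>)
      have "1 \<le> (\<Sum>x\<in>Sigma {s..t - s + m} ?I.
          of_bool (psum inc (drop (t - s - snd x) us @ take (fst x - snd x) vs) = ?e (2 * s)) :: real)"
        by (rule one_le_sum_of_bool[of _ "(u, \<tau>)"]) (use C that in auto)
      then show ?thesis by (subst (asm) sum.Sigma[symmetric, of _ _ "\<lambda>u \<tau>. of_bool (psum inc (drop (t - s - \<tau>) us @ take (u - \<tau>) vs) = ?e (2 * s))", unfolded case_prod_unfold]) auto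
    qed
    then show ?thesis using nn cr by auto
  qed (auto intro!: sum_nonneg add_nonneg_nonneg)
  have EA: "E (t - s) (\<lambda>us. of_bool (psum inc (drop (t - s - \<tau>) us) = z)) \<le> a \<tau>" if "\<tau> \<le> t - s" for \<tau> z
    using E_drop[OF that, of "\<lambda>us. of_bool (psum inc us = z)"] conc[of \<tau> z] by linarith
  have EB: "E m (\<lambda>vs. of_bool (psum inc (take v vs) = z)) \<le> a v" if "v \<le> m" for v z
    using E_take[OF that, of "\<lambda>us. of_bool (psum inc us = z)"] conc[of v z] by linarith
  have EC: "E (t - s) (\<lambda>us. E m (\<lambda>vs. of_bool (psum inc (drop (t - s - \<tau>) us @ take (u - \<tau>) vs) = z))) \<le> a u"
    if \<tau>: "\<tau> \<in> ?I u" for u \<tau> z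
  proof -
    have le: "u - \<tau> \<le> m" "\<tau> \<le> t - s" "\<tau> + (u - \<tau>) = u" using \<tau> by auto
    have "E m (\<lambda>vs. of_bool (psum inc (us @ take (u - \<tau>) vs) = z)) = E (u - \<tau>) (\<lambda>vs. of_bool (psum inc (us @ vs) = z))" for us
      by (rule E_take[OF le(1)])
    then have "E (t - s) (\<lambda>us. E m (\<lambda>vs. of_bool (psum inc (drop (t - s - \<tau>) us @ take (u - \<tau>) vs) = z)))
      = E (t - s) (\<lambda>us. E (u - \<tau>) (\<lambda>vs. of_bool (psum inc (drop (t - s - \<tau>) us @ vs) = z)))" by simp
    also have "\<dots> = E \<tau> (\<lambda>us. E (u - \<tau>) (\<lambda>vs. of_bool (psum inc (us @ vs) = z)))"
      by (rule E_drop[OF le(2)])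
    also have "\<dots> = E u (\<lambda>us. of_bool (psum inc us = z))"
      using expect_append[of S w \<tau> "u - \<tau>" "\<lambda>us. of_bool (psum inc us = z)"] unfolding le(3) by (rule sym)
    finally show ?thesis using conc[of u z] by simp
  qed
  have "E (t - s) (\<lambda>us. E m (\<lambda>vs. of_bool (crossing t (us @ replicate (2 * s) x0 @ vs))))
      \<le> E (t - s) (\<lambda>us. E m (\<lambda>vs. ?A us + ?B vs + ?C us vs))"
    by (intro E_mono pw)
  also have "\<dots> = (\<Sum>\<tau>\<in>{s..t - s}. \<Sum>k\<in>{s..2 * s}. E (t - s) (\<lambda>us. of_bool (psum inc (drop (t - s - \<tau>) us) = ?e k)))
      + (\<Sum>v\<in>{s..m}. \<Sum>k\<in>{Suc s..2 * s}. E m (\<lambda>vs. of_bool (psum inc (take v vs) = ?e k)))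
      + (\<Sum>u\<in>{s..t - s + m}. \<Sum>\<tau>\<in>?I u. E (t - s) (\<lambda>us. E m (\<lambda>vs.
          of_bool (psum inc (drop (t - s - \<tau>) us @ take (u - \<tau>) vs) = ?e (2 * s)))))"
    by (simp only: expect_add expect_sum E_const)
  also have "\<dots> \<le> (\<Sum>\<tau>\<in>{s..t - s}. \<Sum>k\<in>{s..2 * s}. a \<tau>) + (\<Sum>v\<in>{s..m}. \<Sum>k\<in>{Suc s..2 * s}. a v)
      + (\<Sum>u\<in>{s..t - s + m}. \<Sum>\<tau>\<in>?I u. a u)"
    by (intro add_mono sum_mono EA EB EC) auto
  also have "\<dots> \<le> (\<Sum>\<tau>\<in>{s..t - s}. 2 * (real \<tau> * a \<tau>)) + (\<Sum>v\<in>{s..m}. real v * a v)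
      + (\<Sum>u\<in>{s..t - s + m}. real u * a u)"
  proof (intro add_mono sum_mono)
    fix \<tau> assume "\<tau> \<in> {s..t - s}"
    then have "(1 + real s) * a \<tau> \<le> (2 * real \<tau>) * a \<tau>" using s_pos by (intro mult_right_mono a_nonneg) auto
    then show "(\<Sum>k\<in>{s..2 * s}. a \<tau>) \<le> 2 * (real \<tau> * a \<tau>)" by (simp add: mult.assoc)
  next
    fix v assume "v \<in> {s..m}"
    then show "(\<Sum>k\<in>{Suc s..2 * s}. a v) \<le> real v * a v" using a_nonneg by (auto intro!: mult_right_mono)
  next
    fix u
    have "card (?I u) \<le> card {1..<u}" by (intro card_mono) auto
    then show "(\<Sum>\<tau>\<in>?I u. a u) \<le> real u * a u" using a_nonneg by (auto intro!: mult_right_mono)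
  qed
  also have "\<dots> \<le> 2 * (1 / 8) + 1 / 8 + 1 / 8"
    unfolding sum_distrib_left[symmetric] using tail_s by (intro add_mono mult_left_mono) auto
  finally show ?thesis by simp
qed

lemma crossing_prob:
  assumes t: "s < t" "t \<le> n"
  shows "E n (\<lambda>xs. of_bool (crossing t xs)) \<le> 1 - \<delta>"
proof -
  \<comment> \<open>The forced block ends at time \<open>t + s\<close>, so the word is lengthened by
    \<open>s\<close> letters. A crossing within the first \<open>n\<close> letters is also one of
    the longer word, so excluding the latter excludes the former.\<close>
  let ?R = "replicate (2 * s) x0" and ?N = "t - s + (2 * s + (n - t))"
  have N: "?N = n + s" using t by simp
  have "\<delta> \<le> p0 ^ (2 * s) * (1 - E (t - s) (\<lambda>us. E (n - t) (\<lambda>vs. of_bool (crossing t (us @ ?R @ vs)))))"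
    using crossing_forced[OF t(1), of "n - t"] x0 unfolding \<delta>_def by simp
  also have "\<dots> = E (t - s) (\<lambda>us. p0 ^ (2 * s) * E (n - t) (\<lambda>vs. 1 - of_bool (crossing t (us @ ?R @ vs))))"
    by (simp add: expect_diff E_const expect_cmult)
  also have "\<dots> \<le> E (t - s) (\<lambda>us. E (2 * s) (\<lambda>fs. E (n - t) (\<lambda>vs. 1 - of_bool (crossing t (us @ fs @ vs)))))"
  proof (rule E_mono)
    fix us :: "'x list"
    let ?f = "\<lambda>fs. E (n - t) (\<lambda>vs. 1 - of_bool (crossing t (us @ fs @ vs)))"
    show "p0 ^ (2 * s) * ?f ?R \<le> E (2 * s) ?f"
    proof (rule E_replicate[where inc = inc and f = ?f])
      show "?f xs = ?f ys" if "map inc xs = map inc ys" for xs ys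
      proof -
        have "crossing t (us @ xs @ vs) = crossing t (us @ ys @ vs)" for vs
          using that by (intro crossing_cong) simp
        then show ?thesis by simp
      qed
      show "0 \<le> ?f xs" for xs by (intro E_nonneg) simp
      show "x0 \<in> S" "0 \<le> p0" "p0 \<le> (\<Sum>x\<in>{x\<in>S. inc x = inc x0}. w x)" using x0 by simp_all
    qed
  qed
  also have "\<dots> = E ?N (\<lambda>xs. 1 - of_bool (crossing t xs))"
    by (simp only: expect_append)
  also have "\<dots> \<le> E (n + s) (\<lambda>xs. 1 - of_bool (crossing t (take n xs)))"
    unfolding N
  proof (intro E_mono)
    fix xs :: "'x list" assume "length xs = n + s"
    then have "crossing t (take n xs) \<Longrightarrow> crossing t xs"
      using t unfolding crossing_def by (fastforce simp: min_def)
    then show "1 - of_bool (crossing t xs) \<le> (1 - of_bool (crossing t (take n xs)) :: real)" by auto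
  qed
  also have "\<dots> = 1 - E n (\<lambda>xs. of_bool (crossing t xs))"
    using E_take[of n "n + s" "\<lambda>xs. 1 - of_bool (crossing t xs)"] by (simp add: expect_diff E_const)
  finally show ?thesis by simp
qed

end

section \<open>Cut times\<close>

lemma sum_triangle_shift:
  "(\<Sum>M<n. \<Sum>r\<in>{t..M}. F r (M - r)) = (\<Sum>r\<in>{t..<n}. \<Sum>m<n - r. F r m)" for n t :: nat
proof -
  have "(\<Sum>M<n. \<Sum>r\<in>{t..M}. F r (M - r)) = (\<Sum>(M, r)\<in>Sigma {..<n} (\<lambda>M. {t..M}). F r (M - r))"
    by (subst sum.Sigma) auto
  also have "\<dots> = (\<Sum>(r, m)\<in>Sigma {t..<n} (\<lambda>r. {..<n - r}). F r m)"
    by (rule sum.reindex_bij_witness[where i = "\<lambda>(r, m). (r + m, r)" and j = "\<lambda>(M, r). (r, M - r)"]) auto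
  also have "\<dots> = (\<Sum>r\<in>{t..<n}. \<Sum>m<n - r. F r m)"
    by (subst sum.Sigma) auto
  finally show ?thesis .
qed

text \<open>A time \<open>c\<close> is a cut time if the sites seen before \<open>c\<close> are
  disjoint from those seen from \<open>c\<close> on, within the word only. The first
  \<open>k\<close> letters form a past in which no cut time is sought.\<close>

definition nocut :: "('x \<Rightarrow> 'a::ab_group_add) \<Rightarrow> nat \<Rightarrow> 'x list \<Rightarrow> bool" where
  "nocut inc k xs \<longleftrightarrow> (\<forall>c. k < c \<and> c \<le> length xs \<longrightarrow>
     (\<exists>i\<in>{c..length xs}. \<exists>j<c. psum inc (take i xs) = psum inc (take j xs)))"

section \<open>Sums over window lengths without a cut time\<close>

context cut_walk
begin

lemma E_return: "j \<le> n \<Longrightarrow> E n (\<lambda>zs. of_bool (psum inc zs = Z zs j)) \<le> a (n - j)"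
proof -
  assume j: "j \<le> n"
  have "E n (\<lambda>zs. of_bool (psum inc zs = Z zs j)) = E n (\<lambda>zs. of_bool (psum inc (drop (n - (n - j)) zs) = 0))"
    using j by (intro expect_cong) (simp add: psum_drop)
  also have "\<dots> = E (n - j) (\<lambda>zs. of_bool (psum inc zs = 0))"
    by (rule E_drop) simp
  finally show ?thesis using conc[of "n - j" 0] by simp
qed

definition first_cross :: "'x list \<Rightarrow> bool" where
  "first_cross zs \<longleftrightarrow> (\<exists>j\<in>{1..<T}. psum inc zs = Z zs j) \<and>
     \<not> (\<exists>i\<in>{T..<length zs}. \<exists>j\<in>{1..<T}. Z zs i = Z zs j)"

abbreviation fc_prob :: "nat \<Rightarrow> real" where
  "fc_prob r \<equiv> E r (\<lambda>zs. of_bool (first_cross zs))"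

lemma fc_prob_nonneg: "0 \<le> fc_prob r"
  by (intro E_nonneg) simp

lemma first_cross_take:
  "T \<le> r \<Longrightarrow> r \<le> length xs \<Longrightarrow> first_cross (take r xs) \<longleftrightarrow>
    (\<exists>j\<in>{1..<T}. Z xs r = Z xs j) \<and> \<not> (\<exists>i\<in>{T..<r}. \<exists>j\<in>{1..<T}. Z xs i = Z xs j)"
  unfolding first_cross_def by (auto simp: min_def)

text \<open>The first revisit from \<open>T\<close> on happens at one time only, so the events for
  different lengths are disjoint, and each of them implies a crossing of \<open>T\<close>.\<close>

lemma sum_fc_prob: "(\<Sum>r\<in>{T..<n}. fc_prob r) \<le> 1 - \<delta>"
proof (cases "T \<le> n")
  case True
  have pw: "(\<Sum>r\<in>{T..<n}. of_bool (first_cross (take r xs))) \<le> (of_bool (crossing T xs) :: real)"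
    if len: "length xs = n" for xs
  proof (cases "crossing T xs")
    case cr: True
    have "r = r'" if "r \<in> {T..<n}" "r' \<in> {T..<n}" "first_cross (take r xs)" "first_cross (take r' xs)" for r r'
    proof -
      have *: "\<not> r < r'" if "r \<in> {T..<n}" "r' \<in> {T..<n}" "first_cross (take r xs)" "first_cross (take r' xs)" for r r'
      proof
        assume "r < r'"
        have "\<exists>j\<in>{1..<T}. Z xs r = Z xs j" using that len first_cross_take[of r xs] by auto
        moreover have "\<not> (\<exists>i\<in>{T..<r'}. \<exists>j\<in>{1..<T}. Z xs i = Z xs j)"
          using that len first_cross_take[of r' xs] by auto
        ultimately show False using \<open>r < r'\<close> that(1) by auto
      qed
      show ?thesis using *[OF that] *[OF that(2,1,4,3)] by simp
    qed
    then show ?thesis using cr sum_of_bool_le_one[of "{T..<n}" "\<lambda>r. first_cross (take r xs)"] by auto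
  next
    case False
    have "\<not> first_cross (take r xs)" if "r \<in> {T..<n}" for r
      using False that len first_cross_take[of r xs] unfolding crossing_def by auto
    then show ?thesis by (simp add: sum.neutral)
  qed
  have "(\<Sum>r\<in>{T..<n}. fc_prob r) = (\<Sum>r\<in>{T..<n}. E n (\<lambda>xs. of_bool (first_cross (take r xs))))"
    by (intro sum.cong refl E_take[symmetric]) auto
  also have "\<dots> = E n (\<lambda>xs. \<Sum>r\<in>{T..<n}. of_bool (first_cross (take r xs)))" by (simp only: expect_sum)
  also have "\<dots> \<le> E n (\<lambda>xs. of_bool (crossing T xs))" by (intro E_mono pw)
  also have "\<dots> \<le> 1 - \<delta>" using sT True by (rule crossing_prob)
  finally show ?thesis .
qed (use \<delta>_le in simp)

lemma tail_T': "(\<Sum>t\<in>{T..n}. real t * a t) \<le> \<delta> / (4 + \<delta>)"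
  using tail_T[of n] by (simp add: \<delta>_def)

lemma fc_prob_le:
  assumes "T \<le> r"
  shows "fc_prob r \<le> (\<Sum>j\<in>{1..<T}. a (r - j))"
proof -
  have "fc_prob r \<le> E r (\<lambda>zs. \<Sum>j\<in>{1..<T}. of_bool (psum inc zs = Z zs j))"
  proof (intro E_mono)
    fix zs
    show "of_bool (first_cross zs) \<le> (\<Sum>j\<in>{1..<T}. of_bool (psum inc zs = Z zs j) :: real)"
    proof (cases "first_cross zs")
      case True
      then obtain j where j: "j \<in> {1..<T}" "psum inc zs = Z zs j" unfolding first_cross_def by auto
      show ?thesis using one_le_sum_of_bool[of "{1..<T}" j "\<lambda>j. psum inc zs = Z zs j"] j True by simp
    qed (auto intro!: sum_nonneg)
  qed
  also have "\<dots> \<le> (\<Sum>j\<in>{1..<T}. a (r - j))"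
    unfolding expect_sum using assms by (intro sum_mono E_return) auto
  finally show ?thesis .
qed

text \<open>Up to r = 2 T the weight is at most 2 T and the probabilities sum to at most 1. Beyond,
  a return from time r to a time j < T takes r - j \<ge> r / 2 steps, and the tail of t * a t
  contributes at most 1 for each j. Together this is 2 T + T.\<close>

lemma sum_weighted_fc_prob: "(\<Sum>r\<in>{T..<n}. real r * fc_prob r) \<le> 3 * real T"
proof -
  let ?J = "{1..<T}"
  have "(\<Sum>r\<in>{T..<n}. real r * fc_prob r) \<le>
      (\<Sum>r\<in>{T..<n}. 2 * real T * fc_prob r + (\<Sum>j\<in>?J. if 2 * T < r then 2 * (real (r - j) * a (r - j)) else 0))"
  proof (intro sum_mono)
    fix r assume r: "r \<in> {T..<n}"
    show "real r * fc_prob r \<le> 2 * real T * fc_prob r + (\<Sum>j\<in>?J. if 2 * T < r then 2 * (real (r - j) * a (r - j)) else 0)"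
    proof (cases "2 * T < r")
      case True
      have "real r * fc_prob r \<le> real r * (\<Sum>j\<in>?J. a (r - j))"
        using r fc_prob_le by (intro mult_left_mono) auto
      also have "\<dots> \<le> (\<Sum>j\<in>?J. 2 * (real (r - j) * a (r - j)))"
        unfolding sum_distrib_left
      proof (intro sum_mono)
        fix j assume "j \<in> ?J"
        then have "real r \<le> 2 * real (r - j)" using True by auto
        then show "real r * a (r - j) \<le> 2 * (real (r - j) * a (r - j))"
          using mult_right_mono[OF _ a_nonneg] by (metis mult.assoc)
      qed
      finally show ?thesis using True fc_prob_nonneg[of r] by (simp add: add_increasing)
    next
      case False
      then show ?thesis using mult_right_mono[of "real r" "2 * real T" "fc_prob r"] fc_prob_nonneg[of r] by simp
    qed
  qed
  also have "\<dots> = 2 * real T * (\<Sum>r\<in>{T..<n}. fc_prob r)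
      + (\<Sum>j\<in>?J. \<Sum>r\<in>{T..<n}. if 2 * T < r then 2 * (real (r - j) * a (r - j)) else 0)"
    unfolding sum.distrib sum_distrib_left by (subst sum.swap) simp
  also have "\<dots> \<le> 2 * real T * 1 + (\<Sum>j\<in>?J. 1)"
  proof (intro add_mono mult_left_mono sum_mono)
    show "(\<Sum>r\<in>{T..<n}. fc_prob r) \<le> 1" using sum_fc_prob[of n] \<delta>_pos by simp
    fix j assume j: "j \<in> ?J"
    have "(\<Sum>r\<in>{T..<n}. if 2 * T < r then 2 * (real (r - j) * a (r - j)) else 0)
        = (\<Sum>r\<in>{r\<in>{T..<n}. 2 * T < r}. 2 * (real (r - j) * a (r - j)))"
      by (intro sum.inter_filter[symmetric]) simp
    also have "\<dots> = (\<Sum>u\<in>(\<lambda>r. r - j) ` {r\<in>{T..<n}. 2 * T < r}. 2 * (real u * a u))"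
      using j by (subst sum.reindex) (auto simp: inj_on_def)
    also have "\<dots> \<le> (\<Sum>u\<in>{T..n}. 2 * (real u * a u))"
      using j a_nonneg by (intro sum_mono2) auto
    also have "\<dots> = 2 * (\<Sum>u\<in>{T..n}. real u * a u)" by (simp only: sum_distrib_left)
    also have "\<dots> \<le> 2 * (\<delta> / (4 + \<delta>))" using tail_T'[of n] by simp
    also have "\<dots> \<le> 1" using \<delta>_pos \<delta>_le by (simp add: field_simps)
    finally show "(\<Sum>r\<in>{T..<n}. if 2 * T < r then 2 * (real (r - j) * a (r - j)) else 0) \<le> 1" .
  qed simp
  also have "\<dots> \<le> 3 * real T" by simp
  finally show ?thesis .
qed

text \<open>The solution of 4 T + H (1 - \<delta>) = H, the equation by which the induction in
  \<open>sum_E_cov\<close> reproduces its own bound.\<close>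

definition H :: real where "H = 4 * real T / \<delta>"

lemma H_nonneg: "0 \<le> H" using \<delta>_pos by (simp add: H_def)

text \<open>For r \<ge> T one has H \<le> (4 / \<delta>) r, which costs a factor 1 + 4 / \<delta>.
  The tail bound \<delta> / (4 + \<delta>) assumed of \<open>T\<close> is the inverse of this
  factor.\<close>

lemma sum_a_H: "(\<Sum>r\<in>{T..<n}. (real r + H) * a r) \<le> 1"
proof -
  have "(\<Sum>r\<in>{T..<n}. (real r + H) * a r) \<le> (\<Sum>r\<in>{T..n}. (1 + 4 / \<delta>) * (real r * a r))"
  proof (intro order.trans[OF sum_mono sum_mono2])
    fix r assume r: "r \<in> {T..<n}"
    then have "H \<le> 4 / \<delta> * real r" using \<delta>_pos by (auto simp: H_def field_simps)
    then have "real r + H \<le> (1 + 4 / \<delta>) * real r" by (simp add: distrib_right)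
    then show "(real r + H) * a r \<le> (1 + 4 / \<delta>) * (real r * a r)"
      using mult_right_mono[OF _ a_nonneg] by (metis mult.assoc)
  qed (use a_nonneg \<delta>_pos in auto)
  also have "\<dots> \<le> (1 + 4 / \<delta>) * (\<delta> / (4 + \<delta>))"
    unfolding sum_distrib_left[symmetric] using tail_T'[of n] \<delta>_pos by (intro mult_left_mono) auto
  also have "\<dots> = 1"
  proof -
    have "1 + 4 / \<delta> = (4 + \<delta>) / \<delta>" using \<delta>_pos by (simp add: field_simps)
    then show ?thesis using \<delta>_pos by simp
  qed
  finally show ?thesis .
qed

text \<open>The walk \<open>ys\<close> has no cut time when its past consists of the sites in \<open>A\<close>.\<close>

definition cov :: "'a set \<Rightarrow> 'x list \<Rightarrow> bool" where
  "cov A ys \<longleftrightarrow> (\<forall>c\<in>{1..length ys}. \<exists>i\<in>{c..length ys}. Z ys i \<in> A \<or> (\<exists>j\<in>{1..<c}. Z ys i = Z ys j))"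

text \<open>Positions are relative to the endpoint. The index range omits the start but contains the
  endpoint, so that the origin of the restarted walk is an obstacle.\<close>

definition past :: "'x list \<Rightarrow> 'a set" where
  "past zs = (\<lambda>j. Z zs j - psum inc zs) ` {1..length zs}"

text \<open>
  The next candidate for a cut time is \<open>T\<close>. If the walk returns to \<open>A\<close> after \<open>T\<close>, restart at the last such
  time, when \<open>A\<close> no longer matters; otherwise \<open>T\<close> is spoilt by the steps before \<open>T\<close>, with probability at
  most \<open>1 - \<delta>\<close>, and we restart at the first such time.
\<close>

lemma cov_step:
  assumes cov: "cov A ys" and len: "T \<le> length ys"
  shows "\<exists>r\<in>{T..length ys}. (Z ys r \<in> A \<or> first_cross (take r ys)) \<and> cov (past (take r ys)) (drop r ys)"
proof -
  let ?N = "length ys"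
  have past: "past (take r ys) = (\<lambda>j. Z ys j - Z ys r) ` {1..r}" if "r \<le> ?N" for r
    unfolding past_def using that by (intro image_cong) (auto simp: min_def)
  \<comment> \<open>Restarting at \<open>r\<close> is possible once \<open>A\<close> is avoided
    after \<open>r\<close>: the coincidence that spoils the time \<open>r + c\<close> is then with
    an earlier time \<open>j\<close>, which belongs to the new past if \<open>j \<le> r\<close> and
    to the restarted walk otherwise.\<close>
  have cov_drop: "cov (past (take r ys)) (drop r ys)"
    if r: "r \<le> ?N" and noA: "\<And>i. r < i \<Longrightarrow> i \<le> ?N \<Longrightarrow> Z ys i \<notin> A" for r
    unfolding cov_def
  proof
    fix c assume c: "c \<in> {1..length (drop r ys)}"
    then have "r + c \<in> {1..?N}" by auto
    then obtain i j where i: "i \<in> {r + c..?N}" and "Z ys i \<in> A \<or> j \<in> {1..<r + c} \<and> Z ys i = Z ys j"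
      using cov unfolding cov_def by blast
    then have j: "j \<in> {1..<r + c}" "Z ys i = Z ys j" using noA[of i] c by auto
    have Zi: "Z (drop r ys) (i - r) = Z ys i - Z ys r" using i by (simp add: psum_take_drop)
    have "Z (drop r ys) (i - r) \<in> past (take r ys) \<or> (\<exists>j\<in>{1..<c}. Z (drop r ys) (i - r) = Z (drop r ys) j)"
    proof (cases "j \<le> r")
      case True
      then show ?thesis using j unfolding past[OF r] Zi by auto
    next
      case False
      then have "Z (drop r ys) (i - r) = Z (drop r ys) (j - r)" using i j by (simp add: Zi psum_take_drop)
      then show ?thesis using False j by (intro disjI2 bexI[of _ "j - r"]) auto
    qed
    then show "\<exists>i\<in>{c..length (drop r ys)}. Z (drop r ys) i \<in> past (take r ys) \<or>
        (\<exists>j\<in>{1..<c}. Z (drop r ys) i = Z (drop r ys) j)"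
      using i by (intro bexI[of _ "i - r"]) auto
  qed
  show ?thesis
  proof (cases "\<exists>i\<in>{T..?N}. Z ys i \<in> A")
    case True
    let ?I = "{i\<in>{T..?N}. Z ys i \<in> A}"
    have I: "finite ?I" "?I \<noteq> {}" using True by auto
    define r where "r = Max ?I"
    have r: "r \<in> ?I" "\<And>i. i \<in> ?I \<Longrightarrow> i \<le> r" using Max_in[OF I] Max_ge[OF I(1)] by (auto simp: r_def)
    have "cov (past (take r ys)) (drop r ys)"
    proof (rule cov_drop)
      show "Z ys i \<notin> A" if "r < i" "i \<le> ?N" for i using r(1) r(2)[of i] that by auto
    qed (use r in auto)
    then show ?thesis using r(1) by auto
  next
    case False
    let ?P = "\<lambda>i. i \<in> {T..?N} \<and> (\<exists>j\<in>{1..<T}. Z ys i = Z ys j)"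
    have "T \<in> {1..?N}" using len sT by auto
    then have "\<exists>i. ?P i" using cov False unfolding cov_def by blast
    then have r: "?P (LEAST i. ?P i)" by (rule LeastI_ex)
    define r where "r = (LEAST i. ?P i)"
    have "\<not> ?P i" if "i < r" for i using that unfolding r_def by (rule not_less_Least)
    then have "first_cross (take r ys)"
      using r unfolding r_def[symmetric] by (subst first_cross_take) auto
    moreover have "cov (past (take r ys)) (drop r ys)"
      using r False unfolding r_def[symmetric] by (intro cov_drop) auto
    ultimately show ?thesis using r unfolding r_def[symmetric] by auto
  qed
qed

lemma E_cov_le:
  assumes "T \<le> M"
  shows "E M (\<lambda>ys. of_bool (cov A ys)) \<le> (\<Sum>r\<in>{T..M}. E r (\<lambda>zs.
    (of_bool (psum inc zs \<in> A) + of_bool (first_cross zs)) * E (M - r) (\<lambda>ys. of_bool (cov (past zs) ys))))"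
proof -
  let ?h = "\<lambda>zs. of_bool (psum inc zs \<in> A) + of_bool (first_cross zs) :: real"
  let ?F = "\<lambda>r ys. ?h (take r ys) * of_bool (cov (past (take r ys)) (drop r ys))"
  have "E M (\<lambda>ys. of_bool (cov A ys)) \<le> E M (\<lambda>ys. \<Sum>r\<in>{T..M}. ?F r ys)"
  proof (intro E_mono)
    fix ys :: "'x list" assume len: "length ys = M"
    show "of_bool (cov A ys) \<le> (\<Sum>r\<in>{T..M}. ?F r ys)"
    proof (cases "cov A ys")
      case True
      then obtain r where r: "r \<in> {T..M}" "Z ys r \<in> A \<or> first_cross (take r ys)" "cov (past (take r ys)) (drop r ys)"
        using cov_step[OF True] assms len by auto
      have "1 \<le> ?F r ys" using r by auto
      also have "\<dots> \<le> (\<Sum>r\<in>{T..M}. ?F r ys)" using r(1) by (intro member_le_sum) auto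
      finally show ?thesis using True by simp
    qed (auto intro!: sum_nonneg)
  qed
  also have "\<dots> = (\<Sum>r\<in>{T..M}. E M (?F r))" by (simp only: expect_sum)
  also have "\<dots> = (\<Sum>r\<in>{T..M}. E r (\<lambda>zs. ?h zs * E (M - r) (\<lambda>ys. of_bool (cov (past zs) ys))))"
  proof (intro sum.cong refl)
    fix r assume r: "r \<in> {T..M}"
    have "E M (?F r) = E (r + (M - r)) (?F r)" using r by simp
    also have "\<dots> = E r (\<lambda>zs. E (M - r) (\<lambda>ys. ?h zs * of_bool (cov (past zs) ys)))"
      unfolding expect_append by (intro expect_cong) simp
    also have "\<dots> = E r (\<lambda>zs. ?h zs * E (M - r) (\<lambda>ys. of_bool (cov (past zs) ys)))"
      by (simp only: expect_cmult)
    finally show "E M (?F r) = E r (\<lambda>zs. ?h zs * E (M - r) (\<lambda>ys. of_bool (cov (past zs) ys)))" .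
  qed
  finally show ?thesis .
qed

lemma card_past: "finite (past zs)" "card (past zs) \<le> length zs"
  unfolding past_def using card_image_le[of "{1..length zs}"] by auto

text \<open>Induction on the number of window lengths: a restart at r \<ge> T \<ge> 1 leaves a
  shorter sum with at most r obstacles. Windows shorter than \<open>T\<close> contribute T, returns
  to \<open>A\<close> contribute \<open>card A\<close>, and first crossings contribute 3 T + H (1 -
  \<delta>), which add up to \<open>card A + H\<close>. The choice of \<open>T\<close> is what gives
  \<open>card A\<close> the coefficient 1.\<close>

lemma sum_E_cov:
  assumes "finite A"
  shows "(\<Sum>M<n. E M (\<lambda>ys. of_bool (cov A ys))) \<le> real (card A) + H"
  using assms
proof (induction n arbitrary: A rule: less_induct)
  case (less n)
  let ?h = "\<lambda>zs. of_bool (psum inc zs \<in> A) + of_bool (first_cross zs) :: real"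
  let ?G = "\<lambda>r m. E r (\<lambda>zs. ?h zs * E m (\<lambda>ys. of_bool (cov (past zs) ys)))"
  have T: "1 \<le> T" using sT by simp
  have E_h: "E r ?h \<le> real (card A) * a r + fc_prob r" for r
  proof -
    have "E r (\<lambda>zs. of_bool (psum inc zs \<in> A)) \<le> E r (\<lambda>zs. \<Sum>z\<in>A. of_bool (psum inc zs = z))"
      using less.prems by (intro E_mono) (auto intro!: one_le_sum_of_bool sum_nonneg)
    also have "\<dots> \<le> (\<Sum>z\<in>A. a r)" unfolding expect_sum by (intro sum_mono conc)
    finally show ?thesis by (simp add: expect_add)
  qed
  have "(\<Sum>M<n. E M (\<lambda>ys. of_bool (cov A ys))) \<le> (\<Sum>M<n. of_bool (M < T) + (\<Sum>r\<in>{T..M}. ?G r (M - r)))"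
  proof (intro sum_mono)
    fix M
    show "E M (\<lambda>ys. of_bool (cov A ys)) \<le> of_bool (M < T) + (\<Sum>r\<in>{T..M}. ?G r (M - r))"
    proof (cases "M < T")
      case True
      have "E M (\<lambda>ys. of_bool (cov A ys)) \<le> 1" by (intro E_le_const) simp
      then show ?thesis using True by simp
    qed (use E_cov_le[of M A] in auto)
  qed
  also have "\<dots> = (\<Sum>M<n. of_bool (M < T)) + (\<Sum>r\<in>{T..<n}. \<Sum>m<n - r. ?G r m)"
    by (simp only: sum.distrib sum_triangle_shift[of ?G])
  also have "(\<Sum>M<n. of_bool (M < T)) \<le> real T"
  proof -
    have "(\<Sum>M<n. of_bool (M < T)) = real (card {M. M < n \<and> M < T})" by (simp add: Int_def)
    also have "card {M. M < n \<and> M < T} \<le> card {..<T}" by (intro card_mono) auto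
    finally show ?thesis by simp
  qed
  also have "(\<Sum>r\<in>{T..<n}. \<Sum>m<n - r. ?G r m) \<le> (\<Sum>r\<in>{T..<n}. (real r + H) * (real (card A) * a r + fc_prob r))"
  proof (intro sum_mono)
    fix r assume r: "r \<in> {T..<n}"
    have "(\<Sum>m<n - r. ?G r m) = E r (\<lambda>zs. ?h zs * (\<Sum>m<n - r. E m (\<lambda>ys. of_bool (cov (past zs) ys))))"
      by (simp only: expect_sum[symmetric] sum_distrib_left)
    also have "\<dots> \<le> E r (\<lambda>zs. ?h zs * (real r + H))"
    proof (intro E_mono mult_left_mono)
      fix zs :: "'x list" assume "length zs = r"
      then have "real (card (past zs)) \<le> real r" using card_past(2)[of zs] by simp
      moreover have "(\<Sum>m<n - r. E m (\<lambda>ys. of_bool (cov (past zs) ys))) \<le> real (card (past zs)) + H"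
        using r T by (intro less.IH card_past) auto
      ultimately show "(\<Sum>m<n - r. E m (\<lambda>ys. of_bool (cov (past zs) ys))) \<le> real r + H" by linarith
    qed auto
    also have "\<dots> = (real r + H) * E r ?h" by (simp only: expect_cmult[symmetric] mult.commute)
    also have "\<dots> \<le> (real r + H) * (real (card A) * a r + fc_prob r)"
      using E_h H_nonneg by (intro mult_left_mono) auto
    finally show "(\<Sum>m<n - r. ?G r m) \<le> (real r + H) * (real (card A) * a r + fc_prob r)" .
  qed
  also have "\<dots> = real (card A) * (\<Sum>r\<in>{T..<n}. (real r + H) * a r) + (\<Sum>r\<in>{T..<n}. real r * fc_prob r) + H * (\<Sum>r\<in>{T..<n}. fc_prob r)"
    by (simp add: sum_distrib_left sum.distrib[symmetric] algebra_simps)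
  also have "\<dots> \<le> real (card A) * 1 + 3 * real T + H * (1 - \<delta>)"
    using sum_a_H sum_weighted_fc_prob sum_fc_prob H_nonneg by (intro add_mono mult_left_mono) auto
  finally show ?case using \<delta>_pos by (simp add: H_def field_simps)
qed

section \<open>Pasts of arbitrary length\<close>

definition past_from :: "nat \<Rightarrow> 'x list \<Rightarrow> 'a set" where
  "past_from k zs = (\<lambda>j. Z zs j - psum inc zs) ` {k<..length zs}"

text \<open>Restart at the last time q at which a site of times up to k is revisited; it exists
  because k + 1 is not a cut time. Afterwards only the sites of times k + 1 to q can be obstacles,
  and their number is at most q - k, however long the past is.\<close>

lemma nocut_step:
  assumes nc: "nocut inc k xs" and len: "k < length xs"
  shows "\<exists>r\<in>{1..length xs - k}. (\<exists>j\<le>k. Z xs (k + r) = Z xs j) \<and>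
    cov (past_from k (take (k + r) xs)) (drop (k + r) xs)"
proof -
  let ?N = "length xs"
  let ?I = "{i\<in>{k<..?N}. \<exists>j\<le>k. Z xs i = Z xs j}"
  have "\<exists>i\<in>{Suc k..?N}. \<exists>j<Suc k. Z xs i = Z xs j" using nc len unfolding nocut_def by auto
  then have I: "finite ?I" "?I \<noteq> {}" by (auto simp: less_Suc_eq_le)
  define q where "q = Max ?I"
  have q: "q \<in> ?I" "\<And>i. i \<in> ?I \<Longrightarrow> i \<le> q" using Max_in[OF I] Max_ge[OF I(1)] by (auto simp: q_def)
  have past: "past_from k (take q xs) = (\<lambda>j. Z xs j - Z xs q) ` {k<..q}"
    unfolding past_from_def using q(1) by (intro image_cong) (auto simp: min_def)
  have "cov (past_from k (take q xs)) (drop q xs)"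
    unfolding cov_def
  proof
    fix c assume c: "c \<in> {1..length (drop q xs)}"
    then have "k < q + c \<and> q + c \<le> ?N" using q(1) by auto
    then obtain i j where i: "i \<in> {q + c..?N}" and j: "j < q + c" "Z xs i = Z xs j"
      using nc unfolding nocut_def by blast
    have "k < j"
    proof (rule ccontr)
      assume "\<not> k < j"
      then have "i \<in> ?I" using i j c q(1) by (auto intro!: exI[of _ j])
      then show False using q(2)[of i] i c by auto
    qed
    have Zi: "Z (drop q xs) (i - q) = Z xs i - Z xs q" using i by (simp add: psum_take_drop)
    have "Z (drop q xs) (i - q) \<in> past_from k (take q xs) \<or> (\<exists>j\<in>{1..<c}. Z (drop q xs) (i - q) = Z (drop q xs) j)"
    proof (cases "j \<le> q")
      case True
      then show ?thesis using j \<open>k < j\<close> unfolding past Zi by auto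
    next
      case False
      then have "Z (drop q xs) (i - q) = Z (drop q xs) (j - q)" using i j by (simp add: Zi psum_take_drop)
      then show ?thesis using False j by (intro disjI2 bexI[of _ "j - q"]) auto
    qed
    then show "\<exists>i\<in>{c..length (drop q xs)}. Z (drop q xs) i \<in> past_from k (take q xs) \<or>
        (\<exists>j\<in>{1..<c}. Z (drop q xs) i = Z (drop q xs) j)"
      using i by (intro bexI[of _ "i - q"]) auto
  qed
  then show ?thesis using q(1) by (intro bexI[of _ "q - k"]) auto
qed

lemma card_past_from: "finite (past_from k zs)" "card (past_from k zs) \<le> length zs - k"
  unfolding past_from_def using card_image_le[of "{k<..length zs}"] by auto

lemma E_nocut_le:
  assumes "1 \<le> M"
  shows "E (k + M) (\<lambda>xs. of_bool (nocut inc k xs)) \<le> (\<Sum>r\<in>{1..M}. E (k + r) (\<lambda>zs.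
    of_bool (\<exists>j\<le>k. psum inc zs = Z zs j) * E (M - r) (\<lambda>ys. of_bool (cov (past_from k zs) ys))))"
proof -
  let ?h = "\<lambda>zs. of_bool (\<exists>j\<le>k. psum inc zs = Z zs j) :: real"
  let ?F = "\<lambda>r ys. ?h (take (k + r) ys) * of_bool (cov (past_from k (take (k + r) ys)) (drop (k + r) ys))"
  have "E (k + M) (\<lambda>ys. of_bool (nocut inc k ys)) \<le> E (k + M) (\<lambda>ys. \<Sum>r\<in>{1..M}. ?F r ys)"
  proof (intro E_mono)
    fix ys :: "'x list" assume len: "length ys = k + M"
    show "of_bool (nocut inc k ys) \<le> (\<Sum>r\<in>{1..M}. ?F r ys)"
    proof (cases "nocut inc k ys")
      case True
      then obtain r j where r: "r \<in> {1..M}" "j \<le> k" "Z ys (k + r) = Z ys j"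
          "cov (past_from k (take (k + r) ys)) (drop (k + r) ys)"
        using nocut_step[OF True] assms len by auto
      have "?h (take (k + r) ys) = 1" using r by (auto simp: min_def intro!: exI[of _ j])
      then have "1 \<le> ?F r ys" using r by auto
      also have "\<dots> \<le> (\<Sum>r\<in>{1..M}. ?F r ys)" using r(1) by (intro member_le_sum) auto
      finally show ?thesis using True by simp
    qed (auto intro!: sum_nonneg)
  qed
  also have "\<dots> = (\<Sum>r\<in>{1..M}. E (k + M) (?F r))" by (simp only: expect_sum)
  also have "\<dots> = (\<Sum>r\<in>{1..M}. E (k + r) (\<lambda>zs. ?h zs * E (M - r) (\<lambda>ys. of_bool (cov (past_from k zs) ys))))"
  proof (intro sum.cong refl)
    fix r assume r: "r \<in> {1..M}"
    have "E (k + M) (?F r) = E ((k + r) + (M - r)) (?F r)" using r by simp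
    also have "\<dots> = E (k + r) (\<lambda>zs. E (M - r) (\<lambda>ys. ?h zs * of_bool (cov (past_from k zs) ys)))"
      unfolding expect_append[of S w "k + r"] by (intro expect_cong) simp
    also have "\<dots> = E (k + r) (\<lambda>zs. ?h zs * E (M - r) (\<lambda>ys. of_bool (cov (past_from k zs) ys)))"
      by (simp only: expect_cmult)
    finally show "E (k + M) (?F r) = E (k + r) (\<lambda>zs. ?h zs * E (M - r) (\<lambda>ys. of_bool (cov (past_from k zs) ys)))" .
  qed
  finally show ?thesis .
qed

text \<open>The initial restart is the one of \<open>nocut_step\<close>: a return at time k + r to a
  site of times up to k has probability at most the sum of \<open>a\<close> over r to r + k. All
  further restarts are accounted for by \<open>sum_E_cov\<close> with at most r obstacles.\<close>

theorem sum_E_nocut: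
  "(\<Sum>M<n. E (k + M) (\<lambda>xs. of_bool (nocut inc k xs))) \<le> 1 + (\<Sum>r\<in>{1..<n}. (real r + H) * (\<Sum>t\<in>{r..r + k}. a t))"
proof -
  let ?h = "\<lambda>zs. of_bool (\<exists>j\<le>k. psum inc zs = Z zs j) :: real"
  let ?G = "\<lambda>r m. E (k + r) (\<lambda>zs. ?h zs * E m (\<lambda>ys. of_bool (cov (past_from k zs) ys)))"
  have E_h: "E (k + r) ?h \<le> (\<Sum>t\<in>{r..r + k}. a t)" for r
  proof -
    have "E (k + r) ?h \<le> E (k + r) (\<lambda>zs. \<Sum>j\<in>{..k}. of_bool (psum inc zs = Z zs j))"
    proof (intro E_mono)
      fix zs
      show "?h zs \<le> (\<Sum>j\<in>{..k}. of_bool (psum inc zs = Z zs j))"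
      proof (cases "\<exists>j\<le>k. psum inc zs = Z zs j")
        case True
        then obtain j where "j \<in> {..k}" "psum inc zs = Z zs j" by auto
        then show ?thesis using True one_le_sum_of_bool[of "{..k}" j "\<lambda>j. psum inc zs = Z zs j"] by auto
      qed (auto intro!: sum_nonneg)
    qed
    also have "\<dots> \<le> (\<Sum>j\<in>{..k}. a (k + r - j))" unfolding expect_sum by (intro sum_mono E_return) auto
    also have "\<dots> = (\<Sum>t\<in>{r..r + k}. a t)"
      by (rule sum.reindex_bij_witness[where i = "\<lambda>t. k + r - t" and j = "\<lambda>j. k + r - j"]) auto
    finally show ?thesis .
  qed
  have "(\<Sum>M<n. E (k + M) (\<lambda>ys. of_bool (nocut inc k ys))) \<le> (\<Sum>M<n. of_bool (M = 0) + (\<Sum>r\<in>{1..M}. ?G r (M - r)))"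
  proof (intro sum_mono)
    fix M
    show "E (k + M) (\<lambda>ys. of_bool (nocut inc k ys)) \<le> of_bool (M = 0) + (\<Sum>r\<in>{1..M}. ?G r (M - r))"
    proof (cases "M = 0")
      case True
      have "E (k + M) (\<lambda>ys. of_bool (nocut inc k ys)) \<le> 1" by (intro E_le_const) simp
      then show ?thesis using True by simp
    qed (use E_nocut_le[of M k] in auto)
  qed
  also have "\<dots> = (\<Sum>M<n. of_bool (M = 0)) + (\<Sum>r\<in>{1..<n}. \<Sum>m<n - r. ?G r m)"
    by (simp only: sum.distrib sum_triangle_shift[of ?G])
  also have "(\<Sum>M<n. of_bool (M = 0)) \<le> (1::real)"
    by (intro sum_of_bool_le_one) auto
  also have "(\<Sum>r\<in>{1..<n}. \<Sum>m<n - r. ?G r m) \<le> (\<Sum>r\<in>{1..<n}. (real r + H) * (\<Sum>t\<in>{r..r + k}. a t))"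
  proof (intro sum_mono)
    fix r assume r: "r \<in> {1..<n}"
    have "(\<Sum>m<n - r. ?G r m) = E (k + r) (\<lambda>zs. ?h zs * (\<Sum>m<n - r. E m (\<lambda>ys. of_bool (cov (past_from k zs) ys))))"
      by (simp only: expect_sum[symmetric] sum_distrib_left)
    also have "\<dots> \<le> E (k + r) (\<lambda>zs. ?h zs * (real r + H))"
    proof (intro E_mono mult_left_mono)
      fix zs :: "'x list" assume "length zs = k + r"
      then have "real (card (past_from k zs)) \<le> real r" using card_past_from(2)[of k zs] by simp
      moreover have "(\<Sum>m<n - r. E m (\<lambda>ys. of_bool (cov (past_from k zs) ys))) \<le> real (card (past_from k zs)) + H"
        by (intro sum_E_cov card_past_from)
      ultimately show "(\<Sum>m<n - r. E m (\<lambda>ys. of_bool (cov (past_from k zs) ys))) \<le> real r + H" by linarith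
    qed auto
    also have "\<dots> = (real r + H) * E (k + r) ?h" by (simp only: expect_cmult[symmetric] mult.commute)
    also have "\<dots> \<le> (real r + H) * (\<Sum>t\<in>{r..r + k}. a t)"
      using E_h H_nonneg by (intro mult_left_mono) auto
    finally show "(\<Sum>m<n - r. ?G r m) \<le> (real r + H) * (\<Sum>t\<in>{r..r + k}. a t)" .
  qed
  finally show ?thesis by simp
qed

end

section \<open>Return probabilities\<close>

primrec srw1 :: "nat \<Rightarrow> int \<Rightarrow> real" where
  "srw1 0 k = of_bool (k = 0)"
| "srw1 (Suc n) k = (srw1 n (k - 1) + srw1 n (k + 1)) / 2"

lemma srw1_eq_0: "odd (k + int n) \<or> k < - int n \<Longrightarrow> srw1 n k = 0"
  by (induction n arbitrary: k) auto

lemma srw1_binomial: "srw1 n (2 * int j - int n) = (n choose j) / 2 ^ n"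
proof (induction n arbitrary: j)
  case 0
  then show ?case by (cases j) auto
next
  case (Suc n)
  have 2: "srw1 n (2 * int j - int (Suc n) + 1) = (n choose j) / 2 ^ n"
    using Suc[of j] by (simp add: algebra_simps)
  show ?case
  proof (cases j)
    case 0
    have "srw1 n (2 * int j - int (Suc n) - 1) = 0" using 0 by (intro srw1_eq_0) auto
    then show ?thesis unfolding srw1.simps 2 using 0 by simp
  next
    case (Suc j')
    then have "srw1 n (2 * int j - int (Suc n) - 1) = (n choose j') / 2 ^ n"
      using Suc.IH[of j'] by (simp add: algebra_simps)
    then show ?thesis unfolding srw1.simps 2 using Suc by (simp add: field_simps)
  qed
qed

text \<open>The factor 2 m + 1 makes the induction close: passing from m to m + 1 multiplies the
  left side by 4 (2 m + 1) (2 m + 3) / (m + 1)^2, which is at most 16.\<close>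

lemma central_binomial_sq: "((2 * m) choose m)\<^sup>2 * (2 * m + 1) \<le> (16::nat) ^ m"
proof (induction m)
  case (Suc m)
  let ?c = "(2 * m) choose m" and ?c' = "(2 * Suc m) choose Suc m"
  have "?c' = 2 * (Suc (2 * m) choose Suc m)"
    using binomial_symmetric[of m "Suc (2 * m)"] by simp
  then have c': "Suc m * ?c' = 2 * (Suc (2 * m) * ?c)"
    using Suc_times_binomial_eq[of "2 * m" m] by (simp add: mult_ac)
  have "(Suc m)\<^sup>2 * (?c'\<^sup>2 * (2 * Suc m + 1)) = 4 * (2 * m + 1) * (2 * m + 3) * (?c\<^sup>2 * (2 * m + 1))"
    using arg_cong[OF c', of "\<lambda>x. x\<^sup>2 * (2 * m + 3)"] by (simp add: power_mult_distrib algebra_simps power2_eq_square)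
  also have "\<dots> \<le> (16 * (Suc m)\<^sup>2) * 16 ^ m"
    using Suc by (intro mult_mono[of "4 * (2 * m + 1) * (2 * m + 3)"]) (auto simp: power2_eq_square algebra_simps)
  finally have "(Suc m)\<^sup>2 * (?c'\<^sup>2 * (2 * Suc m + 1)) \<le> (Suc m)\<^sup>2 * 16 ^ Suc m" by (simp add: mult_ac)
  then show ?case by (simp only: mult_le_cancel1) simp
qed simp

lemma central_binomial_le: "real ((2 * m) choose m) / 4 ^ m \<le> 1 / sqrt (2 * real m + 1)"
proof -
  have "(real ((2 * m) choose m))\<^sup>2 * (2 * real m + 1) \<le> (4 ^ m)\<^sup>2"
  proof -
    have "real (((2 * m) choose m)\<^sup>2 * (2 * m + 1)) \<le> real (16 ^ m)"
      using central_binomial_sq[of m] by (simp only: of_nat_le_iff)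
    moreover have "(16::real) ^ m = (4 ^ m)\<^sup>2" by (simp add: power2_eq_square power_mult_distrib[symmetric])
    ultimately show ?thesis by (simp add: algebra_simps)
  qed
  then have "(real ((2 * m) choose m) * sqrt (2 * real m + 1))\<^sup>2 \<le> (4 ^ m)\<^sup>2"
    by (simp add: power_mult_distrib)
  then have "real ((2 * m) choose m) * sqrt (2 * real m + 1) \<le> 4 ^ m"
    by (rule power2_le_imp_le) simp
  then show ?thesis by (simp add: field_simps add_pos_nonneg)
qed

lemma middle_binomial_le: "real (n choose (n div 2)) / 2 ^ n \<le> 1 / sqrt (real n + 1)"
proof (cases "even n")
  case True
  then obtain m where m: "n = 2 * m" by auto
  show ?thesis using central_binomial_le[of m] unfolding m by (simp add: power_mult)
next
  case False
  then obtain m where m: "n = Suc (2 * m)" using oddE by fastforce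
  have "2 * Suc m choose Suc m = 2 * (n choose (n div 2))"
    using binomial_symmetric[of m "Suc (2 * m)"] unfolding m by simp
  then have "real (n choose (n div 2)) / 2 ^ n = real (2 * Suc m choose Suc m) / 4 ^ Suc m"
    unfolding m by (simp add: power_mult del: binomial_Suc_Suc)
  also have "\<dots> \<le> 1 / sqrt (2 * real (Suc m) + 1)" by (rule central_binomial_le)
  also have "\<dots> \<le> 1 / sqrt (real n + 1)" unfolding m by (intro divide_left_mono) auto
  finally show ?thesis .
qed

lemma srw1_nonneg: "0 \<le> srw1 n k"
  by (induction n arbitrary: k) auto

lemma srw1_le: "srw1 n k \<le> 1 / sqrt (real n + 1)"
proof (cases "odd (k + int n) \<or> k < - int n")
  case True
  then show ?thesis by (simp add: srw1_eq_0)
next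
  case False
  then have "even (k + int n)" by blast
  then obtain l where l: "k + int n = 2 * l" by (rule evenE)
  then have k: "k = 2 * int (nat l) - int n" using False by auto
  have "srw1 n k = real (n choose nat l) / 2 ^ n" unfolding k by (rule srw1_binomial)
  also have "\<dots> \<le> real (n choose (n div 2)) / 2 ^ n"
    using binomial_maximum by (intro divide_right_mono) auto
  also have "\<dots> \<le> 1 / sqrt (real n + 1)" by (rule middle_binomial_le)
  finally show ?thesis .
qed

text \<open>
  A letter \<open>(i, s, b)\<close> of the driving noise proposes the step \<open>s e\<^sub>i\<close>; if \<open>b\<close> holds, a horizontal step
  from a new site is replaced by \<open>e\<^sub>1\<close>.
\<close>

type_synonym noise = "nat \<times> int \<times> bool"

definition Noise :: "nat \<Rightarrow> noise set" where
  "Noise d = {1..d} \<times> {1, -1} \<times> UNIV"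

definition wt :: "nat \<Rightarrow> real \<Rightarrow> noise \<Rightarrow> real" where
  "wt d \<beta> = (\<lambda>(i, s, b). (if b then \<beta> else 1 - \<beta>) / (2 * real d))"

text \<open>
  The coordinates \<open>2, \<dots>, d\<close> are distributed into \<open>G\<close> classes and summed over each class. The resulting walk
  on \<open>\<int>\<^sup>G\<close> moves in each direction with probability bounded below uniformly in \<open>d\<close>.
\<close>

definition inc :: "nat \<Rightarrow> noise \<Rightarrow> nat \<Rightarrow> int" where
  "inc G = (\<lambda>(i, s, b) g. if 2 \<le> i \<and> (i - 2) mod G = g then s else 0)"

definition cnt :: "nat \<Rightarrow> nat \<Rightarrow> noise list \<Rightarrow> nat" where
  "cnt G g xs = length (filter (\<lambda>(i, s, b). 2 \<le> i \<and> (i - 2) mod G = g) xs)"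

section \<open>Concentration of the projected walk\<close>

lemma sum_Noise:
  "(\<Sum>x\<in>Noise d. f x) = (\<Sum>i\<in>{1..d}. f (i, 1, True) + f (i, 1, False) + f (i, -1, True) + f (i, -1, False))"
  for f :: "noise \<Rightarrow> real"
proof -
  have "(\<Sum>x\<in>Noise d. f x) = (\<Sum>i\<in>{1..d}. \<Sum>s\<in>{1, -1}. \<Sum>b\<in>UNIV. f (i, s, b))"
    unfolding Noise_def by (simp only: sum.cartesian_product) (simp only: case_prod_unfold prod.collapse)
  then show ?thesis by (simp add: UNIV_bool add_ac)
qed

lemma sum_wt_fst: "(\<Sum>x\<in>Noise d. wt d \<beta> x * f (fst x)) = (\<Sum>i\<in>{1..d}. f i) / real d"
proof (cases "d = 0")
  case False
  have "(\<Sum>x\<in>Noise d. wt d \<beta> x * f (fst x)) = (\<Sum>i\<in>{1..d}. f i / real d)"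
    unfolding sum_Noise wt_def using False by (intro sum.cong refl) (simp add: field_simps)
  then show ?thesis by (simp add: sum_divide_distrib)
qed (simp add: Noise_def)

lemma iid_lists_Noise:
  assumes "0 < d" "0 \<le> \<beta>" "\<beta> \<le> 1"
  shows "iid_lists (Noise d) (wt d \<beta>)"
proof
  show "finite (Noise d)" by (simp add: Noise_def)
  show "0 \<le> wt d \<beta> x" for x using assms by (auto simp: wt_def split: prod.split)
  show "sum (wt d \<beta>) (Noise d) = 1" using sum_wt_fst[of d \<beta> "\<lambda>_. 1"] assms by simp
qed

text \<open>Given the class of each letter, the G coordinates are independent simple random walks,
  the g-th one making \<open>cnt G g xs\<close> steps. The conditioning stays implicit: adding up
  the letters with signs 1 and -1 reproduces the recursion of \<open>srw1\<close>. Coordinates of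
  \<open>z\<close> beyond G do not appear on the right, hence an inequality.\<close>

lemma psum_le_prod_srw1:
  assumes d: "0 < d" and \<beta>: "0 \<le> \<beta>" "\<beta> \<le> 1" and G: "0 < G"
  shows "expect (Noise d) (wt d \<beta>) n (\<lambda>xs. of_bool (psum (inc G) xs = z))
    \<le> expect (Noise d) (wt d \<beta>) n (\<lambda>xs. \<Prod>g<G. srw1 (cnt G g xs) (z g))"
proof (induction n arbitrary: z)
  case 0
  show ?case by (auto simp: cnt_def zero_fun_def intro!: prod_nonneg)
next
  case (Suc n)
  interpret iid_lists "Noise d" "wt d \<beta>" by (rule iid_lists_Noise) (use d \<beta> in auto)
  let ?P = "\<lambda>x xs. \<Prod>g<G. srw1 (cnt G g xs) (z g - inc G x g)"
  let ?Q = "\<lambda>x xs. \<Prod>g<G. srw1 (cnt G g (x # xs)) (z g)"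
  have PQ: "?P (i, 1, b) xs + ?P (i, -1, b) xs = ?Q (i, 1, b) xs + ?Q (i, -1, b) xs" for i b xs
  proof (cases "2 \<le> i")
    case True
    define h where "h = (i - 2) mod G"
    have h: "h \<in> {..<G}" using G by (simp add: h_def)
    have "(\<Prod>g\<in>{..<G} - {h}. srw1 (cnt G g xs) (z g - inc G (i, s, b) g)) = (\<Prod>g\<in>{..<G} - {h}. srw1 (cnt G g xs) (z g))" for s
      by (intro prod.cong) (auto simp: inc_def h_def)
    then have P: "?P (i, s, b) xs = srw1 (cnt G h xs) (z h - s) * (\<Prod>g\<in>{..<G} - {h}. srw1 (cnt G g xs) (z g))" for s
      using h True by (subst prod.remove[of _ h]) (auto simp: inc_def h_def)
    have "(\<Prod>g\<in>{..<G} - {h}. srw1 (cnt G g ((i, s, b) # xs)) (z g)) = (\<Prod>g\<in>{..<G} - {h}. srw1 (cnt G g xs) (z g))" for s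
      by (intro prod.cong) (auto simp: cnt_def h_def)
    then have Q: "?Q (i, s, b) xs = srw1 (Suc (cnt G h xs)) (z h) * (\<Prod>g\<in>{..<G} - {h}. srw1 (cnt G g xs) (z g))" for s
      using h True by (subst prod.remove[of _ h]) (auto simp: cnt_def h_def)
    show ?thesis unfolding P Q by (simp add: field_simps)
  next
    case False
    then show ?thesis by (simp add: inc_def cnt_def)
  qed
  have "E (Suc n) (\<lambda>xs. of_bool (psum (inc G) xs = z))
      = (\<Sum>x\<in>Noise d. wt d \<beta> x * E n (\<lambda>xs. of_bool (psum (inc G) xs = z - inc G x)))"
    by (simp add: eq_diff_eq add.commute)
  also have "\<dots> \<le> (\<Sum>x\<in>Noise d. wt d \<beta> x * E n (?P x))"
    using Suc[of "z - inc G _"] w_nonneg by (intro sum_mono mult_left_mono) (auto simp: fun_diff_def)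
  also have "\<dots> = (\<Sum>x\<in>Noise d. wt d \<beta> x * E n (?Q x))"
    unfolding sum_Noise
  proof (intro sum.cong refl)
    fix i
    have EPQ: "E n (?P (i, 1, b)) + E n (?P (i, -1, b)) = E n (?Q (i, 1, b)) + E n (?Q (i, -1, b))" for b
      unfolding expect_add[symmetric] PQ ..
    have *: "c1 * p1 + c2 * p2 + c1 * p3 + c2 * p4 = c1 * q1 + c2 * q2 + c1 * q3 + c2 * q4"
      if "p1 + p3 = q1 + q3" "p2 + p4 = q2 + q4" for c1 c2 p1 p2 p3 p4 q1 q2 q3 q4 :: real
    proof -
      have "c1 * p1 + c2 * p2 + c1 * p3 + c2 * p4 = c1 * (p1 + p3) + c2 * (p2 + p4)" by (simp add: algebra_simps)
      then show ?thesis unfolding that by (simp add: algebra_simps)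
    qed
    have wt: "wt d \<beta> (i, -1, b) = wt d \<beta> (i, 1, b)" for b by (simp add: wt_def)
    show "wt d \<beta> (i, 1, True) * E n (?P (i, 1, True)) + wt d \<beta> (i, 1, False) * E n (?P (i, 1, False)) +
        wt d \<beta> (i, -1, True) * E n (?P (i, -1, True)) + wt d \<beta> (i, -1, False) * E n (?P (i, -1, False)) =
        wt d \<beta> (i, 1, True) * E n (?Q (i, 1, True)) + wt d \<beta> (i, 1, False) * E n (?Q (i, 1, False)) +
        wt d \<beta> (i, -1, True) * E n (?Q (i, -1, True)) + wt d \<beta> (i, -1, False) * E n (?Q (i, -1, False))"
      unfolding wt by (intro * EPQ)
  qed
  finally show ?case by simp
qed

text \<open>Each class has at least q = (d - 1) div G \<ge> 1 members, and d \<le> G (q + 1) \<le> 2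
  G q.\<close>

lemma class_size:
  assumes "0 < G" "g < G" "G < d"
  shows "real (card {i\<in>{1..d}. 2 \<le> i \<and> (i - 2) mod G = g}) / real d \<ge> 1 / (2 * real G)"
proof -
  define q where "q = (d - 1) div G"
  have qG: "G * q \<le> d - 1" "d - 1 < G * Suc q" "1 \<le> q"
    using assms by (auto simp: q_def dividend_less_times_div Suc_le_eq div_greater_zero_iff)
  let ?I = "{i\<in>{1..d}. 2 \<le> i \<and> (i - 2) mod G = g}"
  have "(\<lambda>t. 2 + (g + G * t)) ` {..<q} \<subseteq> ?I"
  proof
    fix i assume "i \<in> (\<lambda>t. 2 + (g + G * t)) ` {..<q}"
    then obtain t where t: "t < q" "i = 2 + (g + G * t)" by auto
    have "G * Suc t \<le> G * q" using t by (intro mult_left_mono) auto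
    then have "g + G * t < G * q" using assms(2) by simp
    then have "i \<le> d" using qG t by linarith
    then show "i \<in> ?I" using t assms by simp
  qed
  then have "card ((\<lambda>t. 2 + (g + G * t)) ` {..<q}) \<le> card ?I" by (intro card_mono) auto
  also have "card ((\<lambda>t. 2 + (g + G * t)) ` {..<q}) = q"
    using assms by (subst card_image) (auto simp: inj_on_def)
  finally have "q \<le> card ?I" .
  moreover have "d \<le> 2 * G * q"
  proof -
    have "G * Suc q \<le> G * (2 * q)" using qG by (intro mult_left_mono) auto
    moreover have "d \<le> G * Suc q" using qG(2) by linarith
    ultimately show ?thesis by (simp only: mult_ac)
  qed
  ultimately have "d \<le> 2 * G * card ?I" using mult_le_mono2[of q "card ?I" "2 * G"] by linarith
  then have "real d \<le> real (2 * G * card ?I)" by (simp only: of_nat_le_iff)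
  then have "real d \<le> 2 * real G * real (card ?I)" by simp
  then show ?thesis using assms by (simp add: field_simps)
qed

text \<open>Chernoff bound for the number of steps in a class: a letter falls into it with
  probability p \<ge> 1 / (2 G), so each letter contributes a factor 1 - (1 - 1/e) p \<le> 1 - 1 /
  (4 G).\<close>

lemma E_exp_cnt:
  assumes d: "G < d" and \<beta>: "0 \<le> \<beta>" "\<beta> \<le> 1" and G: "0 < G" "g < G"
  shows "expect (Noise d) (wt d \<beta>) n (\<lambda>xs. exp (- real (cnt G g xs))) \<le> exp (- real n / (4 * real G))"
proof (induction n)
  case 0
  show ?case by (simp add: cnt_def)
next
  case (Suc n)
  interpret iid_lists "Noise d" "wt d \<beta>" by (rule iid_lists_Noise) (use d \<beta> in auto)
  let ?in = "\<lambda>i. 2 \<le> i \<and> (i - 2) mod G = g"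
  let ?f = "\<lambda>i. if ?in i then exp (- 1) else 1 :: real"
  let ?p = "real (card {i\<in>{1..d}. ?in i}) / real d"
  have "E (Suc n) (\<lambda>xs. exp (- real (cnt G g xs)))
      = (\<Sum>x\<in>Noise d. wt d \<beta> x * ?f (fst x)) * E n (\<lambda>xs. exp (- real (cnt G g xs)))"
    unfolding expect.simps sum_distrib_right
  proof (intro sum.cong refl)
    fix x :: noise
    have "(\<lambda>xs. exp (- real (cnt G g (x # xs)))) = (\<lambda>xs. ?f (fst x) * exp (- real (cnt G g xs)))"
      by (cases x) (auto simp: cnt_def fun_eq_iff exp_add[symmetric])
    then show "wt d \<beta> x * E n (\<lambda>xs. exp (- real (cnt G g (x # xs)))) =
        wt d \<beta> x * ?f (fst x) * E n (\<lambda>xs. exp (- real (cnt G g xs)))"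
      by (simp only: expect_cmult mult.assoc)
  qed
  also have "(\<Sum>x\<in>Noise d. wt d \<beta> x * ?f (fst x)) = (\<Sum>i\<in>{1..d}. 1 - (1 - exp (- 1)) * of_bool (?in i)) / real d"
    unfolding sum_wt_fst[of d \<beta> ?f] by (intro arg_cong2[of _ _ _ _ "(/)"] sum.cong refl) auto
  also have "\<dots> = 1 - (1 - exp (- 1)) * ?p"
  proof -
    have "(\<Sum>i\<in>{1..d}. of_bool (?in i)) = real (card {i\<in>{1..d}. ?in i})" by (simp add: Int_def)
    then have "(\<Sum>i\<in>{1..d}. 1 - (1 - exp (- 1)) * of_bool (?in i)) = real d - (1 - exp (- 1)) * real (card {i\<in>{1..d}. ?in i})"
      by (simp only: sum_subtractf sum_distrib_left[symmetric]) simp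
    then show ?thesis using d by (simp only: diff_divide_distrib) simp
  qed
  also have "\<dots> \<le> 1 - 1 / 2 * (1 / (2 * real G))"
  proof -
    have "exp (- 1) \<le> (1 / 2 :: real)"
      using exp_ge_add_one_self[of 1] by (simp add: exp_minus field_simps)
    then have "1 / 2 * (1 / (2 * real G)) \<le> (1 - exp (- 1)) * ?p"
      using class_size[OF G d] by (intro mult_mono) auto
    then show ?thesis by simp
  qed
  also have "\<dots> \<le> exp (- 1 / (4 * real G))"
    using exp_ge_add_one_self[of "- 1 / (4 * real G)"] by simp
  finally have "E (Suc n) (\<lambda>xs. exp (- real (cnt G g xs))) \<le> exp (- 1 / (4 * real G)) * E n (\<lambda>xs. exp (- real (cnt G g xs)))"
    by (simp add: mult_right_mono E_nonneg)
  also have "\<dots> \<le> exp (- 1 / (4 * real G)) * exp (- real n / (4 * real G))"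
    using Suc by (intro mult_left_mono) auto
  also have "\<dots> = exp (- real (Suc n) / (4 * real G))"
    by (simp add: exp_add[symmetric] diff_divide_distrib)
  finally show ?case .
qed

text \<open>With y = n / (8 G), either every class receives at least y steps and the G
  one-dimensional bounds y^(-1/2) multiply, or some class receives fewer, which costs exp (y - n /
  (4 G)) = exp (- n / (8 G)) per class.\<close>

definition ret_bound :: "nat \<Rightarrow> nat \<Rightarrow> real" where
  "ret_bound G n = (if n = 0 then 1 else (real n / (8 * real G)) powr (- real G / 2) + real G * exp (- real n / (8 * real G)))"

lemma prod_srw1_le:
  assumes "0 < G" "0 < y"
  shows "(\<Prod>g<G. srw1 (c g) (z g)) \<le> y powr (- real G / 2) + (\<Sum>g<G. exp (y - real (c g)))"
proof (cases "\<forall>g<G. y \<le> real (c g)")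
  case True
  have "(\<Prod>g<G. srw1 (c g) (z g)) \<le> (\<Prod>g<G. y powr (- 1 / 2))"
  proof (intro prod_mono conjI srw1_nonneg)
    fix g assume g: "g \<in> {..<G}"
    have "srw1 (c g) (z g) \<le> 1 / sqrt (real (c g) + 1)" by (rule srw1_le)
    also have "\<dots> \<le> 1 / sqrt y" using True g assms by (intro divide_left_mono) (auto intro: order.trans)
    also have "\<dots> = y powr (- 1 / 2)" using assms by (simp add: powr_minus powr_half_sqrt field_simps)
    finally show "srw1 (c g) (z g) \<le> y powr (- 1 / 2)" .
  qed
  also have "\<dots> = y powr (- real G / 2)"
    using assms by (simp add: powr_realpow[symmetric] powr_powr)
  finally show ?thesis by (simp add: add_increasing2 sum_nonneg)
next
  case False
  then obtain g where g: "g < G" "real (c g) < y" by auto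
  have "srw1 (c g) (z g) \<le> 1" for g
    using srw1_le[of "c g" "z g"] by (rule order.trans) (simp add: field_simps)
  then have "(\<Prod>g<G. srw1 (c g) (z g)) \<le> 1" by (intro prod_le_1) (auto simp: srw1_nonneg)
  also have "\<dots> \<le> exp (y - real (c g))" using g by simp
  also have "\<dots> \<le> (\<Sum>g<G. exp (y - real (c g)))" using g by (intro member_le_sum) auto
  finally show ?thesis by (simp add: add_increasing)
qed

lemma psum_conc:
  assumes d: "G < d" and \<beta>: "0 \<le> \<beta>" "\<beta> \<le> 1" and G: "0 < G"
  shows "expect (Noise d) (wt d \<beta>) n (\<lambda>xs. of_bool (psum (inc G) xs = z)) \<le> ret_bound G n"
proof (cases "n = 0")
  case True
  then show ?thesis by (simp add: ret_bound_def)
next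
  case False
  interpret iid_lists "Noise d" "wt d \<beta>" by (rule iid_lists_Noise) (use d \<beta> in auto)
  define y where "y = real n / (8 * real G)"
  have y: "0 < y" using False G by (simp add: y_def)
  have "E n (\<lambda>xs. of_bool (psum (inc G) xs = z)) \<le> E n (\<lambda>xs. \<Prod>g<G. srw1 (cnt G g xs) (z g))"
    using d \<beta> G by (intro psum_le_prod_srw1) auto
  also have "\<dots> \<le> E n (\<lambda>xs. y powr (- real G / 2) + (\<Sum>g<G. exp (y - real (cnt G g xs))))"
    using G y by (intro E_mono prod_srw1_le)
  also have "\<dots> = y powr (- real G / 2) + (\<Sum>g<G. E n (\<lambda>xs. exp y * exp (- real (cnt G g xs))))"
    by (simp add: expect_add E_const expect_sum exp_diff exp_minus field_simps)
  also have "\<dots> \<le> y powr (- real G / 2) + (\<Sum>g<G. exp y * exp (- real n / (4 * real G)))"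
    unfolding expect_cmult using E_exp_cnt[OF d \<beta> G] by (intro add_left_mono sum_mono mult_left_mono) auto
  also have "exp y * exp (- real n / (4 * real G)) = exp (- real n / (8 * real G))"
    using G by (simp add: exp_add[symmetric] y_def field_simps)
  finally show ?thesis using False by (simp add: ret_bound_def y_def)
qed

lemma ret_bound_nonneg: "0 \<le> ret_bound G n"
  by (simp add: ret_bound_def)

lemma summable_ret_bound:
  "summable (\<lambda>n. real n * ret_bound 5 n)" "summable (\<lambda>n. real n powr (5 / 4) * ret_bound 5 n)"
  "summable (\<lambda>n. real n * ret_bound 7 n)" "summable (\<lambda>n. (real n)\<^sup>2 * ret_bound 7 n)"
proof -
  \<comment> \<open>The second sequence decays most slowly, with exponent 5/4 - 5/2 = -5/4, so this
    comparison serves all four.\<close>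
  have s: "summable (\<lambda>n. real n powr (- (5 / 4)))"
    by (subst summable_real_powr_iff) simp
  have ev: "\<forall>\<^sub>F n in sequentially. ret_bound G n = (real n / (8 * real G)) powr (- real G / 2) + real G * exp (- real n / (8 * real G))" for G
    using eventually_gt_at_top[of 0] by eventually_elim (simp add: ret_bound_def)
  have tr: "(\<lambda>n. h n * ret_bound G n) \<in> O(\<lambda>n. real n powr (- (5 / 4))) \<longleftrightarrow>
      (\<lambda>n. h n * ((real n / (8 * real G)) powr (- real G / 2) + real G * exp (- real n / (8 * real G)))) \<in> O(\<lambda>n. real n powr (- (5 / 4)))"
    for h G by (rule landau_o.big.in_cong) (use ev[of G] in eventually_elim, simp)
  have "(\<lambda>n. real n * ((real n / 40) powr (- 5 / 2) + 5 * exp (- real n / 40))) \<in> O(\<lambda>n. real n powr (- (5 / 4)))"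
    "(\<lambda>n. real n powr (5 / 4) * ((real n / 40) powr (- 5 / 2) + 5 * exp (- real n / 40))) \<in> O(\<lambda>n. real n powr (- (5 / 4)))"
    "(\<lambda>n. real n * ((real n / 56) powr (- 7 / 2) + 7 * exp (- real n / 56))) \<in> O(\<lambda>n. real n powr (- (5 / 4)))"
    "(\<lambda>n. (real n)\<^sup>2 * ((real n / 56) powr (- 7 / 2) + 7 * exp (- real n / 56))) \<in> O(\<lambda>n. real n powr (- (5 / 4)))"
    by real_asymp+
  then have "(\<lambda>n. real n * ret_bound 5 n) \<in> O(\<lambda>n. real n powr (- (5 / 4)))"
    "(\<lambda>n. real n powr (5 / 4) * ret_bound 5 n) \<in> O(\<lambda>n. real n powr (- (5 / 4)))"
    "(\<lambda>n. real n * ret_bound 7 n) \<in> O(\<lambda>n. real n powr (- (5 / 4)))"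
    "(\<lambda>n. (real n)\<^sup>2 * ret_bound 7 n) \<in> O(\<lambda>n. real n powr (- (5 / 4)))"
    using tr[of "\<lambda>n. real n" 5] tr[of "\<lambda>n. real n powr (5 / 4)" 5] tr[of "\<lambda>n. real n" 7] tr[of "\<lambda>n. (real n)\<^sup>2" 7]
    by simp_all
  then show "summable (\<lambda>n. real n * ret_bound 5 n)" "summable (\<lambda>n. real n powr (5 / 4) * ret_bound 5 n)"
    "summable (\<lambda>n. real n * ret_bound 7 n)" "summable (\<lambda>n. (real n)\<^sup>2 * ret_bound 7 n)"
    using summable_comparison_test_bigo[of "\<lambda>n. real n powr (- (5 / 4))"] s by auto
qed

text \<open>The letters of class 0 with positive sign, whatever their mark: half of a class whose
  share is at least 1 / (2 G).\<close>

lemma mass_x0: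
  assumes d: "G < d" and \<beta>: "0 \<le> \<beta>" "\<beta> \<le> 1" and G: "0 < G"
  shows "1 / (4 * real G) \<le> (\<Sum>x\<in>{x\<in>Noise d. inc G x = inc G (2, 1, True)}. wt d \<beta> x)"
proof -
  let ?in = "\<lambda>i. 2 \<le> i \<and> (i - 2) mod G = 0"
  have eq: "inc G (i, 1, b) = inc G (2, 1, True)" if "?in i" for i b
    using that by (auto simp: inc_def)
  have "1 / (4 * real G) = 1 / 2 * (1 / (2 * real G))" by simp
  also have "\<dots> \<le> 1 / 2 * (real (card {i\<in>{1..d}. ?in i}) / real d)"
    using class_size[OF G G d] by (intro mult_left_mono) auto
  also have "\<dots> = (\<Sum>i\<in>{1..d}. of_bool (?in i) / (2 * real d))"
    by (simp add: sum_divide_distrib[symmetric] Int_def)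
  also have "\<dots> \<le> (\<Sum>x\<in>Noise d. wt d \<beta> x * of_bool (inc G x = inc G (2, 1, True)))"
    unfolding sum_Noise
  proof (intro sum_mono)
    fix i
    let ?t = "\<lambda>s b. wt d \<beta> (i, s, b) * of_bool (inc G (i, s, b) = inc G (2, 1, True))"
    have nn: "0 \<le> ?t s b" for s b using \<beta> by (simp add: wt_def)
    have "of_bool (?in i) / (2 * real d) \<le> ?t 1 True + ?t 1 False"
      using \<beta> eq[of i] by (cases "?in i") (auto simp: wt_def add_divide_distrib[symmetric])
    then show "of_bool (?in i) / (2 * real d) \<le> ?t 1 True + ?t 1 False + ?t (-1) True + ?t (-1) False"
      using nn[of "-1" True] nn[of "-1" False] by linarith
  qed
  also have "\<dots> = (\<Sum>x\<in>{x\<in>Noise d. inc G x = inc G (2, 1, True)}. wt d \<beta> x)"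
  proof -
    have "finite (Noise d)" by (simp add: Noise_def)
    then have "(\<Sum>x\<in>{x\<in>Noise d. inc G x = inc G (2, 1, True)}. wt d \<beta> x) =
        (\<Sum>x\<in>Noise d. if inc G x = inc G (2, 1, True) then wt d \<beta> x else 0)"
      by (rule sum.inter_filter)
    then show ?thesis by (auto intro!: sum.cong)
  qed
  finally show ?thesis .
qed

text \<open>The order of quantifiers is the point. Since \<open>ret_bound\<close> involves neither d
  nor \<beta>, \<open>s\<close> and then \<open>T\<close>, which depends on \<open>s\<close> through
  the block of 2 s forced steps, are chosen once for all dimensions and biases.\<close>

lemma cut_walk_Noise:
  assumes G: "0 < G" and sm: "summable (\<lambda>n. real n * ret_bound G n)"
  obtains s T where "\<And>d \<beta>. G < d \<Longrightarrow> 0 \<le> \<beta> \<Longrightarrow> \<beta> \<le> 1 \<Longrightarrow>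
    cut_walk (Noise d) (wt d \<beta>) (inc G) (\<lambda>f. f 0) (2, 1, True) (ret_bound G) s T (1 / (4 * real G))"
proof -
  have tail: "\<exists>N. \<forall>m\<ge>N. \<forall>n. (\<Sum>t\<in>{m..n}. real t * ret_bound G t) \<le> e" if e: "0 < e" for e
  proof -
    obtain N where N: "\<And>m n. m \<ge> N \<Longrightarrow> norm (\<Sum>t\<in>{m..n}. real t * ret_bound G t) < e"
      using summable_partial_sum_bound[OF sm e] by blast
    have "(\<Sum>t\<in>{m..n}. real t * ret_bound G t) \<le> e" if "m \<ge> N" for m n
      using N[OF that, of n] by (simp add: abs_less_iff)
    then show ?thesis by blast
  qed
  obtain s0 where s0: "\<And>m n. m \<ge> s0 \<Longrightarrow> (\<Sum>t\<in>{m..n}. real t * ret_bound G t) \<le> 1 / 8"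
    using tail[of "1 / 8"] by auto
  define s where "s = Suc s0"
  define p0 where "p0 = 1 / (4 * real G)"
  have p0: "0 < p0" using G by (simp add: p0_def)
  have "0 < (p0 ^ (2 * s) / 2) / (4 + p0 ^ (2 * s) / 2)" using p0 by (intro divide_pos_pos add_pos_pos) auto
  then obtain T0 where T0: "\<And>m n. m \<ge> T0 \<Longrightarrow> (\<Sum>t\<in>{m..n}. real t * ret_bound G t) \<le> (p0 ^ (2 * s) / 2) / (4 + p0 ^ (2 * s) / 2)"
    using tail by metis
  define T where "T = T0 + Suc s"
  show thesis
  proof (rule that[of s T])
    fix d :: nat and \<beta> :: real assume d: "G < d" and \<beta>: "0 \<le> \<beta>" "\<beta> \<le> 1"
    interpret iid_lists "Noise d" "wt d \<beta>" by (rule iid_lists_Noise) (use d \<beta> in auto)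
    show "cut_walk (Noise d) (wt d \<beta>) (inc G) (\<lambda>f. f 0) (2, 1, True) (ret_bound G) s T (1 / (4 * real G))"
      unfolding p0_def[symmetric]
    proof
      show "\<bar>inc G x 0\<bar> \<le> 1" if "x \<in> Noise d" for x
        using that by (auto simp: inc_def Noise_def)
      show "inc G (2, 1, True) 0 = 1" by (simp add: inc_def)
      show "(2, 1, True) \<in> Noise d" using d G by (simp add: Noise_def)
      show "p0 \<le> (\<Sum>x\<in>{x\<in>Noise d. inc G x = inc G (2, 1, True)}. wt d \<beta> x)"
        unfolding p0_def by (rule mass_x0[OF d \<beta> G])
      show "E n (\<lambda>xs. of_bool (psum (inc G) xs = z)) \<le> ret_bound G n" for n z
        by (rule psum_conc[OF d \<beta> G])
      show "(\<Sum>t\<in>{s..n}. real t * ret_bound G t) \<le> 1 / 8" for n by (rule s0) (simp add: s_def)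
      show "(\<Sum>t\<in>{T..n}. real t * ret_bound G t) \<le> (p0 ^ (2 * s) / 2) / (4 + p0 ^ (2 * s) / 2)" for n
        by (rule T0) (simp add: T_def)
    qed (auto simp: p0 s_def T_def)
  qed
qed

section \<open>Windows without cut times, uniformly in dimension and bias\<close>

context cut_walk
begin

text \<open>After exchanging the sums, t is counted for at most \<open>min t n\<close> values of r,
  and r + H \<le> (1 + H) t. Keeping the truncation at n leaves a useful bound when the sum of t^2 *
  a t diverges.\<close>

lemma sum_E_nocut_le:
  "(\<Sum>M<n. E (k + M) (\<lambda>xs. of_bool (nocut inc k xs))) \<le> 1 + (1 + H) * (\<Sum>t\<le>n + k. real t * real (min t n) * a t)"
proof -
  have "(\<Sum>r\<in>{1..<n}. (real r + H) * (\<Sum>t\<in>{r..r + k}. a t)) \<le> (\<Sum>r\<in>{1..<n}. \<Sum>t\<le>n + k. of_bool (r \<le> t) * ((1 + H) * real t * a t))"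
  proof (intro sum_mono)
    fix r assume r: "r \<in> {1..<n}"
    have "(real r + H) * (\<Sum>t\<in>{r..r + k}. a t) \<le> (\<Sum>t\<in>{r..r + k}. (1 + H) * real t * a t)"
      unfolding sum_distrib_left
    proof (intro sum_mono mult_right_mono a_nonneg)
      fix t assume t: "t \<in> {r..r + k}"
      have "H * 1 \<le> H * real t" using r t H_nonneg by (intro mult_left_mono) auto
      then show "real r + H \<le> (1 + H) * real t" using t by (simp add: distrib_right)
    qed
    also have "\<dots> = (\<Sum>t\<in>{r..r + k}. of_bool (r \<le> t) * ((1 + H) * real t * a t))"
      by (intro sum.cong) auto
    also have "\<dots> \<le> (\<Sum>t\<le>n + k. of_bool (r \<le> t) * ((1 + H) * real t * a t))"
      using r H_nonneg a_nonneg by (intro sum_mono2) auto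
    finally show "(real r + H) * (\<Sum>t\<in>{r..r + k}. a t) \<le> (\<Sum>t\<le>n + k. of_bool (r \<le> t) * ((1 + H) * real t * a t))" .
  qed
  also have "\<dots> = (\<Sum>t\<le>n + k. (\<Sum>r\<in>{1..<n}. of_bool (r \<le> t)) * ((1 + H) * real t * a t))"
    unfolding sum_distrib_right by (rule sum.swap)
  also have "\<dots> \<le> (\<Sum>t\<le>n + k. real (min t n) * ((1 + H) * real t * a t))"
  proof (intro sum_mono mult_right_mono)
    fix t
    have "(\<Sum>r\<in>{1..<n}. of_bool (r \<le> t)) = real (card {r\<in>{1..<n}. r \<le> t})" by (simp add: Int_def)
    also have "card {r\<in>{1..<n}. r \<le> t} \<le> card {1..min t n}" by (intro card_mono) auto
    finally show "(\<Sum>r\<in>{1..<n}. of_bool (r \<le> t)) \<le> real (min t n)" by simp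
  qed (use H_nonneg a_nonneg in auto)
  also have "\<dots> = (1 + H) * (\<Sum>t\<le>n + k. real t * real (min t n) * a t)"
    by (simp add: sum_distrib_left mult_ac)
  finally show ?thesis using sum_E_nocut[where n = n and k = k] by linarith
qed

end

text \<open>
  With \<open>G\<close> classes the return probabilities are of order \<open>n\<close> to the power \<open>- G / 2\<close>. Summability of their
  product with \<open>n\<close>, which needs five classes, gives the law of large numbers; summability of the product
  with \<open>n\<^sup>2\<close>, which needs seven, gives differentiability.
\<close>

lemma E_nocut_5:
  obtains C where "0 < C" "\<And>d \<beta> k n. 6 \<le> d \<Longrightarrow> 0 \<le> \<beta> \<Longrightarrow> \<beta> \<le> 1 \<Longrightarrow>
    (\<Sum>M<n. expect (Noise d) (wt d \<beta>) (k + M) (\<lambda>xs. of_bool (nocut (inc 5) k xs))) \<le> C * (real n + 1) powr (3 / 4)"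
proof -
  obtain s T where cw: "\<And>d \<beta>. 5 < d \<Longrightarrow> 0 \<le> \<beta> \<Longrightarrow> \<beta> \<le> 1 \<Longrightarrow>
    cut_walk (Noise d) (wt d \<beta>) (inc 5) (\<lambda>f. f 0) (2, 1, True) (ret_bound 5) s T (1 / (4 * real 5))"
    using cut_walk_Noise[of 5] summable_ret_bound by auto
  define h where "h = 4 * real T / ((1 / (4 * real 5)) ^ (2 * s) / 2)"
  define A where "A = suminf (\<lambda>n. real n powr (5 / 4) * ret_bound 5 n)"
  have h0: "0 \<le> h" by (simp add: h_def)
  have A: "0 \<le> A" unfolding A_def using summable_ret_bound by (intro suminf_nonneg) (auto simp: ret_bound_nonneg)
  show thesis
  proof (rule that[of "1 + (1 + h) * A"])
    show "0 < 1 + (1 + h) * A" using h0 A by (simp add: add_pos_nonneg)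
    fix d k n :: nat and \<beta> :: real assume d: "6 \<le> d" and \<beta>: "0 \<le> \<beta>" "\<beta> \<le> 1"
    interpret cut_walk "Noise d" "wt d \<beta>" "inc 5" "\<lambda>f. f 0" "(2, 1, True)" "ret_bound 5" s T "1 / (4 * real 5)"
      by (rule cw) (use d \<beta> in auto)
    have h: "H = h" unfolding h_def H_def \<delta>_def ..
    have "(\<Sum>t\<le>n + k. real t * real (min t n) * ret_bound 5 t) \<le> (\<Sum>t\<le>n + k. (real n + 1) powr (3 / 4) * (real t powr (5 / 4) * ret_bound 5 t))"
    proof (intro sum_mono)
      fix t
      \<comment> \<open>The factor \<open>min t n\<close> is split between t, whose power 5/4 is
        still summable against \<open>ret_bound 5\<close>, and n, which receives the power
        3/4.\<close>
      have "real (min t n) = real (min t n) powr (1 / 4) * real (min t n) powr (3 / 4)"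
        by (simp add: powr_add[symmetric])
      also have "\<dots> \<le> real t powr (1 / 4) * (real n + 1) powr (3 / 4)"
        by (intro mult_mono powr_mono2) auto
      finally have "real t * real (min t n) \<le> real t * (real t powr (1 / 4) * (real n + 1) powr (3 / 4))"
        by (intro mult_left_mono) auto
      also have "\<dots> = (real n + 1) powr (3 / 4) * (real t powr 1 * real t powr (1 / 4))" by simp
      also have "real t powr 1 * real t powr (1 / 4) = real t powr (5 / 4)"
        unfolding powr_add[symmetric] by simp
      finally show "real t * real (min t n) * ret_bound 5 t \<le> (real n + 1) powr (3 / 4) * (real t powr (5 / 4) * ret_bound 5 t)"
        using mult_right_mono[OF _ ret_bound_nonneg] by (metis mult.assoc)
    qed
    also have "\<dots> \<le> (real n + 1) powr (3 / 4) * A"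
      unfolding sum_distrib_left[symmetric] A_def using summable_ret_bound
      by (intro mult_left_mono sum_le_suminf) (auto simp: ret_bound_nonneg)
    finally have "(1 + h) * (\<Sum>t\<le>n + k. real t * real (min t n) * ret_bound 5 t) \<le> (1 + h) * ((real n + 1) powr (3 / 4) * A)"
      using h0 by (intro mult_left_mono) auto
    moreover have "1 \<le> (real n + 1) powr (3 / 4)" by (intro ge_one_powr_ge_zero) auto
    ultimately show "(\<Sum>M<n. E (k + M) (\<lambda>xs. of_bool (nocut (inc 5) k xs))) \<le> (1 + (1 + h) * A) * (real n + 1) powr (3 / 4)"
      using sum_E_nocut_le[where n = n and k = k] unfolding h by (simp add: algebra_simps)
  qed
qed

lemma E_nocut_7:
  obtains C where "0 < C" "\<And>d \<beta> k n. 8 \<le> d \<Longrightarrow> 0 \<le> \<beta> \<Longrightarrow> \<beta> \<le> 1 \<Longrightarrow>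
    (\<Sum>M<n. expect (Noise d) (wt d \<beta>) (k + M) (\<lambda>xs. of_bool (nocut (inc 7) k xs))) \<le> C"
proof -
  obtain s T where cw: "\<And>d \<beta>. 7 < d \<Longrightarrow> 0 \<le> \<beta> \<Longrightarrow> \<beta> \<le> 1 \<Longrightarrow>
    cut_walk (Noise d) (wt d \<beta>) (inc 7) (\<lambda>f. f 0) (2, 1, True) (ret_bound 7) s T (1 / (4 * real 7))"
    using cut_walk_Noise[of 7] summable_ret_bound by auto
  define h where "h = 4 * real T / ((1 / (4 * real 7)) ^ (2 * s) / 2)"
  define A where "A = suminf (\<lambda>n. (real n)\<^sup>2 * ret_bound 7 n)"
  have h0: "0 \<le> h" by (simp add: h_def)
  have A: "0 \<le> A" unfolding A_def using summable_ret_bound by (intro suminf_nonneg) (auto simp: ret_bound_nonneg)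
  show thesis
  proof (rule that[of "1 + (1 + h) * A"])
    show "0 < 1 + (1 + h) * A" using h0 A by (simp add: add_pos_nonneg)
    fix d k n :: nat and \<beta> :: real assume d: "8 \<le> d" and \<beta>: "0 \<le> \<beta>" "\<beta> \<le> 1"
    interpret cut_walk "Noise d" "wt d \<beta>" "inc 7" "\<lambda>f. f 0" "(2, 1, True)" "ret_bound 7" s T "1 / (4 * real 7)"
      by (rule cw) (use d \<beta> in auto)
    have h: "H = h" unfolding h_def H_def \<delta>_def ..
    have "(\<Sum>t\<le>n + k. real t * real (min t n) * ret_bound 7 t) \<le> (\<Sum>t\<le>n + k. (real t)\<^sup>2 * ret_bound 7 t)"
      unfolding power2_eq_square by (intro sum_mono mult_right_mono mult_left_mono ret_bound_nonneg) auto
    also have "\<dots> \<le> A"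
      unfolding A_def using summable_ret_bound by (intro sum_le_suminf) (auto simp: ret_bound_nonneg)
    finally have "(1 + h) * (\<Sum>t\<le>n + k. real t * real (min t n) * ret_bound 7 t) \<le> (1 + h) * A"
      using h0 by (intro mult_left_mono) auto
    then show "(\<Sum>M<n. E (k + M) (\<lambda>xs. of_bool (nocut (inc 7) k xs))) \<le> 1 + (1 + h) * A"
      using sum_E_nocut_le[where n = n and k = k] unfolding h by simp
  qed
qed

text \<open>A crossing of the last time n is a coincidence of the endpoint with an earlier site, so
  the bound on crossings becomes an escape probability uniform in d and \<beta>.\<close>

lemma E_no_return:
  obtains \<delta> t0 where "0 < \<delta>" "\<And>d \<beta> n. 6 \<le> d \<Longrightarrow> 0 \<le> \<beta> \<Longrightarrow> \<beta> \<le> 1 \<Longrightarrow> t0 \<le> n \<Longrightarrow>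
    expect (Noise d) (wt d \<beta>) n (\<lambda>xs. of_bool (\<exists>j\<in>{1..<n}. psum (inc 5) xs = psum (inc 5) (take j xs))) \<le> 1 - \<delta>"
proof -
  obtain s T where cw: "\<And>d \<beta>. 5 < d \<Longrightarrow> 0 \<le> \<beta> \<Longrightarrow> \<beta> \<le> 1 \<Longrightarrow>
    cut_walk (Noise d) (wt d \<beta>) (inc 5) (\<lambda>f. f 0) (2, 1, True) (ret_bound 5) s T (1 / (4 * real 5))"
    using cut_walk_Noise[of 5] summable_ret_bound by auto
  show thesis
  proof (rule that[of "(1 / (4 * real 5)) ^ (2 * s) / 2" "Suc s"])
    fix d n :: nat and \<beta> :: real assume d: "6 \<le> d" and \<beta>: "0 \<le> \<beta>" "\<beta> \<le> 1" and n: "Suc s \<le> n"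
    interpret cut_walk "Noise d" "wt d \<beta>" "inc 5" "\<lambda>f. f 0" "(2, 1, True)" "ret_bound 5" s T "1 / (4 * real 5)"
      by (rule cw) (use d \<beta> in auto)
    have "E n (\<lambda>xs. of_bool (\<exists>j\<in>{1..<n}. psum (inc 5) xs = psum (inc 5) (take j xs))) = E n (\<lambda>xs. of_bool (crossing n xs))"
      by (intro expect_cong) (simp add: crossing_def)
    then show "E n (\<lambda>xs. of_bool (\<exists>j\<in>{1..<n}. psum (inc 5) xs = psum (inc 5) (take j xs))) \<le> 1 - (1 / (4 * real 5)) ^ (2 * s) / 2"
      using crossing_prob[of n n] n unfolding \<delta>_def by simp
  qed simp
qed

section \<open>The excited random walk driven by words\<close>

text \<open>Histories of the walk are lists of sites with the current site first.\<close>

definition fresh :: "site list \<Rightarrow> bool" where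
  "fresh H \<longleftrightarrow> hd H \<notin> set (tl H)"

definition next_site :: "site list \<Rightarrow> noise \<Rightarrow> site" where
  "next_site H = (\<lambda>(i, s, b). hd H + Poly_Mapping.single i (if b \<and> i = 1 \<and> fresh H then 1 else s))"

primrec run :: "site list \<Rightarrow> noise list \<Rightarrow> site list" where
  "run H [] = H"
| "run H (x # xs) = run (next_site H x # H) xs"

lemma run_append [simp]: "run H (xs @ ys) = run (run H xs) ys"
  by (induction xs arbitrary: H) simp_all

lemma length_run [simp]: "length (run H xs) = length xs + length H"
  by (induction xs arbitrary: H) simp_all

lemma run_not_Nil [simp]: "H \<noteq> [] \<Longrightarrow> run H xs \<noteq> []"
  by (metis add_is_0 length_0_conv length_run)

lemma fresh_shift: "H \<noteq> [] \<Longrightarrow> fresh (map ((+) v) H) = fresh H"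
  unfolding fresh_def by (cases H) auto

lemma run_shift: "H \<noteq> [] \<Longrightarrow> run (map ((+) v) H) xs = map ((+) v) (run H xs)"
proof (induction xs arbitrary: H)
  case (Cons x xs)
  have "next_site (map ((+) v) H) x = v + next_site H x"
    using Cons.prems fresh_shift[of H v] by (cases x) (simp add: next_site_def hd_map add.assoc)
  then show ?case using Cons.IH[of "next_site H x # H"] by simp
qed simp

text \<open>\<open>P\<close> is an older past placed behind \<open>L\<close>. As long as the walk
  driven from \<open>L\<close> alone avoids \<open>P\<close>, the newness of its sites, and
  therefore each of its steps, is decided by \<open>L\<close>.\<close>

lemma run_past:
  assumes "L \<noteq> []" "\<And>j. j \<le> length zs \<Longrightarrow> hd (run L (take j zs)) \<notin> set P"
  shows "run (L @ P) zs = run L zs @ P"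
  using assms
proof (induction zs arbitrary: L)
  case (Cons x zs)
  have "fresh (L @ P) = fresh L"
    using Cons.prems(1) Cons.prems(2)[of 0] by (auto simp: fresh_def)
  then have "next_site (L @ P) x = next_site L x" using Cons.prems(1) by (simp add: next_site_def)
  moreover have "run ((next_site L x # L) @ P) zs = run (next_site L x # L) zs @ P"
    using Cons.prems(2)[of "Suc _"] by (intro Cons.IH) auto
  ultimately show ?case by simp
qed simp

lemma set_run: "set (run [v] xs) = (\<lambda>j. hd (run [v] (take j xs))) ` {..length xs}"
proof (induction xs rule: rev_induct)
  case (snoc x xs)
  have "run [v] (xs @ [x]) = hd (run [v] (xs @ [x])) # run [v] xs" by simp
  then have "set (run [v] (xs @ [x])) = insert (hd (run [v] (xs @ [x]))) (set (run [v] xs))"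
    by (metis list.simps(15))
  also have "set (run [v] xs) = (\<lambda>j. hd (run [v] (take j (xs @ [x])))) ` {..length xs}"
    unfolding snoc.IH by (intro image_cong) auto
  also have "insert (hd (run [v] (xs @ [x]))) \<dots> = (\<lambda>j. hd (run [v] (take j (xs @ [x])))) ` {..Suc (length xs)}"
    by (simp add: atMost_Suc)
  finally show ?case by simp
qed simp

lemma set_tl_run: "set (tl (run [v] xs)) = (\<lambda>j. hd (run [v] (take j xs))) ` {..<length xs}"
proof (cases xs rule: rev_cases)
  case (snoc ys y)
  have "(\<lambda>j. hd (run [v] (take j xs))) ` {..<length xs} = (\<lambda>j. hd (run [v] (take j ys))) ` {..length ys}"
    using snoc by (intro image_cong) auto
  then show ?thesis using snoc set_run[of v ys] by simp
qed simp

section \<open>Projection, cut times and new sites\<close>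

definition proj :: "nat \<Rightarrow> nat \<Rightarrow> site \<Rightarrow> nat \<Rightarrow> int" where
  "proj d G y = (\<lambda>g. \<Sum>i | i \<in> {2..d} \<and> (i - 2) mod G = g. Poly_Mapping.lookup y i)"

lemma proj_add: "proj d G (y + z) = proj d G y + proj d G z"
  by (simp add: proj_def fun_eq_iff lookup_add sum.distrib)

lemma proj_zero: "proj d G 0 = 0"
  by (simp add: proj_def fun_eq_iff)

lemma proj_single:
  assumes "i \<in> {1..d}"
  shows "proj d G (Poly_Mapping.single i s) = (\<lambda>g. if 2 \<le> i \<and> (i - 2) mod G = g then s else 0)"
proof
  fix g
  have "proj d G (Poly_Mapping.single i s) g = (\<Sum>k | k \<in> {2..d} \<and> (k - 2) mod G = g. if k = i then s else 0)"
    unfolding proj_def by (intro sum.cong) (auto simp: lookup_single when_def)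
  also have "\<dots> = (if 2 \<le> i \<and> (i - 2) mod G = g then s else 0)"
    using assms by (subst sum.delta) auto
  finally show "proj d G (Poly_Mapping.single i s) g = (if 2 \<le> i \<and> (i - 2) mod G = g then s else 0)" .
qed

lemma proj_next_site:
  assumes "x \<in> Noise d"
  shows "proj d G (next_site H x) = proj d G (hd H) + inc G x"
proof -
  obtain i s b where x: "x = (i, s, b)" by (cases x)
  show ?thesis using assms unfolding x next_site_def inc_def Noise_def by (auto simp: proj_add proj_single fun_eq_iff)
qed

lemma proj_run:
  assumes "set xs \<subseteq> Noise d"
  shows "proj d G (hd (run H xs)) = proj d G (hd H) + psum (inc G) xs"
  using assms by (induction xs arbitrary: H) (simp_all add: proj_next_site add.assoc)

definition cutat :: "('x \<Rightarrow> 'a::ab_group_add) \<Rightarrow> nat \<Rightarrow> 'x list \<Rightarrow> bool" where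
  "cutat f c xs \<longleftrightarrow> (\<forall>i\<in>{c..length xs}. \<forall>j<c. psum f (take i xs) \<noteq> psum f (take j xs))"

lemma not_nocut: "\<not> nocut f k xs \<longleftrightarrow> (\<exists>c. k < c \<and> c \<le> length xs \<and> cutat f c xs)"
  unfolding nocut_def cutat_def by blast

lemma psum_cong: "map f xs = map f ys \<Longrightarrow> psum f (take i xs) = psum f (take i ys)"
  unfolding psum_def take_map[symmetric] by simp

lemma cutat_cong: "map f xs = map f ys \<Longrightarrow> cutat f c xs = cutat f c ys"
  unfolding cutat_def using psum_cong[of f xs ys] map_eq_imp_length_eq[of f xs f ys] by simp

lemma nocut_cong: "map f xs = map f ys \<Longrightarrow> nocut f c xs = nocut f c ys"
  unfolding nocut_def using psum_cong[of f xs ys] map_eq_imp_length_eq[of f xs f ys] by simp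

lemma cutat_suffix: "cutat f (length us + c) (us @ ys) \<Longrightarrow> cutat f c ys"
  unfolding cutat_def
proof (intro ballI allI impI)
  fix i j assume *: "\<forall>i\<in>{length us + c..length (us @ ys)}. \<forall>j<length us + c. psum f (take i (us @ ys)) \<noteq> psum f (take j (us @ ys))"
    and i: "i \<in> {c..length ys}" and j: "j < c"
  have "psum f (take (length us + i) (us @ ys)) \<noteq> psum f (take (length us + j) (us @ ys))"
    using i j by (intro *[rule_format]) auto
  then show "psum f (take i ys) \<noteq> psum f (take j ys)" by simp
qed

lemma nocut_prepend:
  assumes "nocut f k ys"
  shows "nocut f (length us + k) (us @ ys)"
proof (rule ccontr)
  assume "\<not> nocut f (length us + k) (us @ ys)"
  then obtain c where c: "length us + k < c" "c \<le> length (us @ ys)" "cutat f c (us @ ys)"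
    unfolding not_nocut by blast
  then have "cutat f (c - length us) ys" using cutat_suffix[of f us "c - length us" ys] by simp
  then have "\<not> nocut f k ys" using c unfolding not_nocut by (intro exI[of _ "c - length us"]) auto
  then show False using assms by simp
qed

text \<open>A letter with zero increment merely repeats a position. The map \<phi> of times
  preserves positions, and a time c of the shorter word is compared with c or c + 1 in the longer
  one, so that earlier and later times stay on their sides. It will be applied to the horizontal
  letter that is differentiated.\<close>

lemma nocut_remove:
  assumes nc: "nocut f k (zs @ x # vs)" and fx: "f x = 0" and k: "k \<le> length zs"
  shows "nocut f k (zs @ vs)"
  unfolding nocut_def
proof (intro allI impI)
  let ?p = "length zs" and ?xs = "zs @ x # vs" and ?ys = "zs @ vs"
  define \<phi> where "\<phi> i = (if i \<le> ?p then i else i - 1)" for i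
  have Z: "psum f (take i ?xs) = psum f (take (\<phi> i) ?ys)" for i
    using fx by (auto simp: \<phi>_def take_Cons' not_le)
  fix c assume c: "k < c \<and> c \<le> length ?ys"
  define c' where "c' = (if c \<le> ?p then c else Suc c)"
  have "k < c' \<and> c' \<le> length ?xs" using c by (auto simp: c'_def)
  then obtain i j where ij: "i \<in> {c'..length ?xs}" "j < c'" "psum f (take i ?xs) = psum f (take j ?xs)"
    using nc unfolding nocut_def by blast
  have "\<phi> i \<in> {c..length ?ys}" "\<phi> j < c" using ij c by (auto simp: \<phi>_def c'_def split: if_splits)
  then show "\<exists>i\<in>{c..length ?ys}. \<exists>j<c. psum f (take i ?ys) = psum f (take j ?ys)"
    using ij(3) unfolding Z by blast
qed

definition newsite :: "noise list \<Rightarrow> bool" where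
  "newsite xs \<longleftrightarrow> fresh (run [0] xs)"

text \<open>From a cut time on the projection avoids all earlier projected sites, so the walk avoids
  all earlier sites. By \<open>run_past\<close> they influence neither the later steps nor the
  newness of the final site, and a translation moves the new start to 0.\<close>

lemma newsite_cut:
  assumes xs: "set xs \<subseteq> Noise d" and c: "c \<le> length xs" and cut: "cutat (inc G) c xs"
  shows "newsite xs \<longleftrightarrow> newsite (drop c xs)"
proof -
  let ?us = "take c xs" and ?zs = "drop c xs"
  define y where "y = hd (run [0] ?us)"
  define P where "P = tl (run [0] ?us)"
  have yP: "run [0] ?us = [y] @ P" using run_not_Nil[of "[0]" ?us] by (simp add: y_def P_def)
  have us: "set ?us \<subseteq> Noise d" and zs: "set ?zs \<subseteq> Noise d"
    using xs set_take_subset[of c xs] set_drop_subset[of c xs] by auto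
  have no: "hd (run [y] (take j ?zs)) \<notin> set P" if j: "j \<le> length ?zs" for j
  proof
    assume "hd (run [y] (take j ?zs)) \<in> set P"
    then obtain l where l: "l < c" "hd (run [y] (take j ?zs)) = hd (run [0] (take l xs))"
      unfolding P_def set_tl_run using c by (auto simp: min_def split: if_splits)
    have "set (take j ?zs) \<subseteq> Noise d" using zs set_take_subset[of j ?zs] by blast
    then have "proj d G (hd (run [y] (take j ?zs))) = proj d G y + psum (inc G) (take j ?zs)"
      by (simp add: proj_run)
    also have "proj d G y = psum (inc G) ?us" using proj_run[OF us, of G "[0]"] by (simp add: y_def proj_zero)
    also have "psum (inc G) ?us + psum (inc G) (take j ?zs) = psum (inc G) (take (c + j) xs)"
      by (simp add: take_add)
    finally have 1: "proj d G (hd (run [y] (take j ?zs))) = psum (inc G) (take (c + j) xs)" .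
    have "set (take l xs) \<subseteq> Noise d" using xs set_take_subset[of l xs] by blast
    then have "proj d G (hd (run [0] (take l xs))) = psum (inc G) (take l xs)"
      using proj_run[of "take l xs" d G "[0]"] by (simp add: proj_zero)
    moreover have "psum (inc G) (take (c + j) xs) \<noteq> psum (inc G) (take l xs)"
      using l j c by (intro cut[unfolded cutat_def, rule_format]) auto
    ultimately show False using 1 l by simp
  qed
  have "run [0] xs = run (run [0] ?us) ?zs" by (metis append_take_drop_id run_append)
  also have "\<dots> = run [y] ?zs @ P" unfolding yP using no by (intro run_past) auto
  finally have "newsite xs \<longleftrightarrow> fresh (run [y] ?zs @ P)" by (simp add: newsite_def)
  also have "\<dots> \<longleftrightarrow> fresh (run [y] ?zs)"
    using no[of "length ?zs"] by (auto simp: fresh_def)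
  also have "run [y] ?zs = map ((+) y) (run [0] ?zs)" using run_shift[of "[0]" y ?zs] by simp
  also have "fresh \<dots> \<longleftrightarrow> newsite ?zs" by (simp add: fresh_shift newsite_def)
  finally show ?thesis .
qed

lemma newsite_append:
  assumes "set (us @ ys) \<subseteq> Noise d" "\<not> nocut (inc G) (length us) (us @ ys)"
  shows "newsite (us @ ys) = newsite ys"
proof -
  obtain c where c: "length us < c" "c \<le> length (us @ ys)" "cutat (inc G) c (us @ ys)"
    using assms(2) unfolding not_nocut by blast
  then have c': "cutat (inc G) (c - length us) ys" using cutat_suffix[of "inc G" us "c - length us" ys] by simp
  have "newsite (us @ ys) = newsite (drop c (us @ ys))" by (rule newsite_cut[OF assms(1) c(2,3)])
  also have "drop c (us @ ys) = drop (c - length us) ys" using c by simp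
  also have "newsite \<dots> = newsite ys" using assms(1) c c' by (intro newsite_cut[symmetric]) auto
  finally show ?thesis .
qed

text \<open>The changed letter has index \<open>length us\<close>, hence is dropped with the letters
  before a cut time \<open>c > length us\<close>; equality of the increments keeps \<open>c\<close>
  a cut time after the change.\<close>

lemma newsite_flip:
  assumes "set (us @ x # vs) \<subseteq> Noise d" "x' \<in> Noise d" "inc G x = inc G x'"
    "\<not> nocut (inc G) (length us) (us @ x # vs)"
  shows "newsite (us @ x # vs) = newsite (us @ x' # vs)"
proof -
  obtain c where c: "length us < c" "c \<le> length (us @ x # vs)" "cutat (inc G) c (us @ x # vs)"
    using assms(4) unfolding not_nocut by blast
  have c': "cutat (inc G) c (us @ x' # vs)"
    using c(3) cutat_cong[of "inc G" "us @ x # vs" "us @ x' # vs" c] assms(3) by simp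
  have "newsite (us @ x # vs) = newsite (drop c (us @ x # vs))" by (rule newsite_cut[OF assms(1) c(2,3)])
  also have "drop c (us @ x # vs) = drop c (us @ x' # vs)" using c(1) by (simp add: drop_Cons')
  also have "newsite \<dots> = newsite (us @ x' # vs)" using assms(1,2) c c' by (intro newsite_cut[symmetric]) auto
  finally show ?thesis .
qed

text \<open>The mark is consulted only for horizontal letters, and replaces a step by itself if s =
  1. Only the letters with i = 1 and s = -1 will contribute to the derivative.\<close>

lemma newsite_irrelevant_flip:
  "i \<noteq> 1 \<or> s = 1 \<Longrightarrow> newsite (us @ (i, s, b) # vs) = newsite (us @ (i, s, b') # vs)"
  by (auto simp: newsite_def next_site_def)

lemma newsite_if_projection_new:
  assumes "set xs \<subseteq> Noise d" "\<And>j. j < length xs \<Longrightarrow> psum (inc G) xs \<noteq> psum (inc G) (take j xs)"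
  shows "newsite xs"
proof -
  have "proj d G (hd (run [0] xs)) = psum (inc G) xs"
    using proj_run[OF assms(1), of G "[0]"] by (simp add: proj_zero)
  moreover have "proj d G (hd (run [0] (take j xs))) = psum (inc G) (take j xs)" for j
    using proj_run[of "take j xs" d G "[0]"] assms(1) set_take_subset[of j xs] by (auto simp: proj_zero)
  ultimately show ?thesis using assms(2) unfolding newsite_def fresh_def set_tl_run by fastforce
qed

section \<open>Density of new sites\<close>

definition pnew :: "nat \<Rightarrow> real \<Rightarrow> nat \<Rightarrow> real" where
  "pnew d \<beta> n = expect (Noise d) (wt d \<beta>) n (\<lambda>xs. of_bool (newsite xs))"

text \<open>The bias is set to 0 because the event depends on the increments only, and these do not
  see the mark; the two marks of a letter together have weight 1 / (2 d) for every bias.\<close>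

definition nocut_prob :: "nat \<Rightarrow> nat \<Rightarrow> nat \<Rightarrow> nat \<Rightarrow> real" where
  "nocut_prob d G K m = expect (Noise d) (wt d 0) (K + m) (\<lambda>xs. of_bool (nocut (inc G) K xs))"

definition nocut_sup :: "nat \<Rightarrow> nat \<Rightarrow> nat \<Rightarrow> real" where
  "nocut_sup d G m = (SUP K. nocut_prob d G K m)"

lemma expect_wt_indep:
  assumes "\<And>xs ys. map (inc G) xs = map (inc G) ys \<Longrightarrow> f xs = f ys"
  shows "expect (Noise d) (wt d \<beta>) n f = expect (Noise d) (wt d \<beta>') n f"
  using assms
proof (induction n arbitrary: f)
  case 0
  show ?case by simp
next
  case (Suc n)
  have IH: "expect (Noise d) (wt d \<beta>) n (\<lambda>xs. f (x # xs)) = expect (Noise d) (wt d \<beta>') n (\<lambda>xs. f (x # xs))" for x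
    by (rule Suc.IH) (rule Suc.prems, simp)
  have "f ((i, s, True) # xs) = f ((i, s, False) # xs)" for i s xs
    by (rule Suc.prems) (simp add: inc_def)
  then have eq: "expect (Noise d) (wt d \<beta>') n (\<lambda>xs. f ((i, s, True) # xs)) = expect (Noise d) (wt d \<beta>') n (\<lambda>xs. f ((i, s, False) # xs))" for i s
    by presburger
  have "wt d \<beta> (i, s, True) * X + wt d \<beta> (i, s, False) * X = wt d \<beta>' (i, s, True) * X + wt d \<beta>' (i, s, False) * X" for i s X
    by (simp add: wt_def add_divide_distrib[symmetric] distrib_right[symmetric])
  then show ?case unfolding expect.simps IH sum_Noise eq by (simp add: add.assoc)
qed

lemma E_nocut_indep:
  "expect (Noise d) (wt d \<beta>) (K + m) (\<lambda>xs. of_bool (nocut (inc G) K xs)) = nocut_prob d G K m"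
  unfolding nocut_prob_def
proof (rule expect_wt_indep[where G = G])
  fix xs ys assume "map (inc G) xs = map (inc G) ys"
  then have "nocut (inc G) K xs = nocut (inc G) K ys" by (rule nocut_cong)
  then show "of_bool (nocut (inc G) K xs) = (of_bool (nocut (inc G) K ys) :: real)" by simp
qed

locale erw =
  fixes d :: nat and \<beta> :: real
  assumes d_pos: "0 < d" and \<beta>: "0 \<le> \<beta>" "\<beta> \<le> 1"

sublocale erw \<subseteq> iid_lists "Noise d" "wt d \<beta>"
  by (rule iid_lists_Noise) (use d_pos \<beta> in auto)

context
  fixes d :: nat
  assumes d: "0 < d"
begin

interpretation erw d 0 by unfold_locales (use d in auto)

lemma nocut_prob_nonneg: "0 \<le> nocut_prob d G K m" and nocut_prob_le_1: "nocut_prob d G K m \<le> 1"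
  unfolding nocut_prob_def by (intro E_nonneg E_le_const; simp)+

text \<open>A letter put in front of the past can only add coincidences. Monotonicity in K makes the
  supremum a limit, so that bounds on sums over m, valid for each fixed K, pass to the sum of the
  suprema.\<close>

lemma nocut_prob_mono: "nocut_prob d G K m \<le> nocut_prob d G (Suc K) m"
proof -
  have "nocut_prob d G K m = E 1 (\<lambda>us. E (K + m) (\<lambda>ys. of_bool (nocut (inc G) K ys)))"
    by (simp only: E_const nocut_prob_def)
  also have "\<dots> \<le> E 1 (\<lambda>us. E (K + m) (\<lambda>ys. of_bool (nocut (inc G) (Suc K) (us @ ys))))"
  proof (intro E_mono)
    fix us ys :: "noise list" assume "length us = 1"
    then show "of_bool (nocut (inc G) K ys) \<le> (of_bool (nocut (inc G) (Suc K) (us @ ys)) :: real)"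
      using nocut_prepend[of "inc G" K ys us] by auto
  qed
  also have "\<dots> = E (1 + (K + m)) (\<lambda>xs. of_bool (nocut (inc G) (Suc K) xs))"
    by (rule expect_append[symmetric])
  finally show ?thesis by (simp add: nocut_prob_def)
qed

lemma bdd_nocut_prob: "bdd_above (range (\<lambda>K. nocut_prob d G K m))"
  using nocut_prob_le_1 by (intro bdd_aboveI[of _ 1]) auto

lemma nocut_prob_le_nocut_sup: "nocut_prob d G K m \<le> nocut_sup d G m"
  unfolding nocut_sup_def using bdd_nocut_prob by (intro cSUP_upper) auto

lemma nocut_sup_nonneg: "0 \<le> nocut_sup d G m"
  using nocut_prob_nonneg nocut_prob_le_nocut_sup by (rule order.trans)

lemma sum_nocut_sup_le:
  assumes "\<And>K. (\<Sum>m<n. nocut_prob d G K m) \<le> B"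
  shows "(\<Sum>m<n. nocut_sup d G m) \<le> B"
proof (rule LIMSEQ_le_const2)
  have "(\<lambda>K. nocut_prob d G K m) \<longlonglongrightarrow> nocut_sup d G m" for m
    unfolding nocut_sup_def by (intro LIMSEQ_incseq_SUP bdd_nocut_prob incseq_SucI nocut_prob_mono)
  then show "(\<lambda>K. \<Sum>m<n. nocut_prob d G K m) \<longlonglongrightarrow> (\<Sum>m<n. nocut_sup d G m)" by (intro tendsto_sum)
qed (use assms in auto)

end

lemma nocut_sup_5:
  obtains C where "0 < C" "\<And>d n. 6 \<le> d \<Longrightarrow> (\<Sum>m<n. nocut_sup d 5 m) \<le> C * (real n + 1) powr (3 / 4)"
proof -
  obtain C where C: "0 < C" "\<And>d \<beta> k n. 6 \<le> d \<Longrightarrow> 0 \<le> \<beta> \<Longrightarrow> \<beta> \<le> 1 \<Longrightarrow>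
    (\<Sum>M<n. expect (Noise d) (wt d \<beta>) (k + M) (\<lambda>xs. of_bool (nocut (inc 5) k xs))) \<le> C * (real n + 1) powr (3 / 4)"
    using E_nocut_5 by blast
  have "(\<Sum>m<n. nocut_sup d 5 m) \<le> C * (real n + 1) powr (3 / 4)" if "6 \<le> d" for d n
    using C(2)[OF that, of 0] that by (intro sum_nocut_sup_le) (auto simp: E_nocut_indep)
  then show thesis using that C(1) by blast
qed

lemma nocut_sup_7:
  obtains C where "0 < C" "\<And>d n. 8 \<le> d \<Longrightarrow> (\<Sum>m<n. nocut_sup d 7 m) \<le> C"
proof -
  obtain C where C: "0 < C" "\<And>d \<beta> k n. 8 \<le> d \<Longrightarrow> 0 \<le> \<beta> \<Longrightarrow> \<beta> \<le> 1 \<Longrightarrow>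
    (\<Sum>M<n. expect (Noise d) (wt d \<beta>) (k + M) (\<lambda>xs. of_bool (nocut (inc 7) k xs))) \<le> C"
    using E_nocut_7 by blast
  have "(\<Sum>m<n. nocut_sup d 7 m) \<le> C" if "8 \<le> d" for d n
    using C(2)[OF that, of 0] that by (intro sum_nocut_sup_le) (auto simp: E_nocut_indep)
  then show thesis using that C(1) by blast
qed

section \<open>Decorrelation of new sites\<close>

context erw
begin

text \<open>Replacing \<open>newsite (us @ ys)\<close> by \<open>newsite ys\<close> makes the two
  factors independent, at the cost of an error supported on \<open>nocut\<close>.\<close>

lemma decouple:
  assumes f: "\<And>us. 0 \<le> f us" "\<And>us. f us \<le> 1"
  shows "\<bar>E (m + n) (\<lambda>xs. f (take m xs) * of_bool (newsite xs)) - E m f * pnew d \<beta> n\<bar> \<le> nocut_sup d G n"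
proof -
  let ?g = "\<lambda>us ys. f us * (of_bool (newsite (us @ ys)) - of_bool (newsite ys)) :: real"
  have "E (m + n) (\<lambda>xs. f (take m xs) * of_bool (newsite xs))
      = E m (\<lambda>us. E n (\<lambda>ys. f us * of_bool (newsite (us @ ys))))"
    unfolding expect_append by (intro expect_cong) simp
  moreover have "E m f * pnew d \<beta> n = E m (\<lambda>us. E n (\<lambda>ys. f us * of_bool (newsite ys)))"
  proof -
    have "E m (\<lambda>us. E n (\<lambda>ys. f us * of_bool (newsite ys))) = E m (\<lambda>us. f us * pnew d \<beta> n)"
      by (simp only: expect_cmult pnew_def)
    also have "\<dots> = E m (\<lambda>us. pnew d \<beta> n * f us)" by (simp only: mult.commute)
    also have "\<dots> = pnew d \<beta> n * E m f" by (rule expect_cmult)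
    finally show ?thesis unfolding mult.commute[of "E m f"] by (rule sym)
  qed
  ultimately have eq: "E (m + n) (\<lambda>xs. f (take m xs) * of_bool (newsite xs)) - E m f * pnew d \<beta> n = E m (\<lambda>us. E n (?g us))"
    by (simp only: expect_diff right_diff_distrib)
  have "\<bar>E m (\<lambda>us. E n (?g us))\<bar> \<le> E m (\<lambda>us. E n (\<lambda>ys. \<bar>?g us ys\<bar>))"
    by (rule order.trans[OF E_abs]) (intro E_mono E_abs)
  also have "\<dots> \<le> E m (\<lambda>us. E n (\<lambda>ys. of_bool (nocut (inc G) m (us @ ys))))"
  proof (intro E_mono)
    fix us ys :: "noise list" assume *: "set us \<subseteq> Noise d" "length us = m" "set ys \<subseteq> Noise d"
    show "\<bar>?g us ys\<bar> \<le> of_bool (nocut (inc G) m (us @ ys))"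
    proof (cases "nocut (inc G) m (us @ ys)")
      case False
      then have "newsite (us @ ys) = newsite ys" using * by (intro newsite_append[of _ _ d G]) auto
      then show ?thesis by simp
    next
      case True
      have "\<bar>of_bool (newsite (us @ ys)) - of_bool (newsite ys)\<bar> \<le> (1::real)" by auto
      then show ?thesis using True mult_mono[of "\<bar>f us\<bar>" 1 "\<bar>of_bool (newsite (us @ ys)) - of_bool (newsite ys)\<bar>" 1] f[of us]
        by (simp add: abs_mult)
    qed
  qed
  also have "\<dots> = nocut_prob d G m n"
    using expect_append[of "Noise d" "wt d \<beta>" m n "\<lambda>xs. of_bool (nocut (inc G) m xs)"] E_nocut_indep[of d \<beta> m n G] by simp
  also have "\<dots> \<le> nocut_sup d G n" using d_pos by (rule nocut_prob_le_nocut_sup)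
  finally show ?thesis unfolding eq .
qed

lemma pnew_close: "\<bar>pnew d \<beta> (m + n) - pnew d \<beta> n\<bar> \<le> nocut_sup d G n"
  using decouple[of "\<lambda>_. 1" m n G] by (simp add: E_const pnew_def)

lemma pnew_01: "0 \<le> pnew d \<beta> n" "pnew d \<beta> n \<le> 1"
  unfolding pnew_def by (intro E_nonneg E_le_const; simp)+

definition centred :: "nat \<Rightarrow> noise list \<Rightarrow> real" where
  "centred k xs = of_bool (newsite (take k xs)) - pnew d \<beta> k"

text \<open>One error comes from decoupling, which produces \<open>pnew d \<beta> m\<close>, the
  other from exchanging this for \<open>pnew d \<beta> (j + m)\<close>.\<close>

lemma covariance:
  assumes "j + m \<le> N"
  shows "\<bar>E N (\<lambda>xs. centred j xs * centred (j + m) xs)\<bar> \<le> 2 * nocut_sup d G m"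
proof -
  let ?k = "j + m"
  let ?A = "\<lambda>k xs. of_bool (newsite (take k xs)) :: real"
  have EA: "E N (?A k) = pnew d \<beta> k" if "k \<le> N" for k
    using E_take[OF that, of "\<lambda>xs. of_bool (newsite xs)"] by (simp add: pnew_def)
  have "E N (\<lambda>xs. centred j xs * centred ?k xs) = E N (\<lambda>xs. ?A j xs * ?A ?k xs - pnew d \<beta> ?k * ?A j xs - pnew d \<beta> j * ?A ?k xs + pnew d \<beta> j * pnew d \<beta> ?k)"
    by (intro expect_cong) (simp add: centred_def algebra_simps)
  also have "\<dots> = E N (\<lambda>xs. ?A j xs * ?A ?k xs) - pnew d \<beta> j * pnew d \<beta> ?k"
    using EA[of j] EA[of ?k] assms by (simp add: expect_add expect_diff expect_cmult E_const)
  also have "E N (\<lambda>xs. ?A j xs * ?A ?k xs) = E ?k (\<lambda>xs. ?A j xs * of_bool (newsite xs))"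
    using E_take[OF assms, of "\<lambda>xs. ?A j xs * of_bool (newsite xs)"] by (simp add: min_def)
  finally have eq: "E N (\<lambda>xs. centred j xs * centred ?k xs) = E ?k (\<lambda>xs. ?A j xs * of_bool (newsite xs)) - pnew d \<beta> j * pnew d \<beta> ?k" .
  have 1: "\<bar>E ?k (\<lambda>xs. ?A j xs * of_bool (newsite xs)) - pnew d \<beta> j * pnew d \<beta> m\<bar> \<le> nocut_sup d G m"
    using decouple[of "\<lambda>xs. of_bool (newsite xs)" j m G] by (simp add: pnew_def)
  have "\<bar>pnew d \<beta> j * pnew d \<beta> ?k - pnew d \<beta> j * pnew d \<beta> m\<bar> = pnew d \<beta> j * \<bar>pnew d \<beta> ?k - pnew d \<beta> m\<bar>"
    using pnew_01 by (simp add: right_diff_distrib[symmetric] abs_mult)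
  also have "\<dots> \<le> 1 * nocut_sup d G m" using pnew_close pnew_01 by (intro mult_mono) auto
  finally show ?thesis using 1 unfolding eq by linarith
qed

lemma variance: "E N (\<lambda>xs. (\<Sum>k<N. centred k xs)\<^sup>2) \<le> 4 * real N * (\<Sum>m<N. nocut_sup d G m)"
proof -
  have cov: "E N (\<lambda>xs. centred j xs * centred k xs) \<le> of_bool (j \<le> k) * (2 * nocut_sup d G (k - j)) + of_bool (k \<le> j) * (2 * nocut_sup d G (j - k))"
    if "j < N" "k < N" for j k
  proof (cases "j \<le> k")
    case True
    then show ?thesis using covariance[of j "k - j" N G] that nocut_sup_nonneg[OF d_pos, of G 0] by auto
  next
    case False
    then have "E N (\<lambda>xs. centred k xs * centred j xs) \<le> 2 * nocut_sup d G (j - k)" using covariance[of k "j - k" N G] that by auto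
    then show ?thesis using False by (simp add: mult.commute)
  qed
  have row: "(\<Sum>k<N. of_bool (j \<le> k) * (2 * nocut_sup d G (k - j))) \<le> 2 * (\<Sum>m<N. nocut_sup d G m)" for j
  proof -
    have "(\<Sum>k<N. of_bool (j \<le> k) * (2 * nocut_sup d G (k - j))) = (\<Sum>k\<in>{j..<N}. 2 * nocut_sup d G (k - j))"
      by (intro sum.mono_neutral_cong_right) auto
    also have "\<dots> = (\<Sum>m<N - j. 2 * nocut_sup d G m)"
      by (rule sum.reindex_bij_witness[where i = "\<lambda>m. m + j" and j = "\<lambda>k. k - j"]) auto
    also have "\<dots> \<le> (\<Sum>m<N. 2 * nocut_sup d G m)"
      using nocut_sup_nonneg[OF d_pos] by (intro sum_mono2) auto
    finally show ?thesis by (simp add: sum_distrib_left)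
  qed
  have "E N (\<lambda>xs. (\<Sum>k<N. centred k xs)\<^sup>2) = (\<Sum>j<N. \<Sum>k<N. E N (\<lambda>xs. centred j xs * centred k xs))"
    unfolding power2_eq_square sum_product by (simp only: expect_sum)
  also have "\<dots> \<le> (\<Sum>j<N. \<Sum>k<N. of_bool (j \<le> k) * (2 * nocut_sup d G (k - j)) + of_bool (k \<le> j) * (2 * nocut_sup d G (j - k)))"
    by (intro sum_mono cov) auto
  also have "\<dots> = (\<Sum>j<N. \<Sum>k<N. of_bool (j \<le> k) * (2 * nocut_sup d G (k - j))) + (\<Sum>j<N. \<Sum>k<N. of_bool (k \<le> j) * (2 * nocut_sup d G (j - k)))"
    by (simp only: sum.distrib)
  also have "(\<Sum>j<N. \<Sum>k<N. of_bool (k \<le> j) * (2 * nocut_sup d G (j - k))) = (\<Sum>k<N. \<Sum>j<N. of_bool (k \<le> j) * (2 * nocut_sup d G (j - k)))"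
    by (rule sum.swap)
  also have "(\<Sum>j<N. \<Sum>k<N. of_bool (j \<le> k) * (2 * nocut_sup d G (k - j))) + \<dots> \<le> (\<Sum>j<N. 2 * (\<Sum>m<N. nocut_sup d G m)) + (\<Sum>j<N. 2 * (\<Sum>m<N. nocut_sup d G m))"
    by (intro add_mono sum_mono row)
  also have "\<dots> = 4 * real N * (\<Sum>m<N. nocut_sup d G m)" by simp
  finally show ?thesis .
qed

end

section \<open>Russo's formula\<close>

definition dwt :: "nat \<Rightarrow> noise \<Rightarrow> real" where
  "dwt d = (\<lambda>(i, s, b). (if b then 1 else -1) / (2 * real d))"

lemma has_derivative_wt: "((\<lambda>\<beta>. wt d \<beta> x) has_real_derivative dwt d x) (at \<beta> within A)"
proof -
  obtain i s b where x: "x = (i, s, b)" by (cases x)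
  have "((\<lambda>\<beta>. if b then \<beta> else 1 - \<beta>) has_real_derivative (if b then 1 else -1)) (at \<beta> within A)"
    by (cases b) (auto intro!: derivative_eq_intros)
  from DERIV_cdivide[OF this, of "2 * real d"] show ?thesis by (simp only: x wt_def dwt_def prod.case)
qed

text \<open>The term of Russo's formula in which the letter following the first \<open>k\<close> is
  differentiated, with \<open>m\<close> letters after it.\<close>

definition influence :: "nat \<Rightarrow> real \<Rightarrow> nat \<Rightarrow> nat \<Rightarrow> (noise list \<Rightarrow> real) \<Rightarrow> real" where
  "influence d \<beta> k m f = expect (Noise d) (wt d \<beta>) k (\<lambda>us. \<Sum>x\<in>Noise d. dwt d x * expect (Noise d) (wt d \<beta>) m (\<lambda>vs. f (us @ x # vs)))"

lemma expect_has_derivative: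
  "((\<lambda>\<beta>. expect (Noise d) (wt d \<beta>) n f) has_real_derivative (\<Sum>m<n. influence d \<beta> (n - Suc m) m f)) (at \<beta> within A)"
proof -
  have "((\<lambda>\<beta>. expect (Noise d) (wt d \<beta>) n f) has_real_derivative (\<Sum>k<n. influence d \<beta> k (n - Suc k) f)) (at \<beta> within A)"
  proof (induction n arbitrary: f)
    case (Suc n)
    have "((\<lambda>\<beta>. expect (Noise d) (wt d \<beta>) (Suc n) f) has_real_derivative
        (\<Sum>x\<in>Noise d. wt d \<beta> x * (\<Sum>k<n. influence d \<beta> k (n - Suc k) (\<lambda>xs. f (x # xs))) + dwt d x * expect (Noise d) (wt d \<beta>) n (\<lambda>xs. f (x # xs)))) (at \<beta> within A)"
      unfolding expect.simps by (intro DERIV_sum DERIV_mult' has_derivative_wt Suc)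
    also have "(\<Sum>x\<in>Noise d. wt d \<beta> x * (\<Sum>k<n. influence d \<beta> k (n - Suc k) (\<lambda>xs. f (x # xs))) + dwt d x * expect (Noise d) (wt d \<beta>) n (\<lambda>xs. f (x # xs)))
        = influence d \<beta> 0 n f + (\<Sum>k<n. influence d \<beta> (Suc k) (n - Suc k) f)"
    proof -
      have "(\<Sum>x\<in>Noise d. wt d \<beta> x * (\<Sum>k<n. influence d \<beta> k (n - Suc k) (\<lambda>xs. f (x # xs)))) = (\<Sum>k<n. influence d \<beta> (Suc k) (n - Suc k) f)"
        unfolding sum_distrib_left by (subst sum.swap) (simp add: influence_def)
      then show ?thesis by (simp add: sum.distrib influence_def)
    qed
    also have "\<dots> = (\<Sum>k<Suc n. influence d \<beta> k (Suc n - Suc k) f)"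
      by (simp only: sum.lessThan_Suc_shift) simp
    finally show ?case .
  qed simp
  \<comment> \<open>Indexing by the number m of letters after the differentiated one makes the terms
    for different n comparable: they decay in m, and for fixed m only the length of the past
    varies.\<close>
  also have "(\<Sum>k<n. influence d \<beta> k (n - Suc k) f) = (\<Sum>m<n. influence d \<beta> (n - Suc m) m f)"
    by (rule sum.reindex_bij_witness[where i = "\<lambda>m. n - Suc m" and j = "\<lambda>k. n - Suc k"]) auto
  finally show ?thesis .
qed

abbreviation infl :: "nat \<Rightarrow> real \<Rightarrow> nat \<Rightarrow> nat \<Rightarrow> real" where
  "infl d \<beta> k m \<equiv> influence d \<beta> k m (\<lambda>xs. of_bool (newsite xs))"

context erw
begin

lemma infl_eq:
  "infl d \<beta> k m = 1 / (2 * real d) * E k (\<lambda>us. E m (\<lambda>vs. of_bool (newsite (us @ (1, -1, True) # vs)) - of_bool (newsite (us @ (1, -1, False) # vs))))"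
proof -
  let ?F = "\<lambda>us x. E m (\<lambda>vs. of_bool (newsite (us @ x # vs)))"
  have "(\<Sum>x\<in>Noise d. dwt d x * ?F us x) = 1 / (2 * real d) * E m (\<lambda>vs. of_bool (newsite (us @ (1, -1, True) # vs)) - of_bool (newsite (us @ (1, -1, False) # vs)))" for us
  proof -
    have 1: "?F us (i, 1, True) = ?F us (i, 1, False)" for i
      using newsite_irrelevant_flip[of i 1 us True _ False] by simp
    have 2: "?F us (i, -1, True) = ?F us (i, -1, False)" if "i \<noteq> 1" for i
      using newsite_irrelevant_flip[of i "-1" us True _ False] that by simp
    have "(\<Sum>x\<in>Noise d. dwt d x * ?F us x) = (\<Sum>i\<in>{1..d}. if i = 1 then (?F us (1, -1, True) - ?F us (1, -1, False)) / (2 * real d) else 0)"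
      unfolding sum_Noise 1
    proof (intro sum.cong refl)
      fix i
      show "dwt d (i, 1, True) * ?F us (i, 1, False) + dwt d (i, 1, False) * ?F us (i, 1, False) + dwt d (i, -1, True) * ?F us (i, -1, True)
          + dwt d (i, -1, False) * ?F us (i, -1, False) = (if i = 1 then (?F us (1, -1, True) - ?F us (1, -1, False)) / (2 * real d) else 0)"
        using 2[of i] by (cases "i = 1") (simp_all add: dwt_def diff_divide_distrib)
    qed
    also have "\<dots> = (?F us (1, -1, True) - ?F us (1, -1, False)) / (2 * real d)"
      using d_pos by (subst sum.delta) auto
    finally show ?thesis by (simp add: expect_diff)
  qed
  then show ?thesis unfolding influence_def by (simp only: expect_cmult)
qed

text \<open>A word with one prescribed letter is not a word of independent letters. The prescribed
  letter has zero increment, and removing it leaves k + m independent letters, of which k + m - l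
  come after the past.\<close>

lemma E_E_nocut_remove:
  assumes k: "l \<le> k"
  shows "E k (\<lambda>us. E m (\<lambda>vs. of_bool (nocut (inc G) l (us @ (1, -1, b) # vs)))) \<le> nocut_sup d G (k + m - l)"
proof -
  have "E k (\<lambda>us. E m (\<lambda>vs. of_bool (nocut (inc G) l (us @ (1, -1, b) # vs)))) \<le> E k (\<lambda>us. E m (\<lambda>vs. of_bool (nocut (inc G) l (us @ vs))))"
  proof (intro E_mono)
    fix us vs :: "noise list" assume "length us = k"
    moreover have "inc G (1, -1, b) = 0" by (simp add: inc_def zero_fun_def)
    ultimately show "of_bool (nocut (inc G) l (us @ (1, -1, b) # vs)) \<le> (of_bool (nocut (inc G) l (us @ vs)) :: real)"
      using nocut_remove[of "inc G" l us "(1, -1, b)" vs] k by auto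
  qed
  also have "\<dots> = E (l + (k + m - l)) (\<lambda>xs. of_bool (nocut (inc G) l xs))"
    using k expect_append[of "Noise d" "wt d \<beta>" k m "\<lambda>xs. of_bool (nocut (inc G) l xs)"] by simp
  also have "\<dots> \<le> nocut_sup d G (k + m - l)" unfolding E_nocut_indep by (rule nocut_prob_le_nocut_sup[OF d_pos])
  finally show ?thesis .
qed

lemma infl_le: "\<bar>infl d \<beta> k m\<bar> \<le> nocut_sup d G m / (2 * real d)"
proof -
  let ?g = "\<lambda>us vs. of_bool (newsite (us @ (1, -1, True) # vs)) - of_bool (newsite (us @ (1, -1, False) # vs)) :: real"
  have "\<bar>E k (\<lambda>us. E m (?g us))\<bar> \<le> E k (\<lambda>us. E m (\<lambda>vs. \<bar>?g us vs\<bar>))"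
    by (rule order.trans[OF E_abs]) (intro E_mono E_abs)
  also have "\<dots> \<le> E k (\<lambda>us. E m (\<lambda>vs. of_bool (nocut (inc G) k (us @ (1, -1, True) # vs))))"
  proof (intro E_mono)
    fix us vs :: "noise list" assume *: "set us \<subseteq> Noise d" "length us = k" "set vs \<subseteq> Noise d"
    show "\<bar>?g us vs\<bar> \<le> of_bool (nocut (inc G) k (us @ (1, -1, True) # vs))"
    proof (cases "nocut (inc G) k (us @ (1, -1, True) # vs)")
      case False
      then have "newsite (us @ (1, -1, True) # vs) = newsite (us @ (1, -1, False) # vs)"
        using * d_pos by (intro newsite_flip[of _ _ _ d _ G]) (auto simp: Noise_def inc_def)
      then show ?thesis by simp
    qed auto
  qed
  also have "\<dots> \<le> nocut_sup d G m" using E_E_nocut_remove[of k k m G True] by simp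
  finally show ?thesis using d_pos unfolding infl_eq by (simp add: abs_mult divide_right_mono)
qed

text \<open>The additional \<open>l\<close> letters are the past to be forgotten, and a cut time
  before the differentiated letter serves as well as one after it; hence the window k + m rather
  than m. Each mark contributes one error of weight 1 / (2 d).\<close>

lemma infl_close: "\<bar>infl d \<beta> (l + k) m - infl d \<beta> k m\<bar> \<le> nocut_sup d G (k + m) / real d"
proof -
  let ?D = "\<lambda>us vs. of_bool (newsite (us @ (1, -1, True) # vs)) - of_bool (newsite (us @ (1, -1, False) # vs)) :: real"
  let ?N = "\<lambda>b ls us vs. of_bool (nocut (inc G) l ((ls @ us) @ (1, -1, b) # vs)) :: real"
  have "infl d \<beta> (l + k) m - infl d \<beta> k m = 1 / (2 * real d) * E l (\<lambda>ls. E k (\<lambda>us. E m (\<lambda>vs. ?D (ls @ us) vs - ?D us vs)))"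
    unfolding infl_eq expect_append[of _ _ l k] by (simp only: expect_diff E_const right_diff_distrib)
  then have eq: "\<bar>infl d \<beta> (l + k) m - infl d \<beta> k m\<bar> = 1 / (2 * real d) * \<bar>E l (\<lambda>ls. E k (\<lambda>us. E m (\<lambda>vs. ?D (ls @ us) vs - ?D us vs)))\<bar>"
    by (simp only: abs_mult) simp
  have "\<bar>E l (\<lambda>ls. E k (\<lambda>us. E m (\<lambda>vs. ?D (ls @ us) vs - ?D us vs)))\<bar> \<le> E l (\<lambda>ls. E k (\<lambda>us. E m (\<lambda>vs. \<bar>?D (ls @ us) vs - ?D us vs\<bar>)))"
    by (intro order.trans[OF E_abs] E_mono order.refl)
  also have "\<dots> \<le> E l (\<lambda>ls. E k (\<lambda>us. E m (\<lambda>vs. ?N True ls us vs + ?N False ls us vs)))"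
  proof (intro E_mono)
    fix ls us vs :: "noise list"
    assume *: "set ls \<subseteq> Noise d" "length ls = l" "set us \<subseteq> Noise d" "set vs \<subseteq> Noise d"
    have **: "newsite ((ls @ us) @ (1, -1, b) # vs) = newsite (us @ (1, -1, b) # vs)"
      if "\<not> nocut (inc G) l ((ls @ us) @ (1, -1, b) # vs)" for b
      using that * d_pos newsite_append[of ls "us @ (1, -1, b) # vs" d G] by (auto simp: Noise_def)
    show "\<bar>?D (ls @ us) vs - ?D us vs\<bar> \<le> ?N True ls us vs + ?N False ls us vs"
    proof -
      have "\<bar>of_bool (newsite ((ls @ us) @ (1, -1, b) # vs)) - of_bool (newsite (us @ (1, -1, b) # vs))\<bar> \<le> ?N b ls us vs" for b
        using **[of b] by (cases "nocut (inc G) l ((ls @ us) @ (1, -1, b) # vs)") auto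
      from this[of True] this[of False] show ?thesis by linarith
    qed
  qed
  also have "\<dots> = E (l + k) (\<lambda>us. E m (\<lambda>vs. of_bool (nocut (inc G) l (us @ (1, -1, True) # vs))))
      + E (l + k) (\<lambda>us. E m (\<lambda>vs. of_bool (nocut (inc G) l (us @ (1, -1, False) # vs))))"
    unfolding expect_append[of _ _ l k] by (simp only: expect_add)
  also have "\<dots> \<le> nocut_sup d G (k + m) + nocut_sup d G (k + m)"
    using E_E_nocut_remove[of l "l + k" m G] by (intro add_mono) (simp_all add: add.assoc)
  finally show ?thesis unfolding eq using d_pos by (simp add: field_simps)
qed

end

section \<open>The limiting density as a function of the bias\<close>

definition newrate :: "nat \<Rightarrow> real \<Rightarrow> real" where
  "newrate d \<beta> = lim (\<lambda>n. pnew d \<beta> n)"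

text \<open>For five classes \<open>nocut_sup\<close> is controlled on average only, so just some
  index M with a small value is obtained. This suffices, because \<open>pnew_close\<close> compares
  all n \<ge> M with the same M.\<close>

lemma small_nocut_sup:
  assumes "6 \<le> d" "0 < e"
  obtains M where "nocut_sup d 5 M < e"
proof -
  obtain C where C: "0 < C" "\<And>d n. 6 \<le> d \<Longrightarrow> (\<Sum>m<n. nocut_sup d 5 m) \<le> C * (real n + 1) powr (3 / 4)"
    using nocut_sup_5 by blast
  have "(\<lambda>n. (real n + 1) powr (3 / 4) / real n) \<longlonglongrightarrow> 0" by real_asymp
  then have "\<forall>\<^sub>F n in sequentially. (real n + 1) powr (3 / 4) / real n < e / C"
    using assms(2) C(1) by (intro order_tendstoD) auto
  then have "\<forall>\<^sub>F n in sequentially. (real n + 1) powr (3 / 4) / real n < e / C \<and> 0 < n"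
    using eventually_gt_at_top[of 0] by eventually_elim auto
  then obtain n where n: "(real n + 1) powr (3 / 4) / real n < e / C" "0 < n"
    using eventually_happens'[OF sequentially_bot] by blast
  then have "C * (real n + 1) powr (3 / 4) < real n * e" using C(1) by (simp add: field_simps)
  then have lt: "(\<Sum>m<n. nocut_sup d 5 m) < real n * e" using C(2)[OF assms(1), of n] by simp
  have "\<exists>M. nocut_sup d 5 M < e"
  proof (rule ccontr)
    assume "\<nexists>M. nocut_sup d 5 M < e"
    then have "(\<Sum>m<n. e) \<le> (\<Sum>m<n. nocut_sup d 5 m)" by (intro sum_mono) (simp add: not_less)
    then show False using lt by simp
  qed
  then show thesis using that by blast
qed

lemma erwI: "6 \<le> d \<Longrightarrow> \<beta> \<in> {0..1} \<Longrightarrow> erw d \<beta>"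
  by unfold_locales auto

lemma newrate_lim:
  assumes "6 \<le> d" "\<beta> \<in> {0..1}"
  shows "(\<lambda>n. pnew d \<beta> n) \<longlonglongrightarrow> newrate d \<beta>"
proof -
  interpret erw d \<beta> using assms by (rule erwI)
  have "Cauchy (\<lambda>n. pnew d \<beta> n)"
  proof (rule metric_CauchyI)
    fix e :: real assume "0 < e"
    then obtain M where M: "nocut_sup d 5 M < e / 2" using small_nocut_sup[OF assms(1), of "e / 2"] by auto
    have "\<bar>pnew d \<beta> n - pnew d \<beta> M\<bar> < e / 2" if "M \<le> n" for n
      using pnew_close[of "n - M" M 5] M that by simp
    from this have "dist (pnew d \<beta> m) (pnew d \<beta> n) < e" if "M \<le> m" "M \<le> n" for m n
      using that by (smt (verit) dist_real_def field_sum_of_halves)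
    then show "\<exists>M. \<forall>m\<ge>M. \<forall>n\<ge>M. dist (pnew d \<beta> m) (pnew d \<beta> n) < e" by blast
  qed
  then show ?thesis unfolding newrate_def by (simp add: Cauchy_convergent_iff convergent_LIMSEQ_iff)
qed

lemma pnew_newrate:
  assumes "6 \<le> d" "\<beta> \<in> {0..1}"
  shows "\<bar>newrate d \<beta> - pnew d \<beta> M\<bar> \<le> nocut_sup d 5 M"
proof -
  interpret erw d \<beta> using assms by (rule erwI)
  have "(\<lambda>n. \<bar>pnew d \<beta> (n + M) - pnew d \<beta> M\<bar>) \<longlonglongrightarrow> \<bar>newrate d \<beta> - pnew d \<beta> M\<bar>"
    by (intro tendsto_intros LIMSEQ_ignore_initial_segment newrate_lim assms)
  then show ?thesis by (rule LIMSEQ_le_const2) (use pnew_close in auto)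
qed

lemma pnew_uniform_limit:
  assumes "6 \<le> d"
  shows "uniform_limit {0..1} (\<lambda>n \<beta>. pnew d \<beta> n) (newrate d) sequentially"
  unfolding uniform_limit_sequentially_iff
proof (intro allI impI)
  fix e :: real assume "0 < e"
  then obtain M where M: "nocut_sup d 5 M < e / 2" using small_nocut_sup[OF assms(1), of "e / 2"] by auto
  have "dist (pnew d \<beta> n) (newrate d \<beta>) < e" if "M \<le> n" "\<beta> \<in> {0..1}" for n \<beta>
  proof -
    interpret erw d \<beta> using assms that(2) by (rule erwI)
    have "\<bar>pnew d \<beta> n - pnew d \<beta> M\<bar> < e / 2" using pnew_close[of "n - M" M 5] M that by simp
    moreover have "\<bar>newrate d \<beta> - pnew d \<beta> M\<bar> < e / 2" using pnew_newrate[OF assms that(2), of M] M by simp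
    ultimately show ?thesis by (smt (verit) dist_real_def field_sum_of_halves)
  qed
  then show "\<exists>N. \<forall>n\<ge>N. \<forall>\<beta>\<in>{0..1}. dist (pnew d \<beta> n) (newrate d \<beta>) < e" by blast
qed

abbreviation dpnew :: "nat \<Rightarrow> nat \<Rightarrow> real \<Rightarrow> real" where
  "dpnew d n \<beta> \<equiv> (\<Sum>m<n. infl d \<beta> (n - Suc m) m)"

lemma pnew_has_derivative: "((\<lambda>\<beta>. pnew d \<beta> n) has_real_derivative dpnew d n \<beta>) (at \<beta> within A)"
  unfolding pnew_def by (rule expect_has_derivative)

lemma continuous_newrate:
  assumes "6 \<le> d"
  shows "continuous_on {0..1} (newrate d)"
proof (rule uniform_limit_theorem[OF _ pnew_uniform_limit[OF assms]])
  have "continuous_on {0..1} (\<lambda>\<beta>. pnew d \<beta> n)" for n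
    using pnew_has_derivative by (intro DERIV_continuous_on)
  then show "\<forall>\<^sub>F n in sequentially. continuous_on {0..1} (\<lambda>\<beta>. pnew d \<beta> n)" by simp
qed simp

text \<open>The escape bound for n + 1 letters concerns the sites of times 1 to n. Deleting the
  first letter turns them into the sites of times 0 to n - 1, and the endpoint is then new already
  in projection.\<close>

lemma newrate_ge:
  obtains \<delta> where "0 < \<delta>" "\<And>d \<beta>. 6 \<le> d \<Longrightarrow> \<beta> \<in> {0..1} \<Longrightarrow> \<delta> \<le> newrate d \<beta>"
proof -
  obtain \<delta> t0 where \<delta>: "0 < \<delta>" "\<And>d \<beta> n. 6 \<le> d \<Longrightarrow> 0 \<le> \<beta> \<Longrightarrow> \<beta> \<le> 1 \<Longrightarrow> t0 \<le> n \<Longrightarrow>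
    expect (Noise d) (wt d \<beta>) n (\<lambda>xs. of_bool (\<exists>j\<in>{1..<n}. psum (inc 5) xs = psum (inc 5) (take j xs))) \<le> 1 - \<delta>"
    using E_no_return by blast
  have "\<delta> \<le> newrate d \<beta>" if d: "6 \<le> d" and \<beta>: "\<beta> \<in> {0..1}" for d \<beta>
  proof (rule LIMSEQ_le_const[OF newrate_lim[OF that]], intro exI[of _ t0] allI impI)
    interpret erw d \<beta> using that by (rule erwI)
    fix n assume n: "t0 \<le> n"
    let ?R = "\<lambda>xs. \<exists>j\<in>{1..<Suc n}. psum (inc 5) xs = psum (inc 5) (take j xs)"
    have "\<delta> \<le> 1 - E (Suc n) (\<lambda>xs. of_bool (?R xs))" using \<delta>(2)[of d \<beta> "Suc n"] d \<beta> n by simp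
    also have "\<dots> = E (1 + n) (\<lambda>xs. 1 - of_bool (?R xs))" by (simp only: expect_diff E_const) simp
    also have "\<dots> = E 1 (\<lambda>us. E n (\<lambda>ys. 1 - of_bool (?R (us @ ys))))" by (rule expect_append)
    also have "\<dots> \<le> E 1 (\<lambda>us. E n (\<lambda>ys. of_bool (newsite ys)))"
    proof (intro E_mono)
      fix us ys :: "noise list"
      assume us: "length us = 1" and ys: "length ys = n" "set ys \<subseteq> Noise d"
      show "1 - of_bool (?R (us @ ys)) \<le> (of_bool (newsite ys) :: real)"
      proof (cases "?R (us @ ys)")
        case False
        have "newsite ys"
        proof (rule newsite_if_projection_new[OF ys(2), of 5])
          fix j assume j: "j < length ys"
          then have "psum (inc 5) (us @ ys) \<noteq> psum (inc 5) (take (Suc j) (us @ ys))"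
            using False ys by auto
          then show "psum (inc 5) ys \<noteq> psum (inc 5) (take j ys)" using us by simp
        qed
        then show ?thesis by simp
      qed simp
    qed
    also have "\<dots> = pnew d \<beta> n" by (simp only: E_const pnew_def)
    finally show "\<delta> \<le> pnew d \<beta> n" .
  qed
  then show thesis using that \<delta>(1) by blast
qed

lemma newrate_Lipschitz:
  obtains C where "0 < C" "\<And>d \<beta> \<beta>'. 8 \<le> d \<Longrightarrow> \<beta> \<in> {0..1} \<Longrightarrow> \<beta>' \<in> {0..1} \<Longrightarrow>
    \<bar>newrate d \<beta> - newrate d \<beta>'\<bar> \<le> C / real d * \<bar>\<beta> - \<beta>'\<bar>"
proof -
  obtain C where C: "0 < C" "\<And>d n. 8 \<le> d \<Longrightarrow> (\<Sum>m<n. nocut_sup d 7 m) \<le> C" using nocut_sup_7 by blast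
  have "\<bar>newrate d \<beta> - newrate d \<beta>'\<bar> \<le> C / real d * \<bar>\<beta> - \<beta>'\<bar>"
    if d: "8 \<le> d" and \<beta>: "\<beta> \<in> {0..1}" "\<beta>' \<in> {0..1}" for d \<beta> \<beta>'
  proof (rule LIMSEQ_le_const2)
    show "(\<lambda>n. \<bar>pnew d \<beta> n - pnew d \<beta>' n\<bar>) \<longlonglongrightarrow> \<bar>newrate d \<beta> - newrate d \<beta>'\<bar>"
      using d \<beta> by (intro tendsto_intros newrate_lim) auto
    have "norm (pnew d \<beta> n - pnew d \<beta>' n) \<le> C / real d * norm (\<beta> - \<beta>')" for n
    proof (rule field_differentiable_bound[of "{0..1}", OF _ pnew_has_derivative])
      fix z :: real assume z: "z \<in> {0..1}"
      interpret erw d z using d z by (intro erwI) auto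
      have "norm (dpnew d n z) \<le> (\<Sum>m<n. nocut_sup d 7 m / (2 * real d))"
        by (intro order.trans[OF norm_sum] sum_mono) (use infl_le in auto)
      also have "\<dots> = (\<Sum>m<n. nocut_sup d 7 m) / (2 * real d)" by (simp add: sum_divide_distrib)
      also have "\<dots> \<le> C / real d" using C(2)[OF d, of n] C(1) d by (simp add: field_simps)
      finally show "norm (dpnew d n z) \<le> C / real d" .
    qed (use \<beta> in auto)
    then show "\<exists>N. \<forall>n\<ge>N. \<bar>pnew d \<beta> n - pnew d \<beta>' n\<bar> \<le> C / real d * \<bar>\<beta> - \<beta>'\<bar>" by auto
  qed
  then show thesis using that C(1) by blast
qed

text \<open>The terms with m \<ge> m0 have a small sum by \<open>infl_le\<close>. Each of the
  finitely many others depends on n only through the length of the past, and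
  \<open>infl_close\<close> bounds its change by \<open>nocut_sup d 7 (n - 1)\<close>, which tends
  to 0.\<close>

lemma dpnew_uniformly_convergent:
  assumes d: "8 \<le> d"
  shows "uniformly_convergent_on {0..1} (dpnew d)"
proof (intro Cauchy_uniformly_convergent uniformly_Cauchy_onI')
  fix e :: real assume e: "0 < e"
  have d0: "0 < d" using d by simp
  obtain C where C: "0 < C" "\<And>d n. 8 \<le> d \<Longrightarrow> (\<Sum>m<n. nocut_sup d 7 m) \<le> C" using nocut_sup_7 by blast
  have sm: "summable (nocut_sup d 7)"
    using C(2)[OF d] nocut_sup_nonneg[OF d0] by (intro summableI_nonneg_bounded) auto
  have qn: "\<bar>nocut_sup d 7 m\<bar> = nocut_sup d 7 m" for m using nocut_sup_nonneg[OF d0] by simp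
  obtain m0 where m0: "\<And>m n. m \<ge> m0 \<Longrightarrow> norm (\<Sum>t\<in>{m..n}. nocut_sup d 7 t) < e / 4"
    by (rule summable_partial_sum_bound[OF sm, of "e / 4"]) (use e in auto)
  have tail: "(\<Sum>t\<in>{m0..<n}. nocut_sup d 7 t) \<le> e / 4" for n
  proof -
    have "(\<Sum>t\<in>{m0..<n}. nocut_sup d 7 t) \<le> (\<Sum>t\<in>{m0..n}. nocut_sup d 7 t)"
      using nocut_sup_nonneg[OF d0] by (intro sum_mono2) auto
    then show ?thesis using m0[of m0 n] by (simp add: abs_less_iff)
  qed
  have "(\<lambda>n. real m0 * nocut_sup d 7 n) \<longlonglongrightarrow> 0" using summable_LIMSEQ_zero[OF sm] by (rule tendsto_mult_right_zero)
  then have "\<forall>\<^sub>F n in sequentially. real m0 * nocut_sup d 7 n < e / 4" using e by (intro order_tendstoD) auto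
  then obtain n1 where n1: "\<And>n. n1 \<le> n \<Longrightarrow> real m0 * nocut_sup d 7 n < e / 4" unfolding eventually_sequentially by blast
  have "dist (dpnew d n \<beta>) (dpnew d n' \<beta>) < e" if \<beta>: "\<beta> \<in> {0..1}" and n: "Suc n1 + m0 \<le> n" "n < n'" for \<beta> n n'
  proof -
    interpret erw d \<beta> using d \<beta> by (intro erwI) auto
    have split: "dpnew d N \<beta> = (\<Sum>m<m0. infl d \<beta> (N - Suc m) m) + (\<Sum>m\<in>{m0..<N}. infl d \<beta> (N - Suc m) m)" if "m0 \<le> N" for N
    proof -
      have "{..<N} = {..<m0} \<union> {m0..<N}" using that by auto
      then show ?thesis by (simp add: sum.union_disjoint ivl_disj_int)
    qed
    have tl: "\<bar>\<Sum>m\<in>{m0..<N}. infl d \<beta> (N - Suc m) m\<bar> \<le> e / 4" for N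
    proof -
      have "\<bar>\<Sum>m\<in>{m0..<N}. infl d \<beta> (N - Suc m) m\<bar> \<le> (\<Sum>m\<in>{m0..<N}. nocut_sup d 7 m)"
      proof (intro order.trans[OF sum_abs] sum_mono)
        fix m
        have "nocut_sup d 7 m / (2 * real d) \<le> nocut_sup d 7 m / 1"
          using d nocut_sup_nonneg[OF d0] by (intro divide_left_mono) auto
        then show "\<bar>infl d \<beta> (N - Suc m) m\<bar> \<le> nocut_sup d 7 m" using infl_le[of "N - Suc m" m 7] by simp
      qed
      then show ?thesis using tail[of N] by linarith
    qed
    have "\<bar>(\<Sum>m<m0. infl d \<beta> (n' - Suc m) m) - (\<Sum>m<m0. infl d \<beta> (n - Suc m) m)\<bar> \<le> (\<Sum>m<m0. nocut_sup d 7 (n - 1))"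
      unfolding sum_subtractf[symmetric]
    proof (intro order.trans[OF sum_abs] sum_mono)
      fix m assume m: "m \<in> {..<m0}"
      have eq: "n' - n + (n - Suc m) = n' - Suc m" "n - Suc m + m = n - 1" using n m by auto
      have "\<bar>infl d \<beta> (n' - Suc m) m - infl d \<beta> (n - Suc m) m\<bar> \<le> nocut_sup d 7 (n - 1) / real d"
        using infl_close[of "n' - n" "n - Suc m" m 7] unfolding eq .
      also have "\<dots> \<le> nocut_sup d 7 (n - 1) / 1" using d nocut_sup_nonneg[OF d0] by (intro divide_left_mono) auto
      finally show "\<bar>infl d \<beta> (n' - Suc m) m - infl d \<beta> (n - Suc m) m\<bar> \<le> nocut_sup d 7 (n - 1)" by simp
    qed
    also have "\<dots> < e / 4" using n1[of "n - 1"] n by simp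
    finally have "\<bar>(\<Sum>m<m0. infl d \<beta> (n' - Suc m) m) - (\<Sum>m<m0. infl d \<beta> (n - Suc m) m)\<bar> < e / 4" .
    moreover have "m0 \<le> n" "m0 \<le> n'" using n by auto
    ultimately show ?thesis
      using tl[of n] tl[of n'] e unfolding dist_real_def split[OF \<open>m0 \<le> n\<close>] split[OF \<open>m0 \<le> n'\<close>]
      by linarith
  qed
  then show "\<exists>M. \<forall>x\<in>{0..1}. \<forall>m\<ge>M. \<forall>n>m. dist (dpnew d m x) (dpnew d n x) < e" by blast
qed

lemma newrate_differentiable:
  assumes d: "8 \<le> d"
  shows "newrate d differentiable_on {0..1}"
proof -
  obtain g' where g': "uniform_limit {0..1} (dpnew d) g' sequentially"
    using dpnew_uniformly_convergent[OF d] unfolding uniformly_convergent_on_def by blast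
  have "\<exists>g. \<forall>x\<in>{0..1}. (\<lambda>n. pnew d x n) \<longlonglongrightarrow> g x \<and> (g has_derivative (*) (g' x)) (at x within {0..1})"
  proof (rule has_derivative_sequence[where f = "\<lambda>n \<beta>. pnew d \<beta> n" and f' = "\<lambda>n x. (*) (dpnew d n x)" and ?x0.0 = 0])
    show "((\<lambda>\<beta>. pnew d \<beta> n) has_derivative (*) (dpnew d n x)) (at x within {0..1})" for n x
      using pnew_has_derivative by (rule has_field_derivative_imp_has_derivative)
    show "(\<lambda>n. pnew d 0 n) \<longlonglongrightarrow> newrate d 0" using d by (intro newrate_lim) auto
    fix e :: real assume "0 < e"
    then have "\<forall>\<^sub>F n in sequentially. \<forall>x\<in>{0..1}. dist (dpnew d n x) (g' x) < e"
      using g' unfolding uniform_limit_iff by blast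
    then show "\<forall>\<^sub>F n in sequentially. \<forall>x\<in>{0..1}. \<forall>h. norm (dpnew d n x * h - g' x * h) \<le> e * norm h"
    proof eventually_elim
      case (elim n)
      show ?case
      proof (intro ballI allI)
        fix x h :: real assume "x \<in> {0..1}"
        then have "\<bar>dpnew d n x - g' x\<bar> * \<bar>h\<bar> \<le> e * \<bar>h\<bar>"
          using elim by (intro mult_right_mono) (auto simp: dist_real_def less_imp_le)
        then show "norm (dpnew d n x * h - g' x * h) \<le> e * norm h"
          by (simp add: left_diff_distrib[symmetric] abs_mult)
      qed
    qed
  qed auto
  then obtain g where g: "\<And>x. x \<in> {0..1} \<Longrightarrow> (\<lambda>n. pnew d x n) \<longlonglongrightarrow> g x"
    "\<And>x. x \<in> {0..1} \<Longrightarrow> (g has_derivative (*) (g' x)) (at x within {0..1})" by blast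
  have "g x = newrate d x" if "x \<in> {0..1}" for x
    using LIMSEQ_unique[OF g(1)[OF that] newrate_lim] d that by simp
  then show ?thesis
    unfolding differentiable_on_def differentiable_def
    using has_derivative_transform[OF _ _ g(2)] by (metis (no_types, lifting))
qed

section \<open>Laws of large numbers\<close>

definition history :: "nat \<Rightarrow> (nat \<Rightarrow> site) \<Rightarrow> site list" where
  "history n \<omega> = map \<omega> (rev [0..<Suc n])"

lemma history_simps: "history 0 \<omega> = [\<omega> 0]" "history (Suc n) \<omega> = \<omega> (Suc n) # history n \<omega>"
  by (simp_all add: history_def)

lemma hd_history [simp]: "hd (history n \<omega>) = \<omega> n"
  by (simp add: history_def)

lemma fresh_history: "fresh (history n \<omega>) \<longleftrightarrow> \<omega> n \<notin> \<omega> ` {..<n}"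
  by (auto simp: fresh_def history_def)

lemma drop_history: "k \<le> n \<Longrightarrow> drop (n - k) (history n \<omega>) = history k \<omega>"
proof (induction n)
  case (Suc n)
  show ?case
  proof (cases "k = Suc n")
    case False
    then have "Suc n - k = Suc (n - k)" "k \<le> n" using Suc.prems by auto
    then show ?thesis using Suc.IH by (simp add: history_simps)
  qed simp
qed simp

lemma drop_run: "k \<le> length xs \<Longrightarrow> drop (length xs - k) (run [0] xs) = run [0] (take k xs)"
proof (induction xs rule: rev_induct)
  case (snoc x xs)
  show ?case
  proof (cases "k = Suc (length xs)")
    case False
    then have "length (xs @ [x]) - k = Suc (length xs - k)" "k \<le> length xs" using snoc.prems by auto
    then show ?thesis using snoc.IH by simp
  qed simp
qed simp

lemma history_eq_iff: "history n \<omega> = history n y \<longleftrightarrow> (\<forall>k\<le>n. \<omega> k = y k)"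
  by (auto simp: history_def less_Suc_eq_le)

lemma history_surj: "length l = Suc n \<Longrightarrow> history n (\<lambda>k. l ! (n - k)) = l"
  by (intro nth_equalityI) (auto simp: history_def rev_nth simp del: upt_Suc)

section \<open>The law of the walk as an image of random words\<close>

lemma walk_prob_erw: "erw d \<beta> \<Longrightarrow> walk_prob d (erw_prob d \<beta>)"
proof
  assume "erw d \<beta>"
  then interpret erw d \<beta> .
  have "(\<Sum>s\<in>{1, -1}. erw_prob d \<beta> n y i s) = 1 / real d" for n y i
    using d_pos by (simp add: erw_prob_def field_simps)
  then show "(\<Sum>i\<in>{1..d}. \<Sum>s\<in>{1, -1}. erw_prob d \<beta> n y i s) = 1" for n y
    using d_pos by simp
  show "0 \<le> erw_prob d \<beta> n y i s" if "s \<in> {1, -1}" for n y i s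
    using that \<beta> by (auto simp: erw_prob_def)
  show "erw_prob d \<beta> n y i s = erw_prob d \<beta> n y' i s"
    if "\<And>k. k \<le> n \<Longrightarrow> y k = y' k" for n y y' i s
  proof -
    have "y ` {..<n} = y' ` {..<n}" using that by (intro image_cong) auto
    then show ?thesis using that by (simp add: erw_prob_def)
  qed
qed

lemma single_eq_iff:
  "Poly_Mapping.single i (s :: int) = Poly_Mapping.single j t \<longleftrightarrow> i = j \<and> s = t" if "s \<noteq> 0"
proof
  assume eq: "Poly_Mapping.single i s = Poly_Mapping.single j t"
  have "Poly_Mapping.lookup (Poly_Mapping.single i s) i = Poly_Mapping.lookup (Poly_Mapping.single j t) i"
    by (simp only: eq)
  then show "i = j \<and> s = t" using that by (auto simp: lookup_single when_def split: if_splits)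
qed auto

context erw
begin

abbreviation P :: "(nat \<Rightarrow> site) measure" where "P \<equiv> erw_law d \<beta>"

lemma law: "is_walk_law d (erw_prob d \<beta>) P"
  using d_pos \<beta> by (rule is_walk_law_erw_law)

lemma prob_P: "prob_space P" and sets_P: "sets P = sets path_space"
  using law by (auto simp: is_walk_law_def)

lemma sets_history: "{\<omega> \<in> space P. Q (history n \<omega>)} \<in> sets P"
proof (rule sets_event[OF sets_P, of "{..n}"])
  fix \<omega> \<omega>' :: "nat \<Rightarrow> site" assume "\<forall>k\<in>{..n}. \<omega> k = \<omega>' k"
  then have "history n \<omega> = history n \<omega>'" by (simp add: history_eq_iff)
  then show "Q (history n \<omega>) \<longleftrightarrow> Q (history n \<omega>')" by simp
qed simp

lemma measurable_history: "(\<lambda>\<omega>. f (history n \<omega>)) \<in> borel_measurable P" for f :: "site list \<Rightarrow> real"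
proof (rule measurableI)
  fix A :: "real set"
  show "(\<lambda>\<omega>. f (history n \<omega>)) -` A \<inter> space P \<in> sets P"
    using sets_history[of "\<lambda>l. f l \<in> A" n] by (simp add: vimage_def Int_def conj_commute)
qed simp

text \<open>At a new site the letters (1, 1, True), (1, 1, False) and (1, -1, True) all produce the
  step e_1, with total weight (1 + \<beta>) / (2 d); this is how the driving noise realises the
  transition probabilities.\<close>

lemma kernel_next_site:
  "(\<Sum>x\<in>Noise d. wt d \<beta> x * of_bool (next_site (history n y) x = y (Suc n)))
    = pmf (walk_prob.kernel d (erw_prob d \<beta>) (Suc n) y) (y (Suc n))"
proof -
  interpret W: walk_prob d "erw_prob d \<beta>" by (rule walk_prob_erw) unfold_locales
  show ?thesis
  proof (cases "\<exists>x\<in>W.steps. y (Suc n) = y n + W.step x")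
    case True
    then obtain i0 s0 where x: "(i0, s0) \<in> W.steps" "y (Suc n) = y n + Poly_Mapping.single i0 s0"
      by (auto simp: W.step_def)
    then have i0: "i0 \<in> {1..d}" and s0: "s0 = 1 \<or> s0 = -1" by (auto simp: W.steps_def)
    have "pmf (W.kernel (Suc n) y) (y (Suc n)) = erw_prob d \<beta> n y i0 s0"
      using W.pmf_kernel[OF x(1), of n y] x(2) by (simp add: W.step_def)
    moreover have "(\<Sum>x\<in>Noise d. wt d \<beta> x * of_bool (next_site (history n y) x = y (Suc n)))
        = (\<Sum>i\<in>{1..d}. if i = i0 then erw_prob d \<beta> n y i0 s0 else 0)"
      unfolding sum_Noise
    proof (intro sum.cong refl)
      fix i
      have "next_site (history n y) (i, s, b) = y (Suc n) \<longleftrightarrow> i = i0 \<and> (if b \<and> i = 1 \<and> fresh (history n y) then 1 else s) = s0"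
        if "s = 1 \<or> s = -1" for s b
        unfolding next_site_def x(2) using that by (auto simp: single_eq_iff)
      note next_site = this
      show "wt d \<beta> (i, 1, True) * of_bool (next_site (history n y) (i, 1, True) = y (Suc n)) +
          wt d \<beta> (i, 1, False) * of_bool (next_site (history n y) (i, 1, False) = y (Suc n)) +
          wt d \<beta> (i, -1, True) * of_bool (next_site (history n y) (i, -1, True) = y (Suc n)) +
          wt d \<beta> (i, -1, False) * of_bool (next_site (history n y) (i, -1, False) = y (Suc n)) =
          (if i = i0 then erw_prob d \<beta> n y i0 s0 else 0)"
        using s0 d_pos by (auto simp: next_site wt_def erw_prob_def fresh_history field_simps)
    qed
    ultimately show ?thesis using i0 by simp
  next
    case False
    then have "pmf (W.kernel (Suc n) y) (y (Suc n)) = 0"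
      using W.set_pmf_step[of n y] by (force simp: pmf_eq_0_set_pmf W.kernel_def)
    moreover have "next_site (history n y) x \<noteq> y (Suc n)" if x: "x \<in> Noise d" for x
    proof
      assume eq: "next_site (history n y) x = y (Suc n)"
      obtain i s b where xx: "x = (i, s, b)" by (cases x)
      let ?s = "if b \<and> i = 1 \<and> fresh (history n y) then 1 else s"
      have "(i, ?s) \<in> W.steps" using x by (auto simp: xx W.steps_def Noise_def)
      moreover have "y (Suc n) = y n + W.step (i, ?s)"
        unfolding eq[symmetric] by (simp add: xx next_site_def W.step_def)
      ultimately show False using False by blast
    qed
    ultimately show ?thesis by simp
  qed
qed

lemma prob_history_y: "measure P {\<omega> \<in> space P. history n \<omega> = history n y} = E n (\<lambda>xs. of_bool (run [0] xs = history n y))"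
proof -
  interpret W: walk_prob d "erw_prob d \<beta>" by (rule walk_prob_erw) unfold_locales
  interpret L: prob_space W.IT.PF.lim by (rule W.prob_lim)
  have "measure W.IT.PF.lim (W.cyl (Suc n) y) = E n (\<lambda>xs. of_bool (run [0] xs = history n y))"
  proof (induction n)
    case 0
    show ?case
      by (simp only: W.measure_lim_cyl_Suc W.cyl_0 L.prob_space) (auto simp: W.kernel_def history_simps)
  next
    case (Suc n)
    let ?K = "\<Sum>x\<in>Noise d. wt d \<beta> x * of_bool (next_site (history n y) x = y (Suc n))"
    have "E (Suc n) (\<lambda>xs. of_bool (run [0] xs = history (Suc n) y)) = E (n + 1) (\<lambda>xs. of_bool (run [0] xs = history (Suc n) y))"
      by simp
    also have "\<dots> = E n (\<lambda>xs. E 1 (\<lambda>zs. of_bool (run [0] (xs @ zs) = history (Suc n) y)))" by (rule expect_append)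
    also have "\<dots> = E n (\<lambda>xs. ?K * of_bool (run [0] xs = history n y))"
    proof (intro expect_cong)
      fix xs :: "noise list"
      show "E 1 (\<lambda>zs. of_bool (run [0] (xs @ zs) = history (Suc n) y)) = ?K * of_bool (run [0] xs = history n y)"
        by (cases "run [0] xs = history n y") (auto simp: history_simps One_nat_def)
    qed
    also have "\<dots> = ?K * measure W.IT.PF.lim (W.cyl (Suc n) y)" by (simp only: expect_cmult Suc)
    also have "\<dots> = measure W.IT.PF.lim (W.cyl (Suc (Suc n)) y)"
      unfolding W.measure_lim_cyl_Suc[of "Suc n"] kernel_next_site by (simp only: mult.commute)
    finally show ?case by simp
  qed
  then show ?thesis using W.walk_law_cylinder[OF law, of n y] by (simp add: history_eq_iff)
qed

lemma prob_history:
  assumes "length l = Suc n"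
  shows "measure P {\<omega> \<in> space P. history n \<omega> = l} = E n (\<lambda>xs. of_bool (run [0] xs = l))"
  using prob_history_y[of n "\<lambda>k. l ! (n - k)"] unfolding history_surj[OF assms] .

text \<open>A finite set carrying the law of the history, which turns integrals of functions of the
  history into finite sums.\<close>

definition histories :: "nat \<Rightarrow> site list set" where
  "histories n = run [0] ` {xs. set xs \<subseteq> Noise d \<and> length xs = n}"

lemma finite_histories: "finite (histories n)"
  unfolding histories_def using finite_S by (intro finite_imageI finite_lists_length_eq)

lemma length_histories: "l \<in> histories n \<Longrightarrow> length l = Suc n"
  by (auto simp: histories_def)

lemma E_histories: "E n (\<lambda>xs. \<Sum>l\<in>histories n. f l * of_bool (run [0] xs = l)) = E n (\<lambda>xs. f (run [0] xs))"
proof (intro expect_cong)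
  fix xs :: "noise list" assume "set xs \<subseteq> Noise d" "length xs = n"
  then have "run [0] xs \<in> histories n" by (auto simp: histories_def)
  moreover have "(\<Sum>l\<in>histories n. f l * of_bool (run [0] xs = l)) = (\<Sum>l\<in>histories n. if l = run [0] xs then f l else 0)"
    by (intro sum.cong) auto
  ultimately show "(\<Sum>l\<in>histories n. f l * of_bool (run [0] xs = l)) = f (run [0] xs)"
    using finite_histories by simp
qed

lemma AE_histories: "AE \<omega> in P. history n \<omega> \<in> histories n"
proof -
  interpret prob_space P by (rule prob_P)
  have eq: "{\<omega> \<in> space P. history n \<omega> \<in> histories n} = (\<Union>l\<in>histories n. {\<omega> \<in> space P. history n \<omega> = l})" by auto
  have "prob {\<omega> \<in> space P. history n \<omega> \<in> histories n} = (\<Sum>l\<in>histories n. prob {\<omega> \<in> space P. history n \<omega> = l})"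
    unfolding eq using sets_history by (intro finite_measure_finite_Union finite_histories) (auto simp: disjoint_family_on_def)
  also have "\<dots> = (\<Sum>l\<in>histories n. E n (\<lambda>xs. of_bool (run [0] xs = l)))"
    by (intro sum.cong refl prob_history length_histories)
  also have "\<dots> = E n (\<lambda>xs. \<Sum>l\<in>histories n. 1 * of_bool (run [0] xs = l))" by (simp only: expect_sum mult_1)
  also have "\<dots> = 1" unfolding E_histories by (rule E_const)
  finally have "AE \<omega> in P. \<omega> \<in> {\<omega> \<in> space P. history n \<omega> \<in> histories n}" by (rule AE_prob_1)
  then show ?thesis by eventually_elim simp
qed

lemma integral_history:
  "integrable P (\<lambda>\<omega>. f (history n \<omega>))" "(\<integral>\<omega>. f (history n \<omega>) \<partial>P) = E n (\<lambda>xs. f (run [0] xs))"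
  for f :: "site list \<Rightarrow> real"
proof -
  interpret prob_space P by (rule prob_P)
  let ?A = "\<lambda>l. {\<omega> \<in> space P. history n \<omega> = l}"
  let ?g = "\<lambda>\<omega>. \<Sum>l\<in>histories n. f l * indicator (?A l) \<omega>"
  have AE: "AE \<omega> in P. f (history n \<omega>) = ?g \<omega>"
    using AE_histories[of n] AE_space
  proof eventually_elim
    case (elim \<omega>)
    have "?g \<omega> = (\<Sum>l\<in>histories n. if l = history n \<omega> then f l else 0)"
      using elim(2) by (intro sum.cong) (auto simp: indicator_def)
    then show ?case using elim(1) finite_histories by simp
  qed
  have ig: "integrable P ?g" using sets_history by (intro Bochner_Integration.integrable_sum integrable_mult_right) (auto intro!: integrable_real_indicator simp: less_top[symmetric])
  have meas: "?g \<in> borel_measurable P" using ig by (rule borel_measurable_integrable)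
  show "integrable P (\<lambda>\<omega>. f (history n \<omega>))"
    using ig by (subst integrable_cong_AE[OF measurable_history meas AE])
  have "(\<integral>\<omega>. f (history n \<omega>) \<partial>P) = (\<integral>\<omega>. ?g \<omega> \<partial>P)"
    by (rule integral_cong_AE[OF measurable_history meas AE])
  also have "\<dots> = (\<Sum>l\<in>histories n. f l * prob (?A l))"
    using sets_history by (subst Bochner_Integration.integral_sum) (auto intro!: integrable_mult_right integrable_real_indicator simp: less_top[symmetric])
  also have "\<dots> = (\<Sum>l\<in>histories n. f l * E n (\<lambda>xs. of_bool (run [0] xs = l)))"
    by (intro sum.cong refl arg_cong2[of _ _ _ _ "(*)"] prob_history length_histories)
  also have "\<dots> = E n (\<lambda>xs. \<Sum>l\<in>histories n. f l * of_bool (run [0] xs = l))" by (simp only: expect_sum expect_cmult)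
  also have "\<dots> = E n (\<lambda>xs. f (run [0] xs))" by (rule E_histories)
  finally show "(\<integral>\<omega>. f (history n \<omega>) \<partial>P) = E n (\<lambda>xs. f (run [0] xs))" .
qed

end

text \<open>Along \<open>k\<^sup>8\<close> the variances become summable, and consecutive terms of this subsequence have ratio tending to \<open>1\<close>.\<close>

lemma subsequence_interpolation:
  fixes s :: "nat \<Rightarrow> real"
  assumes step: "\<And>n. \<bar>s (Suc n) - s n\<bar> \<le> 1" and sub: "(\<lambda>k. s (k ^ 8) / real (k ^ 8)) \<longlonglongrightarrow> \<mu>"
  shows "(\<lambda>n. s n / real n) \<longlonglongrightarrow> \<mu>"
proof -
  define \<kappa> where "\<kappa> n = nat \<lfloor>root 8 (real n)\<rfloor>" for n
  have \<kappa>: "real (\<kappa> n) \<le> root 8 (real n)" "root 8 (real n) < real (\<kappa> n) + 1" for n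
    by (simp_all add: \<kappa>_def)
  have lo: "\<kappa> n ^ 8 \<le> n" for n
  proof -
    have "real (\<kappa> n) ^ 8 \<le> root 8 (real n) ^ 8" using \<kappa> by (intro power_mono) auto
    then have "real (\<kappa> n ^ 8) \<le> real n" by (simp add: real_root_pow_pos2)
    then show ?thesis by (simp only: of_nat_le_iff)
  qed
  have hi: "real n \<le> (real (\<kappa> n) + 1) ^ 8" for n
  proof -
    have "root 8 (real n) ^ 8 \<le> (real (\<kappa> n) + 1) ^ 8" using \<kappa>(2)[of n] by (intro power_mono) auto
    then show ?thesis by (simp add: real_root_pow_pos2)
  qed
  have inf: "filterlim \<kappa> at_top sequentially"
    unfolding filterlim_at_top
  proof
    fix K :: nat
    have "K \<le> \<kappa> n" if n: "K ^ 8 \<le> n" for n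
    proof -
      have "real K = root 8 (real K ^ 8)" by (simp add: real_root_power_cancel)
      also have "\<dots> \<le> root 8 (real n)"
        using n by (intro real_root_le_mono) (simp_all flip: of_nat_power)
      also have "\<dots> < real (\<kappa> n) + 1" by (rule \<kappa>)
      finally show ?thesis by simp
    qed
    then show "\<forall>\<^sub>F n in sequentially. K \<le> \<kappa> n" by (auto intro: eventually_sequentiallyI[of "K ^ 8"])
  qed
  have ratio: "(\<lambda>n. real (\<kappa> n ^ 8) / real n) \<longlonglongrightarrow> 1"
  proof (rule tendsto_sandwich)
    have "(\<lambda>k. (real k / (real k + 1)) ^ 8) \<longlonglongrightarrow> 1" by real_asymp
    from filterlim_compose[OF this inf] show "(\<lambda>n. (real (\<kappa> n) / (real (\<kappa> n) + 1)) ^ 8) \<longlonglongrightarrow> 1" .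
    show "\<forall>\<^sub>F n in sequentially. (real (\<kappa> n) / (real (\<kappa> n) + 1)) ^ 8 \<le> real (\<kappa> n ^ 8) / real n"
      using eventually_gt_at_top[of 0]
    proof eventually_elim
      case (elim n)
      then show ?case unfolding power_divide of_nat_power using hi[of n] by (intro divide_left_mono) auto
    qed
    show "\<forall>\<^sub>F n in sequentially. real (\<kappa> n ^ 8) / real n \<le> 1"
      using eventually_gt_at_top[of 0]
    proof eventually_elim
      case (elim n)
      then show ?case using lo[of n] by (simp add: divide_le_eq flip: of_nat_power)
    qed
  qed auto
  have diff: "\<bar>s (m + l) - s m\<bar> \<le> real l" for m l
  proof (induction l)
    case (Suc l)
    then show ?case using step[of "m + l"] by simp
  qed simp
  have "(\<lambda>n. (s n - s (\<kappa> n ^ 8)) / real n) \<longlonglongrightarrow> 0"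
  proof (rule Lim_null_comparison)
    show "\<forall>\<^sub>F n in sequentially. norm ((s n - s (\<kappa> n ^ 8)) / real n) \<le> 1 - real (\<kappa> n ^ 8) / real n"
      using eventually_gt_at_top[of 0]
    proof eventually_elim
      case (elim n)
      have "\<bar>s n - s (\<kappa> n ^ 8)\<bar> \<le> real n - real (\<kappa> n ^ 8)"
        using diff[of "\<kappa> n ^ 8" "n - \<kappa> n ^ 8"] lo[of n] by (simp add: of_nat_diff)
      then have "\<bar>s n - s (\<kappa> n ^ 8)\<bar> / real n \<le> (real n - real (\<kappa> n ^ 8)) / real n"
        by (intro divide_right_mono) auto
      moreover have "(real n - real (\<kappa> n ^ 8)) / real n = 1 - real (\<kappa> n ^ 8) / real n"
        using elim by (simp only: diff_divide_distrib) simp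
      ultimately show ?case by (simp only: real_norm_def abs_divide abs_of_nat)
    qed
    show "(\<lambda>n. 1 - real (\<kappa> n ^ 8) / real n) \<longlonglongrightarrow> 0" using tendsto_diff[OF tendsto_const ratio, of 1] by simp
  qed
  moreover have "(\<lambda>n. s (\<kappa> n ^ 8) / real (\<kappa> n ^ 8) * (real (\<kappa> n ^ 8) / real n)) \<longlonglongrightarrow> \<mu> * 1"
    by (intro tendsto_mult ratio) (rule filterlim_compose[OF sub inf])
  ultimately have lim: "(\<lambda>n. (s n - s (\<kappa> n ^ 8)) / real n + s (\<kappa> n ^ 8) / real (\<kappa> n ^ 8) * (real (\<kappa> n ^ 8) / real n)) \<longlonglongrightarrow> 0 + \<mu> * 1"
    by (rule tendsto_add)
  have pos: "\<forall>\<^sub>F n in sequentially. 0 < \<kappa> n"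
    using inf[unfolded filterlim_at_top, rule_format, of 1] by eventually_elim simp
  have "\<forall>\<^sub>F n in sequentially. (s n - s (\<kappa> n ^ 8)) / real n + s (\<kappa> n ^ 8) / real (\<kappa> n ^ 8) * (real (\<kappa> n ^ 8) / real n) = s n / real n"
    using pos by eventually_elim (simp add: diff_divide_distrib)
  from Lim_transform_eventually[OF lim this] show ?thesis by simp
qed

text \<open>The series of normalised squared deviations along k^8 has finite expectation, so it
  converges almost surely and its terms tend to 0. The bound on the steps then fills the gaps of the
  subsequence.\<close>

lemma (in prob_space) variance_LLN:
  fixes S :: "nat \<Rightarrow> 'a \<Rightarrow> real"
  assumes meas: "\<And>n. S n \<in> borel_measurable M"
    and step: "AE \<omega> in M. \<forall>n. \<bar>S (Suc n) \<omega> - S n \<omega>\<bar> \<le> 1"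
    and int: "\<And>n. integrable M (\<lambda>\<omega>. (S n \<omega> - m n)\<^sup>2)"
    and var: "\<And>n. (\<integral>\<omega>. (S n \<omega> - m n)\<^sup>2 \<partial>M) \<le> C * (real n + 1) powr (7 / 4)"
    and mean: "(\<lambda>n. m n / real n) \<longlonglongrightarrow> \<mu>"
  shows "AE \<omega> in M. (\<lambda>n. S n \<omega> / real n) \<longlonglongrightarrow> \<mu>"
proof -
  let ?D = "\<lambda>k \<omega>. ((S (k ^ 8) \<omega> - m (k ^ 8)) / real (k ^ 8))\<^sup>2"
  \<comment> \<open>Of order k^(14 - 16) = k^(-2), hence summable.\<close>
  let ?c = "\<lambda>k. C * ((real (k ^ 8) + 1) powr (7 / 4) / (real (k ^ 8))\<^sup>2)"
  have sum_c: "summable ?c"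
  proof (rule summable_mult, rule summable_comparison_test_bigo)
    show "summable (\<lambda>n. norm (real n powr (- 2)))" by (simp add: summable_real_powr_iff)
    show "(\<lambda>k. (real (k ^ 8) + 1) powr (7 / 4) / (real (k ^ 8))\<^sup>2) \<in> O(\<lambda>n. real n powr (- 2))" by real_asymp
  qed
  have iD: "integrable M (?D k)" for k
    using int[of "k ^ 8"] by (simp add: power_divide)
  have le: "(\<integral>\<omega>. ?D k \<omega> \<partial>M) \<le> ?c k" for k
    using var[of "k ^ 8"] by (simp add: power_divide divide_right_mono)
  have c0: "0 \<le> ?c k" for k by (rule order.trans[OF Bochner_Integration.integral_nonneg le]) simp
  have "(\<integral>\<^sup>+\<omega>. suminf (\<lambda>k. ennreal (?D k \<omega>)) \<partial>M) = suminf (\<lambda>k. \<integral>\<^sup>+\<omega>. ennreal (?D k \<omega>) \<partial>M)"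
    using iD by (intro nn_integral_suminf) (auto dest: borel_measurable_integrable)
  also have "\<dots> = suminf (\<lambda>k. ennreal (\<integral>\<omega>. ?D k \<omega> \<partial>M))"
    using iD by (intro suminf_cong nn_integral_eq_integral) auto
  also have "\<dots> \<le> suminf (\<lambda>k. ennreal (?c k))"
    using le by (intro suminf_le ennreal_leI) auto
  also have "\<dots> < \<infinity>"
    using sum_c c0 by (subst suminf_ennreal2) auto
  finally have fin: "(\<integral>\<^sup>+\<omega>. suminf (\<lambda>k. ennreal (?D k \<omega>)) \<partial>M) \<noteq> \<infinity>" by simp
  have "AE \<omega> in M. suminf (\<lambda>k. ennreal (?D k \<omega>)) \<noteq> \<infinity>"
    by (rule nn_integral_PInf_AE[OF _ fin]) (use meas in measurable)
  then show ?thesis using step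
  proof eventually_elim
    case (elim \<omega>)
    have "summable (\<lambda>k. ?D k \<omega>)" using elim(1) by (intro summable_suminf_not_top) auto
    then have "(\<lambda>k. ?D k \<omega>) \<longlonglongrightarrow> 0" by (rule summable_LIMSEQ_zero)
    then have "(\<lambda>k. sqrt (?D k \<omega>)) \<longlonglongrightarrow> sqrt 0" by (rule tendsto_real_sqrt)
    then have d0: "(\<lambda>k. (S (k ^ 8) \<omega> - m (k ^ 8)) / real (k ^ 8)) \<longlonglongrightarrow> 0"
      by (simp only: real_sqrt_abs real_sqrt_zero tendsto_rabs_zero_iff)
    have "filterlim (\<lambda>k::nat. k ^ 8) at_top sequentially"
      by (rule filterlim_subseq) (auto simp: strict_mono_def intro!: power_strict_mono)
    from filterlim_compose[OF mean this] have "(\<lambda>k. m (k ^ 8) / real (k ^ 8)) \<longlonglongrightarrow> \<mu>" .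
    from tendsto_add[OF d0 this] have "(\<lambda>k. S (k ^ 8) \<omega> / real (k ^ 8)) \<longlonglongrightarrow> \<mu>"
      by (simp add: diff_divide_distrib)
    with elim(2) show ?case by (intro subsequence_interpolation) auto
  qed
qed

section \<open>Second moments of range and displacement\<close>

context erw
begin

text \<open>Dropping \<open>n - k\<close> sites from the history at time n leaves the history at
  time k. The times 0 to n - 1 are those from which the first n steps are made.\<close>

definition news :: "nat \<Rightarrow> site list \<Rightarrow> real" where
  "news n l = (\<Sum>k<n. of_bool (fresh (drop (n - k) l)))"

definition means :: "nat \<Rightarrow> real" where
  "means n = (\<Sum>k<n. pnew d \<beta> k)"

lemma news_history: "news n (history n \<omega>) = real (card (\<omega> ` {..<n}))"
proof -
  have "news n (history n \<omega>) = (\<Sum>k<n. of_bool (\<omega> k \<notin> \<omega> ` {..<k}))"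
    unfolding news_def by (intro sum.cong) (auto simp: drop_history fresh_history)
  also have "\<dots> = real (card (\<omega> ` {..<n}))"
  proof (induction n)
    case (Suc n)
    then show ?case by (simp add: lessThan_Suc card_insert_if)
  qed simp
  finally show ?thesis .
qed

lemma news_run: "length xs = n \<Longrightarrow> news n (run [0] xs) = (\<Sum>k<n. of_bool (newsite (take k xs)))"
  unfolding news_def newsite_def using drop_run[of _ xs] by (intro sum.cong) auto

lemma second_moment_news:
  "(\<integral>\<omega>. (news n (history n \<omega>) - means n)\<^sup>2 \<partial>P) \<le> 4 * real n * (\<Sum>m<n. nocut_sup d G m)"
proof -
  have "(\<integral>\<omega>. (news n (history n \<omega>) - means n)\<^sup>2 \<partial>P) = E n (\<lambda>xs. (news n (run [0] xs) - means n)\<^sup>2)"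
    by (rule integral_history(2)[of "\<lambda>l. (news n l - means n)\<^sup>2"])
  also have "\<dots> = E n (\<lambda>xs. (\<Sum>k<n. centred k xs)\<^sup>2)"
    by (intro expect_cong) (simp add: news_run means_def centred_def sum_subtractf)
  also have "\<dots> \<le> 4 * real n * (\<Sum>m<n. nocut_sup d G m)" by (rule variance)
  finally show ?thesis .
qed

text \<open>The displacement minus its compensator: in direction 1, a step from a new site has mean
  \<beta> / d, any other step mean 0.\<close>

definition mart :: "noise list \<Rightarrow> real" where
  "mart xs = of_int (Poly_Mapping.lookup (hd (run [0] xs)) 1) - \<beta> / real d * news (length xs) (run [0] xs)"

lemma mart_snoc:
  "mart (xs @ [(i, s, b)]) = mart xs + ((if i = 1 then (if b \<and> newsite xs then 1 else of_int s) else 0) - \<beta> / real d * of_bool (newsite xs))"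
  unfolding mart_def news_run[OF refl]
  by (auto simp: next_site_def newsite_def lookup_add lookup_single when_def algebra_simps)

text \<open>Given the past, the increment is centred, so the mixed term vanishes. It is at most 2 in
  absolute value, 1 for the step and 1 for the compensator.\<close>

lemma mart_step: "E 1 (\<lambda>zs. (mart (xs @ zs))\<^sup>2) \<le> (mart xs)\<^sup>2 + 4"
proof -
  let ?q = "\<beta> / real d * of_bool (newsite xs)"
  let ?\<Delta> = "\<lambda>(i, s, b). (if i = (1::nat) then (if b \<and> newsite xs then 1 else of_int s) else 0) - ?q"
  have "(\<Sum>x\<in>Noise d. wt d \<beta> x * ?\<Delta> x) = (\<Sum>i\<in>{1..d}. (if i = 1 then of_bool (newsite xs) * \<beta> / real d else 0) - ?q / real d)"
    unfolding sum_Noise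
  proof (intro sum.cong refl)
    fix i
    show "wt d \<beta> (i, 1, True) * ?\<Delta> (i, 1, True) + wt d \<beta> (i, 1, False) * ?\<Delta> (i, 1, False) + wt d \<beta> (i, -1, True) * ?\<Delta> (i, -1, True) + wt d \<beta> (i, -1, False) * ?\<Delta> (i, -1, False)
        = (if i = 1 then of_bool (newsite xs) * \<beta> / real d else 0) - ?q / real d"
      using d_pos by (cases "newsite xs"; cases "i = 1") (simp_all add: wt_def field_simps)
  qed
  also have "\<dots> = 0" using d_pos by (simp add: sum_subtractf)
  finally have mean: "(\<Sum>x\<in>Noise d. wt d \<beta> x * ?\<Delta> x) = 0" .
  have q: "0 \<le> ?q" "?q \<le> 1" using d_pos \<beta> by (auto simp: field_simps)
  have sq: "(?\<Delta> x)\<^sup>2 \<le> 4" if "x \<in> Noise d" for x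
  proof -
    obtain i s b where x: "x = (i, s, b)" by (cases x)
    have "\<bar>if i = (1::nat) then (if b \<and> newsite xs then 1 else of_int s) else 0\<bar> \<le> (1::real)"
      using that by (auto simp: x Noise_def)
    then have "\<bar>?\<Delta> x\<bar> \<le> 2" using q unfolding x prod.case by linarith
    then show ?thesis using power_mono[of "\<bar>?\<Delta> x\<bar>" 2 2] by simp
  qed
  have "E 1 (\<lambda>zs. (mart (xs @ zs))\<^sup>2) = (\<Sum>x\<in>Noise d. wt d \<beta> x * (mart (xs @ [x]))\<^sup>2)"
    by (simp add: One_nat_def)
  also have "\<dots> = (\<Sum>x\<in>Noise d. wt d \<beta> x * (mart xs + ?\<Delta> x)\<^sup>2)"
  proof (intro sum.cong refl)
    fix x :: noise
    show "wt d \<beta> x * (mart (xs @ [x]))\<^sup>2 = wt d \<beta> x * (mart xs + ?\<Delta> x)\<^sup>2"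
      by (cases x) (simp only: mart_snoc prod.case)
  qed
  also have "\<dots> = (\<Sum>x\<in>Noise d. wt d \<beta> x * (mart xs)\<^sup>2 + 2 * mart xs * (wt d \<beta> x * ?\<Delta> x) + wt d \<beta> x * (?\<Delta> x)\<^sup>2)"
    by (intro sum.cong refl) (simp only: power2_sum distrib_left mult_ac)
  also have "\<dots> = (mart xs)\<^sup>2 + 2 * mart xs * (\<Sum>x\<in>Noise d. wt d \<beta> x * ?\<Delta> x) + (\<Sum>x\<in>Noise d. wt d \<beta> x * (?\<Delta> x)\<^sup>2)"
    by (simp only: sum.distrib sum_distrib_left[symmetric] sum_distrib_right[symmetric] w_sum mult_1)
  also have "(\<Sum>x\<in>Noise d. wt d \<beta> x * (?\<Delta> x)\<^sup>2) \<le> (\<Sum>x\<in>Noise d. wt d \<beta> x * 4)"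
    by (intro sum_mono mult_left_mono sq w_nonneg)
  also have "\<dots> = 4" by (simp only: sum_distrib_right[symmetric] w_sum mult_1)
  finally show ?thesis unfolding mean by simp
qed

lemma second_moment_mart: "E n (\<lambda>xs. (mart xs)\<^sup>2) \<le> 4 * real n"
proof (induction n)
  case 0
  show ?case by (simp add: mart_def news_def)
next
  case (Suc n)
  have "E (Suc n) (\<lambda>xs. (mart xs)\<^sup>2) = E (n + 1) (\<lambda>xs. (mart xs)\<^sup>2)" by simp
  also have "\<dots> = E n (\<lambda>xs. E 1 (\<lambda>zs. (mart (xs @ zs))\<^sup>2))" by (rule expect_append)
  also have "\<dots> \<le> E n (\<lambda>xs. (mart xs)\<^sup>2 + 4)" by (intro E_mono mart_step)
  also have "\<dots> \<le> 4 * real (Suc n)" using Suc by (simp add: expect_add E_const)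
  finally show ?case .
qed

definition disp :: "site list \<Rightarrow> real" where
  "disp l = of_int (Poly_Mapping.lookup (hd l) 1)"

lemma second_moment_disp:
  "(\<integral>\<omega>. (disp (history n \<omega>) - \<beta> / real d * means n)\<^sup>2 \<partial>P) \<le> 8 * real n + 8 * real n * (\<Sum>m<n. nocut_sup d G m)"
proof -
  have "(\<integral>\<omega>. (disp (history n \<omega>) - \<beta> / real d * means n)\<^sup>2 \<partial>P) = E n (\<lambda>xs. (disp (run [0] xs) - \<beta> / real d * means n)\<^sup>2)"
    by (rule integral_history(2)[of "\<lambda>l. (disp l - \<beta> / real d * means n)\<^sup>2"])
  also have "\<dots> \<le> E n (\<lambda>xs. 2 * (mart xs)\<^sup>2 + 2 * (\<Sum>k<n. centred k xs)\<^sup>2)"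
  proof (intro E_mono)
    fix xs :: "noise list" assume "length xs = n"
    then have eq: "disp (run [0] xs) - \<beta> / real d * means n = mart xs + \<beta> / real d * (\<Sum>k<n. centred k xs)"
      by (simp add: disp_def mart_def means_def centred_def news_run sum_subtractf algebra_simps)
    have "(mart xs + \<beta> / real d * (\<Sum>k<n. centred k xs))\<^sup>2 \<le> 2 * (mart xs)\<^sup>2 + 2 * (\<beta> / real d * (\<Sum>k<n. centred k xs))\<^sup>2"
      using zero_le_power2[of "mart xs - \<beta> / real d * (\<Sum>k<n. centred k xs)"] by (simp add: power2_sum power2_diff)
    also have "(\<beta> / real d * (\<Sum>k<n. centred k xs))\<^sup>2 \<le> 1 * (\<Sum>k<n. centred k xs)\<^sup>2"
      unfolding power_mult_distrib using \<beta> d_pos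
      by (intro mult_right_mono) (auto intro!: power_le_one simp: divide_le_eq_1)
    finally show "(disp (run [0] xs) - \<beta> / real d * means n)\<^sup>2 \<le> 2 * (mart xs)\<^sup>2 + 2 * (\<Sum>k<n. centred k xs)\<^sup>2"
      unfolding eq by simp
  qed
  also have "\<dots> = 2 * E n (\<lambda>xs. (mart xs)\<^sup>2) + 2 * E n (\<lambda>xs. (\<Sum>k<n. centred k xs)\<^sup>2)"
    by (simp only: expect_add expect_cmult)
  also have "\<dots> \<le> 2 * (4 * real n) + 2 * (4 * real n * (\<Sum>m<n. nocut_sup d G m))"
    by (intro add_mono mult_left_mono second_moment_mart variance) auto
  finally show ?thesis by simp
qed

lemma AE_disp_step: "AE \<omega> in P. \<forall>n. \<bar>disp (history (Suc n) \<omega>) - disp (history n \<omega>)\<bar> \<le> 1"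
  unfolding AE_all_countable
proof
  fix n
  show "AE \<omega> in P. \<bar>disp (history (Suc n) \<omega>) - disp (history n \<omega>)\<bar> \<le> 1"
    using AE_histories[of "Suc n"]
  proof eventually_elim
    case (elim \<omega>)
    then obtain xs where xs: "set xs \<subseteq> Noise d" "length xs = Suc n" "history (Suc n) \<omega> = run [0] xs"
      unfolding histories_def by auto
    then obtain ys i s b where ys: "xs = ys @ [(i, s, b)]" by (metis length_Suc_conv_rev prod_cases3)
    have l: "run [0] ys = history n \<omega>" "next_site (run [0] ys) (i, s, b) = \<omega> (Suc n)" using xs(3) unfolding ys history_simps by auto
    have "s = 1 \<or> s = -1" using xs(1) unfolding ys by (auto simp: Noise_def)
    then show ?case
      unfolding disp_def hd_history l(2)[symmetric] unfolding l(1)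
      by (auto simp: next_site_def lookup_add lookup_single when_def)
  qed
qed

lemma means_limit:
  assumes "6 \<le> d"
  shows "(\<lambda>n. means n / real n) \<longlonglongrightarrow> newrate d \<beta>"
proof -
  obtain C where C: "0 < C" "\<And>d n. 6 \<le> d \<Longrightarrow> (\<Sum>m<n. nocut_sup d 5 m) \<le> C * (real n + 1) powr (3 / 4)"
    using nocut_sup_5 by blast
  have "(\<lambda>n. means n / real n - newrate d \<beta>) \<longlonglongrightarrow> 0"
  proof (rule Lim_null_comparison)
    show "\<forall>\<^sub>F n in sequentially. norm (means n / real n - newrate d \<beta>) \<le> C * ((real n + 1) powr (3 / 4) / real n)"
      using eventually_gt_at_top[of 0]
    proof eventually_elim
      case (elim n)
      have "means n / real n - newrate d \<beta> = (\<Sum>k<n. pnew d \<beta> k - newrate d \<beta>) / real n"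
        using elim by (simp add: means_def sum_subtractf diff_divide_distrib)
      also have "norm \<dots> = \<bar>\<Sum>k<n. pnew d \<beta> k - newrate d \<beta>\<bar> / real n" by simp
      also have "\<dots> \<le> (\<Sum>k<n. nocut_sup d 5 k) / real n"
      proof (intro divide_right_mono order.trans[OF sum_abs] sum_mono)
        fix k
        show "\<bar>pnew d \<beta> k - newrate d \<beta>\<bar> \<le> nocut_sup d 5 k"
          using pnew_newrate[OF assms, of \<beta> k] \<beta> by (simp add: abs_minus_commute)
      qed simp
      also have "\<dots> \<le> C * (real n + 1) powr (3 / 4) / real n"
        by (intro divide_right_mono C assms) simp
      finally show ?case by simp
    qed
    have "(\<lambda>n. (real n + 1) powr (3 / 4) / real n) \<longlonglongrightarrow> 0" by real_asymp
    then show "(\<lambda>n. C * ((real n + 1) powr (3 / 4) / real n)) \<longlonglongrightarrow> 0" by (rule tendsto_mult_right_zero)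
  qed
  then show ?thesis by (rule LIM_zero_cancel)
qed

lemma moment_bound:
  assumes "6 \<le> d"
  obtains C where "\<And>n. 8 * real n + 8 * real n * (\<Sum>m<n. nocut_sup d 5 m) \<le> C * (real n + 1) powr (7 / 4)"
proof -
  obtain C where C: "0 < C" "\<And>d n. 6 \<le> d \<Longrightarrow> (\<Sum>m<n. nocut_sup d 5 m) \<le> C * (real n + 1) powr (3 / 4)"
    using nocut_sup_5 by blast
  have "8 * real n + 8 * real n * (\<Sum>m<n. nocut_sup d 5 m) \<le> (8 + 8 * C) * (real n + 1) powr (7 / 4)" for n
  proof -
    have "1 \<le> (real n + 1) powr (3 / 4)" by (intro ge_one_powr_ge_zero) auto
    then have "8 + 8 * (\<Sum>m<n. nocut_sup d 5 m) \<le> (8 + 8 * C) * (real n + 1) powr (3 / 4)"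
      using C(2)[OF assms, of n] by (simp add: distrib_right)
    then have "real n * (8 + 8 * (\<Sum>m<n. nocut_sup d 5 m)) \<le> (real n + 1) * ((8 + 8 * C) * (real n + 1) powr (3 / 4))"
      using C(1) by (intro mult_mono) (auto intro!: add_nonneg_nonneg sum_nonneg nocut_sup_nonneg[OF d_pos])
    also have "\<dots> = (8 + 8 * C) * ((real n + 1) powr 1 * (real n + 1) powr (3 / 4))" by simp
    also have "(real n + 1) powr 1 * (real n + 1) powr (3 / 4) = (real n + 1) powr (7 / 4)"
      unfolding powr_add[symmetric] by simp
    finally show ?thesis by (simp add: algebra_simps)
  qed
  then show thesis using that by blast
qed

lemma range_LLN:
  assumes d: "6 \<le> d"
  shows "AE \<omega> in P. (\<lambda>n. real (card (\<omega> ` {..<n})) / real n) \<longlonglongrightarrow> newrate d \<beta>"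
proof -
  interpret prob_space P by (rule prob_P)
  obtain C where C: "\<And>n. 8 * real n + 8 * real n * (\<Sum>m<n. nocut_sup d 5 m) \<le> C * (real n + 1) powr (7 / 4)"
    using moment_bound[OF d] by blast
  have "AE \<omega> in P. (\<lambda>n. news n (history n \<omega>) / real n) \<longlonglongrightarrow> newrate d \<beta>"
  proof (rule variance_LLN[OF _ _ _ _ means_limit[OF d]])
    show "(\<lambda>\<omega>. news n (history n \<omega>)) \<in> borel_measurable P" for n by (rule measurable_history)
    show "AE \<omega> in P. \<forall>n. \<bar>news (Suc n) (history (Suc n) \<omega>) - news n (history n \<omega>)\<bar> \<le> 1"
      unfolding news_history by (auto simp: lessThan_Suc card_insert_if)
    show "integrable P (\<lambda>\<omega>. (news n (history n \<omega>) - means n)\<^sup>2)" for n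
      by (rule integral_history(1)[of "\<lambda>l. (news n l - means n)\<^sup>2"])
    show "(\<integral>\<omega>. (news n (history n \<omega>) - means n)\<^sup>2 \<partial>P) \<le> C * (real n + 1) powr (7 / 4)" for n
    proof -
      have "0 \<le> real n * (\<Sum>m<n. nocut_sup d 5 m)" by (intro mult_nonneg_nonneg sum_nonneg nocut_sup_nonneg[OF d_pos]) auto
      then show ?thesis using second_moment_news[of n 5] C[of n] by simp
    qed
  qed
  then show ?thesis unfolding news_history .
qed

lemma displacement_LLN:
  assumes d: "6 \<le> d"
  shows "AE \<omega> in P. (\<lambda>n. of_int (Poly_Mapping.lookup (\<omega> n) 1) / real n) \<longlonglongrightarrow> \<beta> / real d * newrate d \<beta>"
proof -
  interpret prob_space P by (rule prob_P)
  obtain C where C: "\<And>n. 8 * real n + 8 * real n * (\<Sum>m<n. nocut_sup d 5 m) \<le> C * (real n + 1) powr (7 / 4)"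
    using moment_bound[OF d] by blast
  have "AE \<omega> in P. (\<lambda>n. disp (history n \<omega>) / real n) \<longlonglongrightarrow> \<beta> / real d * newrate d \<beta>"
  proof (rule variance_LLN[where m = "\<lambda>n. \<beta> / real d * means n"])
    show "(\<lambda>\<omega>. disp (history n \<omega>)) \<in> borel_measurable P" for n by (rule measurable_history)
    show "AE \<omega> in P. \<forall>n. \<bar>disp (history (Suc n) \<omega>) - disp (history n \<omega>)\<bar> \<le> 1" by (rule AE_disp_step)
    show "integrable P (\<lambda>\<omega>. (disp (history n \<omega>) - \<beta> / real d * means n)\<^sup>2)" for n
      by (rule integral_history(1)[of "\<lambda>l. (disp l - \<beta> / real d * means n)\<^sup>2"])
    show "(\<integral>\<omega>. (disp (history n \<omega>) - \<beta> / real d * means n)\<^sup>2 \<partial>P) \<le> C * (real n + 1) powr (7 / 4)" for n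
      using second_moment_disp[of n 5] C[of n] by simp
    show "(\<lambda>n. \<beta> / real d * means n / real n) \<longlonglongrightarrow> \<beta> / real d * newrate d \<beta>"
      using tendsto_mult_left[OF means_limit[OF d], of "\<beta> / real d"] by simp
  qed
  then show ?thesis by (simp add: disp_def)
qed

lemma THE_AE_limit:
  fixes X :: "nat \<Rightarrow> (nat \<Rightarrow> site) \<Rightarrow> real"
  assumes "AE \<omega> in P. (\<lambda>n. X n \<omega>) \<longlonglongrightarrow> L"
  shows "(THE v. AE \<omega> in P. (\<lambda>n. X n \<omega>) \<longlonglongrightarrow> v) = L"
proof (rule the_equality)
  interpret prob_space P by (rule prob_P)
  fix v assume "AE \<omega> in P. (\<lambda>n. X n \<omega>) \<longlonglongrightarrow> v"
  with assms have "AE \<omega> in P. v = L"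
    by eventually_elim (rule LIMSEQ_unique)
  then show "v = L" by (simp add: AE_const)
qed (rule assms)

end

section \<open>Speed, derivative at zero and monotonicity\<close>

lemma speed_eq:
  assumes "6 \<le> d" "\<beta> \<in> {0..1}"
  shows "speed d \<beta> = \<beta> / real d * newrate d \<beta>"
proof -
  interpret erw d \<beta> using assms by (rule erwI)
  show ?thesis unfolding speed_def by (rule THE_AE_limit[OF displacement_LLN[OF assms(1)]])
qed

lemma range_rate_eq:
  assumes "6 \<le> d"
  shows "range_rate d = newrate d 0"
proof -
  interpret erw d 0 using assms by (intro erwI) auto
  have "srw_prob d = erw_prob d 0" by (simp add: srw_prob_def erw_prob_def fun_eq_iff)
  then have "srw_law d = erw_law d 0" by (simp add: srw_law_def erw_law_def)
  then show ?thesis unfolding range_rate_def by (simp only: THE_AE_limit[OF range_LLN[OF assms]])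
qed

theorem theorem1p3:
  shows
    "(\<forall>d\<ge>8. speed d differentiable_on {0..<1}) \<and>
     (\<forall>d\<ge>6. \<exists>D. (speed d has_real_derivative D) (at_right 0) \<and> D > 0 \<and>
        ((\<lambda>\<beta>. speed d \<beta> / \<beta>) \<longlongrightarrow> D) (at_right 0) \<and>
        D = 1 / real d * range_rate d) \<and>
     (\<exists>d\<^sub>0>0. \<exists>\<beta>\<^sub>0. 0 < \<beta>\<^sub>0 \<and> \<beta>\<^sub>0 < 1 \<and>
        (\<forall>d\<ge>d\<^sub>0. strict_mono_on {0..1} (speed d)) \<and>
        (\<forall>d\<ge>8. strict_mono_on {0..<\<beta>\<^sub>0} (speed d)))"
proof (intro conjI)
  obtain \<delta> where \<delta>: "0 < \<delta>" "\<And>d \<beta>. 6 \<le> d \<Longrightarrow> \<beta> \<in> {0..1} \<Longrightarrow> \<delta> \<le> newrate d \<beta>"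
    using newrate_ge by blast
  obtain C where C: "0 < C" "\<And>d \<beta> \<beta>'. 8 \<le> d \<Longrightarrow> \<beta> \<in> {0..1} \<Longrightarrow> \<beta>' \<in> {0..1} \<Longrightarrow>
    \<bar>newrate d \<beta> - newrate d \<beta>'\<bar> \<le> C / real d * \<bar>\<beta> - \<beta>'\<bar>"
    using newrate_Lipschitz by blast
  show "\<forall>d\<ge>8. speed d differentiable_on {0..<1}"
  proof (intro allI impI)
    fix d :: nat assume d: "8 \<le> d"
    have "newrate d differentiable_on {0..<1}"
      using newrate_differentiable[OF d] by (rule differentiable_on_subset) auto
    then have *: "(\<lambda>\<beta>. \<beta> / real d * newrate d \<beta>) differentiable_on {0..<1}"
      using d unfolding differentiable_on_def by (auto intro!: derivative_intros)
    show "speed d differentiable_on {0..<1}"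
      unfolding differentiable_on_def
    proof
      fix x :: real assume x: "x \<in> {0..<1}"
      have "(\<lambda>\<beta>. \<beta> / real d * newrate d \<beta>) differentiable (at x within {0..<1})"
        using * x unfolding differentiable_on_def by blast
      then show "speed d differentiable (at x within {0..<1})"
        by (rule differentiable_transform_within[of _ _ _ 1]) (use x d in \<open>auto simp: speed_eq\<close>)
    qed
  qed
  show "\<forall>d\<ge>6. \<exists>D. (speed d has_real_derivative D) (at_right 0) \<and> D > 0 \<and>
      ((\<lambda>\<beta>. speed d \<beta> / \<beta>) \<longlongrightarrow> D) (at_right 0) \<and> D = 1 / real d * range_rate d"
  proof (intro allI impI)
    fix d :: nat assume d: "6 \<le> d"
    define D where "D = 1 / real d * range_rate d"
    have D: "D = 1 / real d * newrate d 0" by (simp only: D_def range_rate_eq[OF d])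
    have "((\<lambda>\<beta>. newrate d \<beta>) \<longlongrightarrow> newrate d 0) (at 0 within {0..1})"
      using continuous_newrate[OF d] unfolding continuous_on_def by auto
    then have "((\<lambda>\<beta>. newrate d \<beta>) \<longlongrightarrow> newrate d 0) (at_right 0)"
      by (simp add: at_within_Icc_at_right)
    then have lim: "((\<lambda>\<beta>. 1 / real d * newrate d \<beta>) \<longlongrightarrow> D) (at_right 0)"
      unfolding D by (rule tendsto_mult_left)
    have ev: "\<forall>\<^sub>F \<beta> in at_right 0. 1 / real d * newrate d \<beta> = speed d \<beta> / \<beta>"
      using eventually_at_right_real[OF zero_less_one]
    proof eventually_elim
      case (elim \<beta>)
      then show ?case using d by (simp add: speed_eq)
    qed
    have lim': "((\<lambda>\<beta>. speed d \<beta> / \<beta>) \<longlongrightarrow> D) (at_right 0)"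
      using lim ev by (rule Lim_transform_eventually)
    have "speed d 0 = 0" using d by (simp add: speed_eq)
    then have "(speed d has_real_derivative D) (at_right 0)"
      using lim' by (simp add: has_field_derivative_iff)
    moreover have "D > 0" using \<delta>(2)[OF d, of 0] \<delta>(1) d by (simp add: D)
    ultimately show "\<exists>D. (speed d has_real_derivative D) (at_right 0) \<and> D > 0 \<and>
        ((\<lambda>\<beta>. speed d \<beta> / \<beta>) \<longlongrightarrow> D) (at_right 0) \<and> D = 1 / real d * range_rate d"
      using lim' D_def by blast
  qed
  \<comment> \<open>Writing r for \<open>newrate d\<close>, y r(y) - x r(x) = (y - x) r(y) + x (r(y)
    - r(x)). The first term is at least (y - x) \<delta>, the second at least - x (y - x) C /
    d.\<close>
  have mono: "speed d x < speed d y"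
    if d: "8 \<le> d" and xy: "0 \<le> x" "x < y" "y \<le> 1" and small: "x * (C / real d) < \<delta>" for d x y
  proof -
    have "x * \<bar>newrate d y - newrate d x\<bar> \<le> x * (C / real d * \<bar>y - x\<bar>)"
      using xy by (intro mult_left_mono C(2)[OF d]) auto
    also have "\<dots> = x * (C / real d) * (y - x)" using xy by simp
    also have "\<dots> < \<delta> * (y - x)" using small xy by (intro mult_strict_right_mono) auto
    also have "\<dots> \<le> newrate d y * (y - x)" using \<delta>(2)[of d y] d xy by (intro mult_right_mono) auto
    finally have "x * \<bar>newrate d y - newrate d x\<bar> < newrate d y * (y - x)" .
    moreover have "x * (newrate d x - newrate d y) \<le> x * \<bar>newrate d y - newrate d x\<bar>"
      using xy by (intro mult_left_mono) auto
    ultimately have "x * newrate d x < y * newrate d y" by (simp add: algebra_simps)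
    then have "x * newrate d x / real d < y * newrate d y / real d"
      using d by (intro divide_strict_right_mono) auto
    then show ?thesis using d xy by (simp add: speed_eq)
  qed
  show "\<exists>d\<^sub>0>0. \<exists>\<beta>\<^sub>0. 0 < \<beta>\<^sub>0 \<and> \<beta>\<^sub>0 < 1 \<and>
      (\<forall>d\<ge>d\<^sub>0. strict_mono_on {0..1} (speed d)) \<and> (\<forall>d\<ge>8. strict_mono_on {0..<\<beta>\<^sub>0} (speed d))"
  proof (intro exI conjI allI impI)
    \<comment> \<open>For d > C / \<delta> the condition x C / d < \<delta> holds for all x \<le> 1.
      For every other d \<ge> 8 it is enforced by x < \<delta> / C; the value 1/2 keeps
      \<open>\<beta>0\<close> below 1.\<close>
    define d0 where "d0 = max 8 (nat \<lceil>C / \<delta>\<rceil> + 1)"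
    define \<beta>0 where "\<beta>0 = min (1 / 2) (\<delta> / C)"
    show "0 < d0" by (simp add: d0_def)
    show "0 < \<beta>0" "\<beta>0 < 1" using \<delta>(1) C(1) by (auto simp: \<beta>0_def)
    show "strict_mono_on {0..1} (speed d)" if d: "d0 \<le> d" for d
    proof (intro strict_mono_onI mono)
      show "8 \<le> d" using d by (simp add: d0_def)
      have "C / \<delta> < real d" using d unfolding d0_def by linarith
      then have Cd: "C / real d < \<delta>" using \<delta>(1) \<open>8 \<le> d\<close> by (simp add: field_simps)
      fix x y :: real assume "x \<in> {0..1}" "y \<in> {0..1}"
      have "x * (C / real d) \<le> 1 * (C / real d)"
        using \<open>x \<in> {0..1}\<close> C(1) by (intro mult_right_mono) auto
      then show "x * (C / real d) < \<delta>" using Cd by simp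
    qed auto
    show "strict_mono_on {0..<\<beta>0} (speed d)" if d: "8 \<le> d" for d
    proof (intro strict_mono_onI mono d)
      fix x y :: real assume x: "x \<in> {0..<\<beta>0}"
      have "x * (C / real d) \<le> x * C" using x C(1) d by (intro mult_left_mono) (auto simp: divide_le_eq)
      also have "x * C < \<delta>" using x C(1) by (auto simp: \<beta>0_def field_simps)
      finally show "x * (C / real d) < \<delta>" .
    qed (auto simp: \<beta>0_def)
  qed
qed

end
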